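(* Let $1<p<\infty$, $k\in\mathbb{N}$, and let $\omega$ and $\nu$ be radial weights on $\mathbb{D}$. If $P_\omega:L^p_\nu\to D^p_{\nu,k}$ is bounded, then $P_\nu:L^p_\nu\to D^p_{\nu,k}$ and $P_\nu:L^p_\nu\to L^p_\nu$ are bounded.
   Context: Let $\mathbb{D}=\{z\in\mathbb{C}:|z|<1\}$, let $dA=\frac{dx\,dy}{\pi}$ be normalized area measure on $\mathbb{D}$, and let $\mathcal{H}(\mathbb{D})$ be the space of analytic functions in $\mathbb{D}$. A radial weight is a non-negative function $\omega\in L^1(\mathbb{D})$ with $\omega(z)=\omega(|z|)$ for all $z\in\mathbb{D}$; throughout it is assumed that $\int_{|z|}^1\omega(s)\,ds>0$ for all $z\in\mathbb{D}$. For $0<p<\infty$, $L^p_\omega$ is the space of complex-valued measurable $f$ on $\mathbb{D}$ with $\|f\|_{L^p_\omega}^p=\int_{\mathbb{D}}|f|^p\omega\,dA<\infty$, and $A^p_\omega=L^p_\omega\cap\mathcal{H}(\mathbb{D})$. For $k\in\mathbb{N}=\{1,2,\dots\}$, the Dirichlet space $D^p_{\nu,k}$ consists of $f\in\mathcal{H}(\mathbb{D})$ with $$\|f\|_{D^p_{\nu,k}}^p=\sum_{j=0}^{k-1}|f^{(j)}(0)|^p+\int_{\mathbb{D}}|f^{(k)}(z)|^p(1-|z|)^{kp}\nu(z)\,dA(z)<\infty.$$ $B^\omega_z\in A^2_\omega$ denotes the reproducing kernel of $A^2_\omega$ at $z\in\mathbb{D}$: $f(z)=\int_{\mathbb{D}}f(\zeta)\overline{B^\omega_z(\zeta)}\omega(\zeta)\,dA(\zeta)$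 for all $f\in A^2_\omega$. Equivalently $B^\omega_z(\zeta)=\sum_{n=0}^\infty\frac{(\overline z\zeta)^n}{2\omega_{2n+1}}$, where $\omega_x=\int_0^1r^x\omega(r)\,dr$. The Bergman projection induced by $\omega$ is $$P_\omega(f)(z)=\int_{\mathbb{D}}f(\zeta)\overline{B^\omega_z(\zeta)}\,\omega(\zeta)\,dA(\zeta),\quad z\in\mathbb{D},$$ and $P_\nu$ is defined likewise with $\nu$ in place of $\omega$. Boundedness of an operator $T:L^p_\nu\to X$ means that $T(f)$ is well defined for every $f\in L^p_\nu$ and $\|T(f)\|_X\le C\|f\|_{L^p_\nu}$ for some constant $C$. *)

theory Defs
  imports "HOL-Complex_Analysis.Complex_Analysis"
begin

abbreviation unit_disc :: "complex set" where
  "unit_disc \<equiv> ball 0 1"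

definition disc_area :: "complex measure" where
  "disc_area = density (lebesgue_on unit_disc) (\<lambda>_. ennreal (1 / pi))"

text \<open>
  Functions on the disc are represented by functions on the whole plane; every notion below
  depends only on their values on the open unit disc.
  The tail condition is stated with the extended integral, because for an integrable radial
  weight \<open>\<integral>\<^sub>0\<^sup>1 \<omega>(s) ds\<close> may be infinite (the area integral only controls \<open>\<omega>(s) s\<close>).
\<close>

definition radial_weight :: "(complex \<Rightarrow> real) \<Rightarrow> bool" where
  "radial_weight \<omega> \<longleftrightarrow>
     (\<forall>z\<in>unit_disc. 0 \<le> \<omega> z) \<and>
     integrable disc_area \<omega> \<and>
     (\<forall>z\<in>unit_disc. \<omega> z = \<omega> (complex_of_real (cmod z))) \<and>
     (\<forall>z\<in>unit_disc. 0 < (\<integral>\<^sup>+ s\<in>{cmod z<..<1}. ennreal (\<omega> (complex_of_real s)) \<partial>lebesgue))"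

definition Lp_space :: "real \<Rightarrow> (complex \<Rightarrow> real) \<Rightarrow> (complex \<Rightarrow> complex) set" where
  "Lp_space p \<omega> = {f. f \<in> borel_measurable disc_area \<and>
                      integrable disc_area (\<lambda>z. cmod (f z) powr p * \<omega> z)}"

definition Lp_norm :: "real \<Rightarrow> (complex \<Rightarrow> real) \<Rightarrow> (complex \<Rightarrow> complex) \<Rightarrow> real" where
  "Lp_norm p \<omega> f = (LINT z|disc_area. cmod (f z) powr p * \<omega> z) powr (1 / p)"

definition bergman_space :: "real \<Rightarrow> (complex \<Rightarrow> real) \<Rightarrow> (complex \<Rightarrow> complex) set" where
  "bergman_space p \<omega> = Lp_space p \<omega> \<inter> {f. f holomorphic_on unit_disc}"

definition dirichlet_space ::
  "real \<Rightarrow> (complex \<Rightarrow> real) \<Rightarrow> nat \<Rightarrow> (complex \<Rightarrow> complex) set" where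
  "dirichlet_space p \<nu> k = {f. f holomorphic_on unit_disc \<and>
     integrable disc_area
       (\<lambda>z. cmod ((deriv ^^ k) f z) powr p * (1 - cmod z) powr (real k * p) * \<nu> z)}"

definition dirichlet_norm ::
  "real \<Rightarrow> (complex \<Rightarrow> real) \<Rightarrow> nat \<Rightarrow> (complex \<Rightarrow> complex) \<Rightarrow> real" where
  "dirichlet_norm p \<nu> k f =
     ((\<Sum>j<k. cmod ((deriv ^^ j) f 0) powr p) +
      (LINT z|disc_area.
         cmod ((deriv ^^ k) f z) powr p * (1 - cmod z) powr (real k * p) * \<nu> z)) powr (1 / p)"

definition is_reproducing_kernel ::
  "(complex \<Rightarrow> real) \<Rightarrow> complex \<Rightarrow> (complex \<Rightarrow> complex) \<Rightarrow> bool" where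
  "is_reproducing_kernel \<omega> z B \<longleftrightarrow>
     B \<in> bergman_space 2 \<omega> \<and>
     (\<forall>f\<in>bergman_space 2 \<omega>.
        f z = (LINT \<zeta>|disc_area. f \<zeta> * cnj (B \<zeta>) * complex_of_real (\<omega> \<zeta>)))"

text \<open>
  For a radial weight and \<open>z\<close> in the disc, the reproducing kernel is unique as a function on the
  disc; the choice operator only fixes its irrelevant values outside the disc.
\<close>

definition bergman_kernel :: "(complex \<Rightarrow> real) \<Rightarrow> complex \<Rightarrow> complex \<Rightarrow> complex" where
  "bergman_kernel \<omega> z = (SOME B. is_reproducing_kernel \<omega> z B)"

definition bergman_proj ::
  "(complex \<Rightarrow> real) \<Rightarrow> (complex \<Rightarrow> complex) \<Rightarrow> complex \<Rightarrow> complex" where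
  "bergman_proj \<omega> f z =
     (LINT \<zeta>|disc_area. f \<zeta> * cnj (bergman_kernel \<omega> z \<zeta>) * complex_of_real (\<omega> \<zeta>))"

text \<open>
  Boundedness of the projection from \<open>X\<close> (with norm \<open>nX\<close>) to \<open>Y\<close> (with norm \<open>nY\<close>). The first
  conjunct says that the projection is well defined on \<open>X\<close>; it is needed because the Bochner
  integral of a non-integrable function is \<open>0\<close>.
\<close>

definition bergman_proj_bounded ::
  "(complex \<Rightarrow> real) \<Rightarrow>
   (complex \<Rightarrow> complex) set \<Rightarrow> ((complex \<Rightarrow> complex) \<Rightarrow> real) \<Rightarrow>
   (complex \<Rightarrow> complex) set \<Rightarrow> ((complex \<Rightarrow> complex) \<Rightarrow> real) \<Rightarrow> bool" where
  "bergman_proj_bounded \<omega> X nX Y nY \<longleftrightarrow>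
     (\<forall>f\<in>X. \<forall>z\<in>unit_disc.
        integrable disc_area
          (\<lambda>\<zeta>. f \<zeta> * cnj (bergman_kernel \<omega> z \<zeta>) * complex_of_real (\<omega> \<zeta>))) \<and>
     (\<forall>f\<in>X. bergman_proj \<omega> f \<in> Y) \<and>
     (\<exists>C. \<forall>f\<in>X. nY (bergman_proj \<omega> f) \<le> C * nX f)"

end

theory Submission
  imports Defs "HOL-Probability.Probability_Measure"
begin

text \<open>
  Let \<open>N(r)\<close> be the mass that \<open>\<nu> dA\<close> gives to \<open>{|z| \<ge> r}\<close>. Since \<open>P\<^sub>\<omega> z^n = z^n\<close>, testing the hypothesis on
  monomials shows that most of \<open>\<integral> |z|^(np) \<nu> dA\<close> is carried by \<open>{|z| > 1 - C/n}\<close>, which forces the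
  doubling condition \<open>N(r) \<le> D N((1+r)/2)\<close>. Conversely, let \<open>N\<close> be doubling. On circles, \<open>P\<^sub>\<nu>\<close> acts by the
  Fourier multipliers \<open>\<rho>^n / m\<^sub>n\<close>, where \<open>m\<^sub>n\<close> are the moments of \<open>\<nu>\<close>. These have total variation at most
  \<open>C / N(\<rho>)\<close>, so the theorem of M. Riesz bounds their norm on \<open>L^p\<close> of the circle by \<open>C / N(\<rho>)\<close>. It
  remains to bound on \<open>L^p(\<nu>)\<close> the positive kernel \<open>1 / max (N(|z|), N(|\<zeta>|))\<close>, and this is Schur's test with
  powers of \<open>N\<close>. The derivatives are controlled by Cauchy's formula on circles of radius \<open>(1-|z|)/2\<close>.
\<close>

section \<open>The circle\<close>

text \<open>For slowly decreasing tails the means over circles of the modulus of the Bergman kernel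
  exceed 1 / N by a logarithm, so cancellation on circles has to be kept; this is where 1 < p <
  \<infinity> enters. It can be kept because the projection of a radial measure commutes with
  rotations and acts between two circles as a Fourier multiplier; only the interaction of different
  radii is estimated by absolute values. Schur's test for the resulting kernel depends on \<nu> only
  through the inequality M {N \<le> t} \<le> t. The testing step rests on the size of the k-th
  derivative of z^n: multiplied by (1-|z|)^k it is about (n (1-|z|))^k |z|^n. Where n (1-|z|) is
  large this factor is large, while the hypothesis bounds the integral of its p-th power by a
  multiple of that of |z|^(np). Doubling is spent twice: the multiplier with coefficients r^n / m_n
  is controlled by the tail at a radius somewhat closer to 1 than r, and Cauchy's formula compares
  circles whose distances to the boundary differ by a bounded factor.\<close>

lemma lborel_nn_integral_translate:
  fixes g :: "'a::euclidean_space \<Rightarrow> ennreal"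
  assumes [measurable]: "g \<in> borel_measurable borel"
  shows "(\<integral>\<^sup>+ x. g (x + y) \<partial>lborel) = (\<integral>\<^sup>+ x. g x \<partial>lborel)"
proof -
  have "(\<integral>\<^sup>+ x. g x \<partial>lborel) = (\<integral>\<^sup>+ x. g x \<partial>distr lborel borel ((+) y))"
    by (simp add: lborel_distr_plus)
  also have "\<dots> = (\<integral>\<^sup>+ x. g (x + y) \<partial>lborel)"
    by (subst nn_integral_distr) (auto simp: add.commute)
  finally show ?thesis by simp
qed

text \<open>Uniqueness of Haar measure by one double integral. Integrating
  \<open>indicator B y * indicator A (x + y)\<close> first in \<open>x\<close> gives the left side;
  in the other order the translation of \<open>y\<close> by \<open>- x\<close> moves the shift to
  \<open>B\<close>, and invariance of \<open>R\<close> yields the right side. It replaces a change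
  of variables formula for rotations.\<close>

lemma translation_invariant_unique:
  fixes R :: "'a::euclidean_space measure"
  assumes R: "sigma_finite_measure R" and sets[measurable_cong]: "sets R = sets borel"
    and inv: "\<And>g y. g \<in> borel_measurable borel \<Longrightarrow>
       (\<integral>\<^sup>+ x. g (x + y) \<partial>R) = (\<integral>\<^sup>+ x. g x \<partial>R)"
    and [measurable]: "A \<in> sets borel" "B \<in> sets borel"
  shows "emeasure R A * emeasure lborel B = emeasure lborel A * emeasure R (uminus -` B)"
proof -
  interpret R: sigma_finite_measure R by fact
  interpret P: pair_sigma_finite lborel R ..
  have [measurable]: "uminus -` B \<in> sets borel"
    using measurable_sets[of uminus borel borel B] by simp
  have "emeasure R A * emeasure lborel B = (\<integral>\<^sup>+ y. indicator B y * emeasure R A \<partial>lborel)"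
    by (simp add: nn_integral_multc mult.commute)
  also have "\<dots> = (\<integral>\<^sup>+ y. (\<integral>\<^sup>+ x. indicator B y * indicator A (x + y) \<partial>R) \<partial>lborel)"
    using sets by (subst nn_integral_cmult) (auto simp: inv[of "indicator A"] intro!: nn_integral_cong)
  also have "\<dots> = (\<integral>\<^sup>+ x. (\<integral>\<^sup>+ y. indicator B y * indicator A (x + y) \<partial>lborel) \<partial>R)"
    by (rule P.Fubini'[symmetric]) measurable
  also have "\<dots> = (\<integral>\<^sup>+ x. (\<integral>\<^sup>+ y. indicator B (y - x) * indicator A y \<partial>lborel) \<partial>R)"
  proof (rule nn_integral_cong)
    fix x
    have "(\<integral>\<^sup>+ y. (indicator B ((y + x) - x) * indicator A (y + x) :: ennreal) \<partial>lborel)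
      = (\<integral>\<^sup>+ y. indicator B (y - x) * indicator A y \<partial>lborel)"
      by (rule lborel_nn_integral_translate[where g="\<lambda>y. indicator B (y - x) * indicator A y"]) measurable
    then show "(\<integral>\<^sup>+ y. (indicator B y * indicator A (x + y) :: ennreal) \<partial>lborel)
      = (\<integral>\<^sup>+ y. indicator B (y - x) * indicator A y \<partial>lborel)" by (simp add: add.commute)
  qed
  also have "\<dots> = (\<integral>\<^sup>+ y. (\<integral>\<^sup>+ x. indicator B (y - x) * indicator A y \<partial>R) \<partial>lborel)"
    by (rule P.Fubini') measurable
  also have "\<dots> = (\<integral>\<^sup>+ y. emeasure R (uminus -` B) * indicator A y \<partial>lborel)"
  proof (rule nn_integral_cong)
    fix y
    have "(\<integral>\<^sup>+ x. indicator B (y - x) \<partial>R) = (\<integral>\<^sup>+ x. indicator B (y - (x + y)) \<partial>R)"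
      by (rule inv[where g="\<lambda>x. indicator B (y - x)", symmetric]) measurable
    also have "\<dots> = (\<integral>\<^sup>+ x. indicator (uminus -` B) x \<partial>R)"
      by (intro nn_integral_cong) (auto simp: indicator_def)
    also have "\<dots> = emeasure R (uminus -` B)" using sets by simp
    finally show "(\<integral>\<^sup>+ x. indicator B (y - x) * indicator A y \<partial>R)
        = emeasure R (uminus -` B) * indicator A y"
      using sets by (subst nn_integral_multc) auto
  qed
  also have "\<dots> = emeasure lborel A * emeasure R (uminus -` B)"
    by (subst nn_integral_cmult) (simp_all add: mult.commute)
  finally show ?thesis .
qed

lemma emeasure_unit_ball:
  "emeasure lborel (ball (0::complex) 1) \<noteq> 0" "emeasure lborel (ball (0::complex) 1) \<noteq> \<infinity>"
proof -
  show "emeasure lborel (ball (0::complex) 1) \<noteq> 0"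
    using open_not_negligible[of "ball (0::complex) 1"]
    by (auto simp: negligible_iff_null_sets null_sets_def)
  show "emeasure lborel (ball (0::complex) 1) \<noteq> \<infinity>"
    using emeasure_bounded_finite[of "ball (0::complex) 1"] by auto
qed

text \<open>The image of Lebesgue measure under a rotation is again translation invariant, hence a
  multiple of it. The closed unit disc, which rotations and \<open>uminus\<close> preserve, shows
  that the factor is 1.\<close>

lemma lborel_distr_rotation:
  fixes e :: complex
  assumes e: "cmod e = 1"
  shows "distr lborel borel ((*) e) = lborel"
proof (rule measure_eqI)
  let ?R = "distr lborel borel ((*) e)"
  have e0: "e \<noteq> 0" using e by auto
  have ball: "emeasure ?R (cball 0 r) = emeasure lborel (cball (0::complex) r)" for r
  proof -
    have "(*) e -` cball 0 r = cball (0::complex) r" using e by (auto simp: norm_mult)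
    then show ?thesis by (subst emeasure_distr) auto
  qed
  have fin: "emeasure ?R (cball 0 r) \<noteq> \<infinity>" for r
    unfolding ball using emeasure_bounded_finite[of "cball (0::complex) r"] by auto
  have sf: "sigma_finite_measure ?R"
  proof
    show "\<exists>A. countable A \<and> A \<subseteq> sets ?R \<and> \<Union> A = space ?R \<and> (\<forall>a\<in>A. emeasure ?R a \<noteq> \<infinity>)"
      using real_arch_simple
      by (intro exI[of _ "range (\<lambda>n::nat. cball 0 (real n))"])
         (auto simp: fin[unfolded infinity_ennreal_def])
  qed
  fix A assume "A \<in> sets ?R"
  then have A: "A \<in> sets borel" by simp
  have inv: "(\<integral>\<^sup>+ x. g (x + y) \<partial>?R) = (\<integral>\<^sup>+ x. g x \<partial>?R)"
    if [measurable]: "g \<in> borel_measurable borel" for g y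
  proof -
    have "(\<integral>\<^sup>+ x. g (x + y) \<partial>?R) = (\<integral>\<^sup>+ x. g (e * (x + y / e)) \<partial>lborel)"
      using e0 by (subst nn_integral_distr) (auto simp: ring_distribs)
    also have "\<dots> = (\<integral>\<^sup>+ x. g (e * x) \<partial>lborel)"
      by (rule lborel_nn_integral_translate[where g="\<lambda>x. g (e * x)"]) measurable
    finally show ?thesis by (simp add: nn_integral_distr)
  qed
  have "uminus -` cball (0::complex) 1 = cball 0 1" by auto
  then have *: "emeasure ?R A * emeasure lborel (cball (0::complex) 1)
      = emeasure lborel A * emeasure lborel (cball (0::complex) 1)"
    using translation_invariant_unique[OF sf _ inv A, of "cball 0 1"] ball[of 1] by simp
  have "emeasure lborel (ball (0::complex) 1) \<le> emeasure lborel (cball (0::complex) 1)"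
    by (rule emeasure_mono) auto
  then have "emeasure lborel (cball (0::complex) 1) \<noteq> 0"
    using emeasure_unit_ball(1) by (metis le_zero_eq)
  moreover have "emeasure lborel (cball (0::complex) 1) \<noteq> \<infinity>"
    using emeasure_compact_finite[of "cball (0::complex) 1"] by auto
  ultimately show "emeasure ?R A = emeasure lborel A"
    using * by (metis mult_divide_eq_ennreal infinity_ennreal_def)
qed simp

text \<open>
  Normalized arc length is represented as the distribution of the direction \<open>dir\<close> under normalized
  area \<open>circ\<close>: rotation invariance is then inherited from Lebesgue measure. Giving the origin the
  direction \<open>1\<close> makes \<open>|dir z| = 1\<close> hold everywhere.
\<close>

definition circ :: "complex measure" where
  "circ = uniform_measure lborel (ball 0 1)"

definition dir :: "complex \<Rightarrow> complex" where
  "dir z = (if z = 0 then 1 else sgn z)"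

lemma norm_dir [simp]: "cmod (dir z) = 1"
  by (simp add: dir_def norm_sgn)

lemma dir_mult_cnj [simp]: "dir z * cnj (dir z) = 1" "cnj (dir z) * dir z = 1"
  by (simp_all add: complex_norm_square[symmetric] mult.commute)

lemma measurable_dir [measurable]: "dir \<in> borel_measurable borel"
proof -
  have "(sgn :: complex \<Rightarrow> complex) = (\<lambda>z. z /\<^sub>R cmod z)" by (auto simp: sgn_div_norm)
  then have [measurable]: "(sgn :: complex \<Rightarrow> complex) \<in> borel_measurable borel" by simp
  show ?thesis unfolding dir_def[abs_def] by measurable
qed

lemma sets_circ [measurable_cong, simp]: "sets circ = sets borel"
  and space_circ [simp]: "space circ = UNIV"
  by (auto simp: circ_def)

interpretation circ: prob_space circ
  unfolding circ_def using emeasure_unit_ball by (intro prob_space_uniform_measure) auto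

lemma measure_circ_UNIV [simp]: "measure circ UNIV = 1"
  using circ.prob_space by simp

text \<open>\<open>dir\<close> commutes with multiplication by \<open>e\<close> except possibly at
  the origin, a null point, and the unit disc is invariant.\<close>

lemma circ_nn_integral_rotate:
  assumes e: "cmod e = 1" and [measurable]: "g \<in> borel_measurable borel"
  shows "(\<integral>\<^sup>+ x. g (e * dir x) \<partial>circ) = (\<integral>\<^sup>+ x. g (dir x) \<partial>circ)"
proof -
  have e0: "e \<noteq> 0" using e by auto
  have [measurable]: "ball 0 1 \<in> sets (borel :: complex measure)" by simp
  have nz: "AE x in lborel. x \<noteq> (0::complex)" by (rule AE_lborel_singleton)
  have "(\<integral>\<^sup>+ x. g (dir x) * indicator (ball 0 1) x \<partial>lborel)
     = (\<integral>\<^sup>+ x. g (dir x) * indicator (ball 0 1) x \<partial>distr lborel borel ((*) e))"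
    by (simp add: lborel_distr_rotation[OF e])
  also have "\<dots> = (\<integral>\<^sup>+ x. g (dir (e * x)) * indicator (ball 0 1) (e * x) \<partial>lborel)"
    by (rule nn_integral_distr; measurable)
  also have "\<dots> = (\<integral>\<^sup>+ x. g (e * dir x) * indicator (ball 0 1) x \<partial>lborel)"
  proof (rule nn_integral_cong_AE)
    show "AE x in lborel. g (dir (e * x)) * indicator (ball 0 1) (e * x)
        = g (e * dir x) * indicator (ball 0 1) x"
      using nz
    proof eventually_elim
      case (elim x)
      have "sgn (e * x) = e * sgn x" using e by (simp add: sgn_mult) (simp add: sgn_eq)
      then show ?case using elim e e0 by (simp add: dir_def indicator_def norm_mult)
    qed
  qed
  finally show ?thesis
    unfolding circ_def by (subst (1 2) nn_integral_uniform_measure) auto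
qed

lemma distr_circ_rotate:
  assumes e: "cmod e = 1"
  shows "distr circ borel (\<lambda>x. e * dir x) = distr circ borel dir"
proof (rule measure_eqI)
  fix A :: "complex set" assume "A \<in> sets (distr circ borel (\<lambda>x. e * dir x))"
  then have [measurable]: "A \<in> sets borel" by simp
  have "emeasure (distr circ borel (\<lambda>x. e * dir x)) A = (\<integral>\<^sup>+ x. indicator A (e * dir x) \<partial>circ)"
    by (subst nn_integral_distr[of "\<lambda>x. e * dir x" circ borel "indicator A", symmetric]) auto
  also have "\<dots> = (\<integral>\<^sup>+ x. indicator A (dir x) \<partial>circ)"
    by (rule circ_nn_integral_rotate[OF e]) auto
  also have "\<dots> = emeasure (distr circ borel dir) A"
    by (subst nn_integral_distr[of "dir" circ borel "indicator A", symmetric]) auto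
  finally show "emeasure (distr circ borel (\<lambda>x. e * dir x)) A = emeasure (distr circ borel dir) A" .
qed simp

lemma circ_integral_rotate:
  fixes g :: "complex \<Rightarrow> complex"
  assumes e: "cmod e = 1" and [measurable]: "g \<in> borel_measurable borel"
  shows "(\<integral> x. g (e * dir x) \<partial>circ) = (\<integral> x. g (dir x) \<partial>circ)"
  using integral_distr[of "\<lambda>x. e * dir x" circ borel g] integral_distr[of dir circ borel g]
  by (simp add: distr_circ_rotate[OF e])

text \<open>Rotation by \<open>e\<close> multiplies the integral by \<open>e ^ n\<close> yet leaves
  it unchanged; for e = cis (pi / n) the factor is -1.\<close>

lemma circ_integral_power:
  assumes "0 < n" shows "(\<integral> x. dir x ^ n \<partial>circ) = 0"
proof -
  obtain e :: complex where e: "cmod e = 1" "e ^ n \<noteq> 1"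
  proof -
    have "cis (pi / real n) ^ n = cis (real n * (pi / real n))" by (simp add: Complex.DeMoivre)
    also have "\<dots> = -1" using assms by simp
    finally have "cis (pi / real n) ^ n = -1" .
    then show ?thesis using that[of "cis (pi / real n)"] by auto
  qed
  have "(\<integral> x. dir x ^ n \<partial>circ) = (\<integral> x. (e * dir x) ^ n \<partial>circ)"
    by (rule circ_integral_rotate[OF e(1), symmetric]) measurable
  also have "\<dots> = e ^ n * (\<integral> x. dir x ^ n \<partial>circ)" by (simp add: power_mult_distrib)
  finally show ?thesis using e(2) by (metis mult_cancel_right1 mult.commute)
qed

lemma measurable_cnj [measurable]: "cnj \<in> borel_measurable borel"
  by (intro borel_measurable_continuous_onI continuous_intros)

lemma circ_integral_dir_power:
  "(\<integral> x. dir x ^ n * cnj (dir x) ^ k \<partial>circ) = (if n = k then 1 else 0)"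
proof -
  have c: "dir x ^ j * cnj (dir x) ^ j = 1" for x j by (simp add: power_mult_distrib[symmetric])
  consider "n = k" | d where "n = d + k" "0 < d" | d where "k = d + n" "0 < d"
    by (metis add.commute less_imp_add_positive linorder_neqE_nat)
  then show ?thesis
  proof cases
    case 1 then show ?thesis by (simp add: c)
  next
    case 2
    then have "(\<lambda>x. dir x ^ n * cnj (dir x) ^ k) = (\<lambda>x. dir x ^ d)"
      using c[of _ k] by (simp add: power_add mult.assoc)
    then show ?thesis using 2 circ_integral_power[of d] by simp
  next
    case 3
    then have "(\<lambda>x. dir x ^ n * cnj (dir x) ^ k) = (\<lambda>x. cnj (dir x ^ d))"
    proof (intro ext)
      fix x
      have "dir x ^ n * cnj (dir x) ^ k = (dir x ^ n * cnj (dir x) ^ n) * cnj (dir x) ^ d"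
        using 3 by (simp add: power_add mult_ac)
      then show "dir x ^ n * cnj (dir x) ^ k = cnj (dir x ^ d)" by (simp add: c)
    qed
    then show ?thesis using 3 circ_integral_power[of d] by (simp only: Bochner_Integration.integral_cnj) simp
  qed
qed

lemma circ_integral_coeff:
  assumes f: "f holomorphic_on ball 0 R" and R: "R > 1"
  shows "(\<integral> x. f (dir x) * cnj (dir x) ^ k \<partial>circ) = (deriv ^^ k) f 0 / fact k"
proof -
  define a where "a n = (deriv ^^ n) f 0 / fact n" for n
  have s: "(\<lambda>n. a n * w ^ n) sums f w" if "w \<in> ball 0 R" for w
    using holomorphic_power_series[OF f that] by (simp add: a_def)
  \<comment> \<open>A radius strictly between 1 and \<open>R\<close>: convergence there forces
    absolute convergence on the unit circle, which justifies integrating term by term.\<close>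
  have "summable (\<lambda>n. a n * of_real ((1 + R) / 2) ^ n)"
    using s[of "of_real ((1 + R) / 2)"] R by (auto simp: sums_iff simp del: of_real_add of_real_divide)
  then have "summable (\<lambda>n. norm (a n * 1 ^ n))"
    by (rule powser_insidea) (use R in \<open>simp del: of_real_add of_real_divide\<close>)
  then have sa: "summable (\<lambda>n. norm (a n))" by simp
  have int: "integrable circ (\<lambda>x. a n * (dir x ^ n * cnj (dir x) ^ k))" for n
    by (intro circ.integrable_const_bound[where B="norm (a n)"]) (auto simp: norm_mult norm_power)
  have fx: "f (dir x) * cnj (dir x) ^ k = (\<Sum>n. a n * (dir x ^ n * cnj (dir x) ^ k))" for x
  proof -
    have "(\<lambda>n. a n * dir x ^ n) sums f (dir x)" using R by (intro s) simp
    from sums_mult2[OF this, of "cnj (dir x) ^ k"] show ?thesis by (simp add: sums_iff mult.assoc)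
  qed
  have "(\<integral> x. f (dir x) * cnj (dir x) ^ k \<partial>circ) = (\<Sum>n. \<integral> x. a n * (dir x ^ n * cnj (dir x) ^ k) \<partial>circ)"
    unfolding fx using sa by (intro integral_suminf int) (auto simp: norm_mult norm_power circ.prob_space)
  also have "(\<lambda>n. \<integral> x. a n * (dir x ^ n * cnj (dir x) ^ k) \<partial>circ) = (\<lambda>n. if n = k then a k else 0)"
    by (auto simp: circ_integral_dir_power)
  also have "(\<Sum>n. if n = k then a k else 0) = a k"
    using suminf_finite[of "{k}" "\<lambda>n. if n = k then a k else 0"] by simp
  finally show ?thesis by (simp add: a_def)
qed

lemma circ_integral_holomorphic:
  assumes f: "f holomorphic_on ball 0 R" and R: "R > 1"
  shows "(\<integral> x. f (dir x) \<partial>circ) = f 0"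
  using circ_integral_coeff[OF assms, of 0] by simp

text \<open>Young's inequality with a free scale \<open>t\<close>. The bound is linear in
  \<open>h powr p\<close>, so it can be integrated first and optimized in \<open>t\<close>
  afterwards; this yields Hoelder's inequality without normalizing the functions.\<close>

lemma weighted_Young:
  fixes h t p :: real
  assumes p: "p > 1" and h: "h \<ge> 0" and t: "t > 0"
  shows "h \<le> t * (1 - 1 / p) + t powr (1 - p) * h powr p / p"
proof -
  define q where "q = p / (p - 1)"
  have "(h / t) * 1 \<le> (h / t) powr p / p + 1 powr q / q"
    using p h t by (intro Youngs_inequality) (auto simp: q_def field_simps)
  then have "t * (h / t) \<le> t * ((h / t) powr p / p + 1 / q)"
    using t by (intro mult_left_mono) auto
  also have "\<dots> = t * (1 - 1 / p) + t * (h powr p / t powr p) / p"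
    using p h t by (simp add: q_def powr_divide field_simps)
  also have "t * (h powr p / t powr p) = t powr (1 - p) * h powr p"
    using t by (simp add: powr_diff)
  finally show ?thesis using t by simp
qed

lemma ennreal_lincomb:
  assumes "0 \<le> a" "0 \<le> b" "0 \<le> v" "0 \<le> w"
  shows "ennreal (a * v + b * w) = ennreal a * ennreal v + ennreal b * ennreal w"
  using assms by (simp add: ennreal_mult ennreal_plus)

text \<open>
  No integrability is assumed: the Bochner integral on the left is \<open>0\<close> for a non-integrable function.
\<close>

lemma Jensen_integral:
  fixes f :: "'a \<Rightarrow> complex" and w h :: "'a \<Rightarrow> real" and W p :: real
  assumes p: "p > 1"
    and [measurable]: "w \<in> borel_measurable M" "h \<in> borel_measurable M"
    and w: "\<And>x. x \<in> space M \<Longrightarrow> 0 \<le> w x" and h: "\<And>x. x \<in> space M \<Longrightarrow> 0 \<le> h x"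
    and W: "W > 0" "(\<integral>\<^sup>+ x. ennreal (w x) \<partial>M) \<le> ennreal W"
    and f: "\<And>x. x \<in> space M \<Longrightarrow> cmod (f x) \<le> w x * h x"
  shows "ennreal (cmod (\<integral> x. f x \<partial>M) powr p)
     \<le> ennreal (W powr (p - 1)) * (\<integral>\<^sup>+ x. ennreal (w x * h x powr p) \<partial>M)"
proof (cases "integrable M f \<and> (\<integral>\<^sup>+ x. ennreal (w x * h x powr p) \<partial>M) \<noteq> \<infinity>")
  case False
  then consider "\<not> integrable M f" | "(\<integral>\<^sup>+ x. ennreal (w x * h x powr p) \<partial>M) = \<infinity>" by blast
  then show ?thesis
  proof cases
    case 1
    then show ?thesis using p by (simp add: not_integrable_integral_eq)
  next
    case 2
    then show ?thesis using W by (simp add: ennreal_mult_top)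
  qed
next
  case True
  then obtain I where I: "I \<ge> 0" "(\<integral>\<^sup>+ x. ennreal (w x * h x powr p) \<partial>M) = ennreal I"
    by (metis ennreal_cases infinity_ennreal_def)
  define N where "N = cmod (\<integral> x. f x \<partial>M)"
  have key: "N \<le> W * t * (1 - 1 / p) + t powr (1 - p) * I / p" if t: "t > 0" for t
  proof -
    have "ennreal N \<le> (\<integral>\<^sup>+ x. ennreal (cmod (f x)) \<partial>M)"
      unfolding N_def using True by (intro integral_norm_bound_ennreal) auto
    also have "\<dots> \<le> (\<integral>\<^sup>+ x. ennreal (t * (1 - 1 / p)) * ennreal (w x)
        + ennreal (t powr (1 - p) / p) * ennreal (w x * h x powr p) \<partial>M)"
    proof (rule nn_integral_mono)
      fix x assume x: "x \<in> space M"
      have "cmod (f x) \<le> w x * (t * (1 - 1 / p) + t powr (1 - p) * h x powr p / p)"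
        using f[OF x] weighted_Young[OF p h[OF x] t] w[OF x] by (meson mult_left_mono order_trans)
      also have "\<dots> = (t * (1 - 1 / p)) * w x + (t powr (1 - p) / p) * (w x * h x powr p)"
        by (simp add: algebra_simps)
      finally show "ennreal (cmod (f x)) \<le> ennreal (t * (1 - 1 / p)) * ennreal (w x)
        + ennreal (t powr (1 - p) / p) * ennreal (w x * h x powr p)"
        using p t w[OF x] by (intro ord_le_eq_trans[OF ennreal_leI ennreal_lincomb]) auto
    qed
    also have "\<dots> = ennreal (t * (1 - 1 / p)) * (\<integral>\<^sup>+ x. ennreal (w x) \<partial>M)
        + ennreal (t powr (1 - p) / p) * ennreal I"
      by (subst nn_integral_add) (auto simp: nn_integral_cmult I(2))
    also have "\<dots> \<le> ennreal (t * (1 - 1 / p)) * ennreal W + ennreal (t powr (1 - p) / p) * ennreal I"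
      using W by (intro add_right_mono mult_left_mono) auto
    also have "\<dots> = ennreal ((t * (1 - 1 / p)) * W + (t powr (1 - p) / p) * I)"
      using p t W I by (subst ennreal_lincomb) auto
    finally have le: "ennreal N \<le> ennreal ((t * (1 - 1 / p)) * W + (t powr (1 - p) / p) * I)" .
    have "0 \<le> (t * (1 - 1 / p)) * W + (t powr (1 - p) / p) * I"
      using p t W I by (intro add_nonneg_nonneg mult_nonneg_nonneg) auto
    then show ?thesis using le by (simp add: algebra_simps)
  qed
  have "N powr p \<le> W powr (p - 1) * I"
  proof (cases "I = 0")
    case True
    \<comment> \<open>With \<open>I = 0\<close> there is no optimal scale, so
      \<open>t = e / W\<close> is taken arbitrarily small.\<close>
    have "N \<le> e" if "e > 0" for e
    proof -
      have "N \<le> W * (e / W) * (1 - 1 / p)" using key[of "e / W"] True that W by auto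
      also have "\<dots> \<le> e" using that p W by (simp add: field_simps)
      finally show ?thesis .
    qed
    then have "N \<le> 0" by (rule field_le_epsilon[of N 0, simplified])
    then show ?thesis using True by (simp add: N_def)
  next
    case False
    with I have I0: "I > 0" by simp
    \<comment> \<open>The minimizing scale: it makes \<open>t powr (1 - p) * I\<close> equal to
      \<open>W * t\<close>, and the weights 1 - 1/p and 1/p add up to 1.\<close>
    define t where "t = (I / W) powr (1 / p)"
    have t: "t > 0" using I0 W by (simp add: t_def)
    have tp: "t powr p = I / W" using I0 W p by (simp add: t_def powr_powr)
    have "t powr (1 - p) * I = W * t" using t tp I0 W by (simp add: powr_diff)
    then have "N \<le> W * t" using key[OF t] p by (simp add: algebra_simps)
    then have "N powr p \<le> (W * t) powr p" using p by (intro powr_mono2) (auto simp: N_def)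
    also have "\<dots> = W powr (p - 1) * I"
      using W t tp by (simp add: powr_mult powr_diff)
    finally show ?thesis .
  qed
  then show ?thesis unfolding I(2) N_def using I
    by (subst ennreal_mult'[symmetric]) (auto intro!: ennreal_leI)
qed

section \<open>The theorem of M. Riesz\<close>

text \<open>Near the imaginary axis p times the modulus of the argument lies between pi/2 and pi, so
  the real part of the power is negative and comparable to |w|^p; elsewhere Re w is comparable to
  |w|. The bound p \<le> 2 keeps the angle within [0, pi], where the cosine decreases.\<close>

lemma powr_p_trig_inequality:
  fixes p :: real
  assumes p: "1 < p" "p \<le> 2"
  obtains B C where "B \<ge> 0" "C > 0"
    "\<And>w. Re w > 0 \<Longrightarrow> cmod w powr p \<le> C * Re w powr p - B * Re (w powr of_real p)"
proof -
  \<comment> \<open>The midpoint of pi / (2 p) and pi / 2: above the first value cos (p \<theta>) is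
    negative, below the second cos \<theta> is still positive.\<close>
  define \<theta>\<^sub>0 where "\<theta>\<^sub>0 = (pi / (2 * p) + pi / 2) / 2"
  have t0: "0 < \<theta>\<^sub>0" "\<theta>\<^sub>0 < pi / 2"
    using p pi_gt_zero by (auto simp: \<theta>\<^sub>0_def field_simps intro!: add_pos_pos)
  have pt0: "p * \<theta>\<^sub>0 = pi / 4 + p * pi / 4" using p by (simp add: \<theta>\<^sub>0_def field_simps)
  have "pi / 4 + pi / 4 < pi / 4 + p * pi / 4" "pi / 4 + p * pi / 4 \<le> pi / 4 + 2 * pi / 4"
    using p pi_gt_zero by (simp_all add: field_simps)
  then have "pi / 2 < p * \<theta>\<^sub>0" "p * \<theta>\<^sub>0 \<le> pi" unfolding pt0 using pi_gt_zero by linarith+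
  then have "cos (p * \<theta>\<^sub>0) < cos (pi / 2)" using pi_gt_zero by (intro cos_monotone_0_pi) auto
  then have d: "cos (p * \<theta>\<^sub>0) < 0" by simp
  have k: "cos \<theta>\<^sub>0 > 0" using t0 by (intro cos_gt_zero_pi) auto
  define B where "B = - 1 / cos (p * \<theta>\<^sub>0)"
  define C where "C = (1 + B) / cos \<theta>\<^sub>0 powr p"
  have B: "B > 0" using d by (simp add: B_def divide_neg_neg)
  have C: "C > 0" using B k by (simp add: C_def)
  show thesis
  proof (rule that)
    show "B \<ge> 0" "C > 0" using B C by auto
    fix w :: complex assume w: "Re w > 0"
    then have w0: "w \<noteq> 0" by auto
    define \<theta> where "\<theta> = Arg w"
    have "\<bar>\<theta>\<bar> < pi / 2" using w Arg_Re_pos[of w] w0 by (simp add: \<theta>_def)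
    have weq: "w = of_real (cmod w) * exp (\<i> * of_real \<theta>)"
      using Arg_eq[OF w0] by (simp add: \<theta>_def)
    have "Re (of_real (cmod w) * exp (\<i> * of_real \<theta>)) = cmod w * cos \<theta>" by (simp add: Re_exp)
    with weq have Re_w: "Re w = cmod w * cos \<theta>" by metis
    have cos: "cos \<theta> > 0" using \<open>\<bar>\<theta>\<bar> < pi / 2\<close> by (intro cos_gt_zero_pi) auto
    have "w powr of_real p = exp (of_real p * Ln w)" using w0 by (simp add: powr_def)
    also have "Ln w = of_real (ln (cmod w)) + \<i> * of_real \<theta>" using Ln_Arg[OF w0] by (simp add: \<theta>_def)
    finally have "Re (w powr of_real p) = exp (p * ln (cmod w)) * cos (p * \<theta>)"
      by (simp add: Re_exp)
    then have Re_wp: "Re (w powr of_real p) = cmod w powr p * cos (p * \<theta>)"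
      using w0 by (simp add: powr_def)
    have "1 \<le> C * cos \<theta> powr p - B * cos (p * \<theta>)"
    proof (cases "\<bar>\<theta>\<bar> \<ge> \<theta>\<^sub>0")
      case True
      have "p * \<bar>\<theta>\<bar> \<le> 2 * (pi / 2)" using p \<open>\<bar>\<theta>\<bar> < pi / 2\<close> by (intro mult_mono) auto
      then have "cos (p * \<bar>\<theta>\<bar>) \<le> cos (p * \<theta>\<^sub>0)"
        using True t0 p by (intro cos_monotone_0_pi_le) auto
      moreover have "cos (p * \<bar>\<theta>\<bar>) = cos (p * \<theta>)" by (simp add: abs_if)
      ultimately have "B * cos (p * \<theta>) \<le> B * cos (p * \<theta>\<^sub>0)" using B by (intro mult_left_mono) auto
      also have "\<dots> = -1" using d by (simp add: B_def)
      finally show ?thesis using C by (smt (verit) mult_nonneg_nonneg powr_ge_zero)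
    next
      case False
      then have "cos \<theta>\<^sub>0 \<le> cos \<bar>\<theta>\<bar>" using t0 by (intro cos_monotone_0_pi_le) auto
      then have "cos \<theta>\<^sub>0 powr p \<le> cos \<theta> powr p" using k p by (intro powr_mono2) (auto simp: abs_if split: if_splits)
      then have "C * cos \<theta>\<^sub>0 powr p \<le> C * cos \<theta> powr p" using C by (intro mult_left_mono) auto
      moreover have "C * cos \<theta>\<^sub>0 powr p = 1 + B" using k by (simp add: C_def)
      moreover have "B * cos (p * \<theta>) \<le> B * 1" using B by (intro mult_left_mono) auto
      ultimately show ?thesis by simp
    qed
    then have "cmod w powr p * 1 \<le> cmod w powr p * (C * cos \<theta> powr p - B * cos (p * \<theta>))"
      by (intro mult_left_mono) auto
    also have "\<dots> = C * Re w powr p - B * Re (w powr of_real p)"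
      using cos by (simp add: Re_w Re_wp powr_mult algebra_simps)
    finally show "cmod w powr p \<le> C * Re w powr p - B * Re (w powr of_real p)" by simp
  qed
qed

lemma powr_add_le:
  fixes a b p :: real
  assumes "0 \<le> a" "0 \<le> b" "0 \<le> p"
  shows "(a + b) powr p \<le> 2 powr p * (a powr p + b powr p)"
proof -
  have "(a + b) powr p \<le> (2 * max a b) powr p" using assms by (intro powr_mono2) auto
  also have "\<dots> = 2 powr p * max a b powr p" using assms by (simp add: powr_mult)
  also have "\<dots> \<le> 2 powr p * (a powr p + b powr p)" by (intro mult_left_mono) (auto simp: max_def)
  finally show ?thesis .
qed

text \<open>The p-th power of the L^p norm on the circle, extended valued so that estimates can be
  chained before finiteness is known.\<close>

definition pmean :: "real \<Rightarrow> (complex \<Rightarrow> complex) \<Rightarrow> ennreal" where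
  "pmean p f = (\<integral>\<^sup>+ x. ennreal (cmod (f (dir x)) powr p) \<partial>circ)"

text \<open>In terms of the Fourier coefficients c_n of f this is the sum of c_n r^n u^n over n
  \<ge> 0: the projection onto nonnegative frequencies, read at the radius \<open>r\<close>. The
  bounds below are uniform in r < 1.\<close>

definition cauchy_op :: "real \<Rightarrow> (complex \<Rightarrow> complex) \<Rightarrow> complex \<Rightarrow> complex" where
  "cauchy_op r f u = (\<integral> x. f (dir x) / (1 - of_real r * u * cnj (dir x)) \<partial>circ)"

lemma measurable_cauchy_op [measurable]:
  assumes [measurable]: "f \<in> borel_measurable borel"
  shows "cauchy_op r f \<in> borel_measurable borel"
  unfolding cauchy_op_def[abs_def] by measurable

lemma le_norm_one_minus:
  "1 - r * R \<le> cmod (1 - of_real r * u * cnj (dir x))" if "0 \<le> r" "cmod u \<le> R"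
proof -
  have "cmod (of_real r * u * cnj (dir x)) \<le> r * R"
    using that by (simp add: norm_mult mult_left_mono)
  then show ?thesis
    using norm_triangle_ineq2[of 1 "of_real r * u * cnj (dir x)"] by simp
qed

lemma integrable_circ_if_pmean_finite:
  assumes [measurable]: "f \<in> borel_measurable borel" and p: "1 \<le> p" and fin: "pmean p f < \<infinity>"
  shows "integrable circ (\<lambda>x. f (dir x))" "integrable circ (\<lambda>x. cmod (f (dir x)) powr p)"
proof -
  show int: "integrable circ (\<lambda>x. cmod (f (dir x)) powr p)"
    using fin by (intro integrableI_bounded) (auto simp: pmean_def)
  show "integrable circ (\<lambda>x. f (dir x))"
  proof (rule Bochner_Integration.integrable_bound)
    show "integrable circ (\<lambda>x. 1 + cmod (f (dir x)) powr p)" using int by simp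
    show "AE x in circ. norm (f (dir x)) \<le> norm (1 + cmod (f (dir x)) powr p)"
    proof (rule AE_I2)
      fix x
      have "cmod (f (dir x)) \<le> 1 + cmod (f (dir x)) powr p"
        using powr_mono[of 1 p "cmod (f (dir x))"] p by (cases "cmod (f (dir x)) \<le> 1") (auto simp: add_increasing2)
      then show "norm (f (dir x)) \<le> norm (1 + cmod (f (dir x)) powr p)" by simp
    qed
  qed simp
qed

lemma integrable_cauchy_kernel:
  assumes [measurable]: "f \<in> borel_measurable borel" and int: "integrable circ (\<lambda>x. f (dir x))"
    and r: "0 \<le> r" "cmod u \<le> R" "r * R < 1"
  shows "integrable circ (\<lambda>x. f (dir x) / (1 - of_real r * u * cnj (dir x)))"
proof (rule Bochner_Integration.integrable_bound)
  show "integrable circ (\<lambda>x. 1 / (1 - r * R) * cmod (f (dir x)))" using int by simp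
  show "AE x in circ. norm (f (dir x) / (1 - of_real r * u * cnj (dir x)))
      \<le> norm (1 / (1 - r * R) * cmod (f (dir x)))"
  proof (rule AE_I2)
    fix x
    have "cmod (f (dir x)) / cmod (1 - of_real r * u * cnj (dir x)) \<le> cmod (f (dir x)) / (1 - r * R)"
      using le_norm_one_minus[OF r(1,2), of x] r by (intro divide_left_mono mult_pos_pos) auto
    then show "norm (f (dir x) / (1 - of_real r * u * cnj (dir x)))
      \<le> norm (1 / (1 - r * R) * cmod (f (dir x)))" using r by (simp add: norm_divide abs_mult)
  qed
qed simp

lemma norm_cauchy_op_le:
  assumes [measurable]: "f \<in> borel_measurable borel" and int: "integrable circ (\<lambda>x. f (dir x))"
    and r: "0 \<le> r" "cmod u \<le> R" "r * R < 1"
  shows "cmod (cauchy_op r f u) \<le> (\<integral> x. cmod (f (dir x)) \<partial>circ) / (1 - r * R)"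
proof -
  have "cmod (cauchy_op r f u) \<le> (\<integral> x. cmod (f (dir x)) / (1 - r * R) \<partial>circ)"
    unfolding cauchy_op_def
  proof (rule Bochner_Integration.integral_norm_bound_integral)
    show "integrable circ (\<lambda>x. f (dir x) / (1 - of_real r * u * cnj (dir x)))"
      by (rule integrable_cauchy_kernel[OF assms])
    fix x
    show "norm (f (dir x) / (1 - of_real r * u * cnj (dir x))) \<le> cmod (f (dir x)) / (1 - r * R)"
      using le_norm_one_minus[OF r(1,2), of x] r
      by (subst norm_divide) (intro divide_left_mono mult_pos_pos, auto)
  qed (use int in auto)
  then show ?thesis by simp
qed

lemma holomorphic_cauchy_op:
  assumes [measurable]: "f \<in> borel_measurable borel" and int: "integrable circ (\<lambda>x. f (dir x))"
    and r: "0 \<le> r" "0 < R" "r * R < 1"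
  shows "cauchy_op r f holomorphic_on ball 0 R"
proof (rule power_series_holomorphic)
  define a where "a n = of_real r ^ n * (\<integral> x. f (dir x) * cnj (dir x) ^ n \<partial>circ)" for n
  fix z :: complex assume "z \<in> ball 0 R"
  then have z: "cmod z < R" by simp
  have rz: "r * cmod z < 1" using z r by (meson le_less_trans less_imp_le mult_left_mono)
  have int': "integrable circ (\<lambda>x. (of_real r * z) ^ n * (f (dir x) * cnj (dir x) ^ n))" for n
    by (intro integrable_mult_right Bochner_Integration.integrable_bound[OF int])
       (auto simp: norm_mult norm_power)
  have nrm: "norm ((of_real r * z) ^ n * (f (dir x) * cnj (dir x) ^ n)) = (r * cmod z) ^ n * cmod (f (dir x))" for n x
    using r by (simp add: norm_mult norm_power)
  have "(\<lambda>n. \<integral> x. (of_real r * z) ^ n * (f (dir x) * cnj (dir x) ^ n) \<partial>circ) sums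
      (\<integral> x. (\<Sum>n. (of_real r * z) ^ n * (f (dir x) * cnj (dir x) ^ n)) \<partial>circ)"
    by (rule sums_integral[OF int'])
       (use rz r in \<open>auto simp: nrm intro!: summable_mult2 summable_geometric AE_I2\<close>)
  also have "(\<integral> x. (\<Sum>n. (of_real r * z) ^ n * (f (dir x) * cnj (dir x) ^ n)) \<partial>circ) = cauchy_op r f z"
    unfolding cauchy_op_def
  proof (intro Bochner_Integration.integral_cong refl)
    fix x
    have "cmod (of_real r * z * cnj (dir x)) < 1" using rz r by (simp add: norm_mult)
    from sums_mult[OF geometric_sums[OF this], of "f (dir x)"]
    show "(\<Sum>n. (of_real r * z) ^ n * (f (dir x) * cnj (dir x) ^ n)) = f (dir x) / (1 - of_real r * z * cnj (dir x))"
      by (simp add: sums_iff power_mult_distrib mult_ac)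
  qed
  also have "(\<lambda>n. \<integral> x. (of_real r * z) ^ n * (f (dir x) * cnj (dir x) ^ n) \<partial>circ) = (\<lambda>n. a n * (z - 0) ^ n)"
    by (auto simp: a_def power_mult_distrib)
  finally show "(\<lambda>n. a n * (z - 0) ^ n) sums cauchy_op r f z" .
qed

text \<open>The real part equals (1 - |x|^2) / |1 - x|^2, the Poisson kernel. The explicit positive
  lower bound keeps Poisson integrals of nonnegative functions of positive mass in the open right
  half plane.\<close>

lemma Re_cayley_lower:
  assumes "cmod x \<le> q" "q < 1"
  shows "(1 - q) / 2 \<le> Re ((1 + x) / (1 - x))"
proof -
  have q: "0 \<le> q" using assms(1) norm_ge_zero[of x] by linarith
  have x1: "cmod (1 - x) > 0" using assms by auto
  have "Re ((1 + x) / (1 - x)) = Re ((1 + x) * cnj (1 - x)) / (cmod (1 - x))\<^sup>2"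
    by (subst complex_div_cnj) (simp add: Re_divide_of_real flip: of_real_power)
  also have "Re ((1 + x) * cnj (1 - x)) = 1 - (cmod x)\<^sup>2"
    by (simp add: cmod_power2) (simp add: algebra_simps power2_eq_square)
  finally have eq: "Re ((1 + x) / (1 - x)) = (1 - (cmod x)\<^sup>2) / (cmod (1 - x))\<^sup>2" .
  have "cmod (1 - x) \<le> 1 + q" using norm_triangle_ineq4[of 1 x] assms by simp
  then have d: "(cmod (1 - x))\<^sup>2 \<le> (1 + q)\<^sup>2" by (intro power_mono) auto
  have "(cmod x)\<^sup>2 \<le> q\<^sup>2" using assms by (intro power_mono) auto
  then have n: "(1 - q) * (1 + q) \<le> 1 - (cmod x)\<^sup>2" by (simp add: algebra_simps power2_eq_square)
  have "0 \<le> (1 - q) * (1 + q)" using q assms by simp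
  with n have n0: "0 \<le> 1 - (cmod x)\<^sup>2" by linarith
  have "(1 - q) / 2 \<le> (1 - q) / (1 + q)" using q assms by (intro divide_left_mono) auto
  also have "\<dots> = ((1 - q) * (1 + q)) / (1 + q)\<^sup>2" using q by (simp add: power2_eq_square)
  also have "\<dots> \<le> (1 - (cmod x)\<^sup>2) / (cmod (1 - x))\<^sup>2"
    using x1 by (intro frac_le n n0 d) auto
  finally show ?thesis using eq by simp
qed

lemma Re_cayley_upper:
  assumes "cmod x \<le> q" "q < 1"
  shows "cmod ((1 + x) / (1 - x)) \<le> 2 / (1 - q)"
proof -
  have "1 - q \<le> cmod (1 - x)" using norm_triangle_ineq2[of 1 x] assms by simp
  moreover have "cmod (1 + x) \<le> 2" using norm_triangle_ineq[of 1 x] assms by simp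
  ultimately show ?thesis using assms by (subst norm_divide) (intro frac_le; simp)
qed

lemma circ_integral_poisson:
  assumes r: "0 \<le> r" "r < 1" and v: "cmod v = 1"
  shows "(\<integral>\<^sup>+ x. ennreal (Re ((1 + of_real r * dir x * cnj v) / (1 - of_real r * dir x * cnj v))) \<partial>circ) = 1"
proof -
  let ?g = "\<lambda>u. (1 + of_real r * u * cnj v) / (1 - of_real r * u * cnj v)"
  \<comment> \<open>Any R > 1 with r R < 1 would do: the kernel is then holomorphic on a disc larger
    than the unit disc, and its mean over the unit circle is its value at 0.\<close>
  define R where "R = 2 / (1 + r)"
  have R: "R > 1" "r * R < 1" using r by (auto simp: R_def field_simps)
  have ne: "1 - of_real r * u * cnj v \<noteq> 0" if "u \<in> ball 0 R" for u
  proof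
    assume "1 - of_real r * u * cnj v = 0"
    then have "cmod (of_real r * u * cnj v) = 1" by (metis eq_iff_diff_eq_0 norm_one)
    moreover have "r * cmod u \<le> r * R" using that r by (intro mult_left_mono) auto
    ultimately show False using R r v by (simp add: norm_mult)
  qed
  have "?g holomorphic_on ball 0 R" using ne by (intro holomorphic_intros) auto
  from circ_integral_holomorphic[OF this R(1)] have 1: "(\<integral> x. ?g (dir x) \<partial>circ) = 1" by simp
  have q: "cmod (of_real r * dir x * cnj v) \<le> r" for x using r v by (simp add: norm_mult)
  have int: "integrable circ (\<lambda>x. ?g (dir x))"
    by (rule circ.integrable_const_bound[where B="2 / (1 - r)"])
       (use Re_cayley_upper[OF q r(2)] in auto)
  have "(\<integral>\<^sup>+ x. ennreal (Re (?g (dir x))) \<partial>circ) = ennreal (\<integral> x. Re (?g (dir x)) \<partial>circ)"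
  proof (rule nn_integral_eq_integral)
    have "0 \<le> (1 - r) / 2" using r by simp
    then have "0 \<le> Re (?g (dir x))" for x using Re_cayley_lower[OF q r(2), of x] by (rule order_trans)
    then show "AE x in circ. 0 \<le> Re (?g (dir x))" by (intro AE_I2)
  qed (use int integrable_Re in auto)
  also have "(\<integral> x. Re (?g (dir x)) \<partial>circ) = 1" using int 1 by (subst integral_Re) auto
  finally show ?thesis by simp
qed

text \<open>
  For \<open>f \<ge> 0\<close> with mean \<open>m\<close>, the function \<open>G = 2 C f - m\<close>, with \<open>C\<close> the Cauchy operator, has the Poisson
  extension of \<open>f\<close> as its positive real part. Hence \<open>G^p\<close> is holomorphic with mean \<open>G(0)^p = m^p \<ge> 0\<close>, and
  averaging \<open>|G|^p \<le> c (Re G)^p - b Re (G^p)\<close> gives the bound.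
\<close>

lemma cauchy_op_nonneg_bounded:
  fixes p :: real
  assumes p: "1 < p" "p \<le> 2"
  obtains A where "A > 0"
    "\<And>r (f :: complex \<Rightarrow> real). 0 \<le> r \<Longrightarrow> r < 1 \<Longrightarrow> f \<in> borel_measurable borel \<Longrightarrow> (\<And>x. 0 \<le> f x) \<Longrightarrow>
       pmean p (cauchy_op r (\<lambda>x. of_real (f x))) \<le> ennreal A * pmean p (\<lambda>x. of_real (f x))"
proof -
  obtain B C where B: "B \<ge> 0" and C: "C > 0" and
    trig: "\<And>w. Re w > 0 \<Longrightarrow> cmod w powr p \<le> C * Re w powr p - B * Re (w powr of_real p)"
    using powr_p_trig_inequality[OF p] by metis
  interpret PP: pair_sigma_finite circ circ ..
  show thesis
  proof (rule that)
    show "2 powr p * (C + 1) > 0" using C by auto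
    fix r :: real and f :: "complex \<Rightarrow> real"
    assume r: "0 \<le> r" "r < 1" and [measurable]: "f \<in> borel_measurable borel" and f: "\<And>x. 0 \<le> f x"
    define F where "F = (\<lambda>x. complex_of_real (f x))"
    have [measurable]: "F \<in> borel_measurable borel" unfolding F_def by measurable
    show "pmean p (cauchy_op r (\<lambda>x. of_real (f x))) \<le> ennreal (2 powr p * (C + 1)) * pmean p (\<lambda>x. of_real (f x))"
      unfolding F_def[symmetric]
    proof (cases "pmean p F < \<infinity>")
      case False
      then have "pmean p F = top" by (metis infinity_ennreal_def top.not_eq_extremum)
      then show "pmean p (cauchy_op r F) \<le> ennreal (2 powr p * (C + 1)) * pmean p F"
        using C by (simp add: ennreal_mult_top)
    next
      case True
      have intF: "integrable circ (\<lambda>x. F (dir x))"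
        using True p by (intro integrable_circ_if_pmean_finite(1)[of F p]) auto
      then have intf: "integrable circ (\<lambda>x. f (dir x))" using integrable_Re[OF intF] by (simp add: F_def)
      define m where "m = (\<integral> x. f (dir x) \<partial>circ)"
      have m0: "m \<ge> 0" using f by (simp add: m_def)
      show "pmean p (cauchy_op r F) \<le> ennreal (2 powr p * (C + 1)) * pmean p F"
      \<comment> \<open>The strict positivity of Re G needs m > 0. If m = 0, then \<open>f\<close>
        vanishes almost everywhere on the circle and so does its Cauchy integral.\<close>
      proof (cases "m = 0")
        case True
        then have AE: "AE x in circ. f (dir x) = 0"
          using integral_nonneg_eq_0_iff_AE[OF intf] f by (simp add: m_def)
        have "cauchy_op r F u = (\<integral> x. 0 \<partial>circ)" for u
          unfolding cauchy_op_def by (rule integral_cong_AE) (use AE in \<open>auto simp: F_def\<close>)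
        then show ?thesis using p by (simp add: pmean_def)
      next
        case False
        with m0 have m: "m > 0" by simp
        have mF: "complex_of_real m = (\<integral> x. F (dir x) \<partial>circ)"
          unfolding m_def F_def by (rule integral_complex_of_real[symmetric])
        define R where "R = 2 / (1 + r)"
        have R: "R > 1" "r * R < 1" using r by (auto simp: R_def field_simps)
        define P where "P u v = Re ((1 + of_real r * u * cnj v) / (1 - of_real r * u * cnj v))" for u v
        have [measurable]: "(\<lambda>x. P (fst x) (snd x)) \<in> borel_measurable (borel \<Otimes>\<^sub>M borel)"
          unfolding P_def[abs_def] by measurable
        have [measurable]: "(\<lambda>x. P u (g x)) \<in> borel_measurable borel" "(\<lambda>x. P (g x) u) \<in> borel_measurable borel"
          if [measurable]: "g \<in> borel_measurable borel" for g :: "complex \<Rightarrow> complex" and u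
          unfolding P_def[abs_def] by measurable
        define G where "G z = 2 * cauchy_op r F z - of_real m" for z
        have [measurable]: "G \<in> borel_measurable borel" unfolding G_def[abs_def] by measurable
        have Gint: "G z = (\<integral> x. F (dir x) * ((1 + of_real r * z * cnj (dir x)) / (1 - of_real r * z * cnj (dir x))) \<partial>circ)"
          and Gi: "integrable circ (\<lambda>x. F (dir x) * ((1 + of_real r * z * cnj (dir x)) / (1 - of_real r * z * cnj (dir x))))"
          if z: "cmod z \<le> R" for z
        proof -
          have i: "integrable circ (\<lambda>x. F (dir x) / (1 - of_real r * z * cnj (dir x)))"
            using z R r by (intro integrable_cauchy_kernel[OF _ intF]) auto
          \<comment> \<open>The identity 2 / (1 - x) - 1 = (1 + x) / (1 - x) turns the Cauchy kernel
            into the one whose real part is the Poisson kernel.\<close>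
          have eq: "2 * (F (dir x) / (1 - of_real r * z * cnj (dir x))) - F (dir x)
              = F (dir x) * ((1 + of_real r * z * cnj (dir x)) / (1 - of_real r * z * cnj (dir x)))" for x
          proof -
            have "1 - of_real r * z * cnj (dir x) \<noteq> 0"
              using le_norm_one_minus[OF r(1) z, of x] R by auto
            then show ?thesis by (simp add: divide_simps) (simp add: algebra_simps)
          qed
          have "G z = (\<integral> x. 2 * (F (dir x) / (1 - of_real r * z * cnj (dir x))) - F (dir x) \<partial>circ)"
            unfolding G_def cauchy_op_def mF integral_mult_right_zero[symmetric] using i intF
            by (intro Bochner_Integration.integral_diff[symmetric] integrable_mult_right)
          then show "G z = (\<integral> x. F (dir x) * ((1 + of_real r * z * cnj (dir x)) / (1 - of_real r * z * cnj (dir x))) \<partial>circ)"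
            unfolding eq .
          show "integrable circ (\<lambda>x. F (dir x) * ((1 + of_real r * z * cnj (dir x)) / (1 - of_real r * z * cnj (dir x))))"
            unfolding eq[symmetric] by (intro Bochner_Integration.integrable_diff integrable_mult_right i intF)
        qed
        have ReG: "Re (G z) = (\<integral> x. f (dir x) * P z (dir x) \<partial>circ)"
          and ReGi: "integrable circ (\<lambda>x. f (dir x) * P z (dir x))" if "cmod z \<le> R" for z
        proof -
          have "Re (F (dir x) * ((1 + of_real r * z * cnj (dir x)) / (1 - of_real r * z * cnj (dir x)))) = f (dir x) * P z (dir x)" for x
          proof -
            have "Re (of_real a * b) = a * Re b" for a b by simp
            then show ?thesis unfolding F_def P_def .
          qed
          then show "Re (G z) = (\<integral> x. f (dir x) * P z (dir x) \<partial>circ)"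
             "integrable circ (\<lambda>x. f (dir x) * P z (dir x))"
            using Gint[OF that] Gi[OF that] integral_Re[OF Gi[OF that]] integrable_Re[OF Gi[OF that]] by simp_all
        qed
        have Plow: "(1 - r * R) / 2 \<le> P z (dir x)" if "cmod z \<le> R" for z x
          unfolding P_def using R r that
          by (intro Re_cayley_lower) (auto simp: norm_mult mult_left_mono)
        have Gpos: "Re (G z) > 0" if "cmod z \<le> R" for z
        proof -
          have "0 < (1 - r * R) / 2 * m" using R m by simp
          also have "\<dots> = (\<integral> x. f (dir x) * ((1 - r * R) / 2) \<partial>circ)" by (simp add: m_def)
          also have "\<dots> \<le> Re (G z)" unfolding ReG[OF that]
            by (intro integral_mono ReGi[OF that] integrable_mult_left intf mult_left_mono Plow[OF that] f)
          finally show ?thesis .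
        qed
        have holG: "G holomorphic_on ball 0 R" unfolding G_def
          using R r by (intro holomorphic_intros holomorphic_cauchy_op intF) auto
        have slit: "G z \<notin> \<real>\<^sub>\<le>\<^sub>0" if "z \<in> ball 0 R" for z
          using Gpos[of z] that by (auto simp: complex_nonpos_Reals_iff)
        have "(\<lambda>z. G z powr of_real p) holomorphic_on ball 0 R"
          by (intro holomorphic_intros holG slit) auto
        from circ_integral_holomorphic[OF this R(1)]
        have "(\<integral> x. G (dir x) powr of_real p \<partial>circ) = G 0 powr of_real p" .
        also have "G 0 = of_real m" by (simp add: G_def cauchy_op_def m_def F_def)
        also have "of_real m powr of_real p = complex_of_real (m powr p)" using m by (simp add: powr_of_real)
        finally have mean: "(\<integral> x. G (dir x) powr of_real p \<partial>circ) = complex_of_real (m powr p)" .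
        define K where "K = 2 * (m / (1 - r)) + m"
        have GK: "cmod (G (dir x)) \<le> K" for x
        proof -
          have "cmod (cauchy_op r F (dir x)) \<le> (\<integral> x. cmod (F (dir x)) \<partial>circ) / (1 - r * 1)"
            using r by (intro norm_cauchy_op_le intF) auto
          also have "(\<integral> x. cmod (F (dir x)) \<partial>circ) = m" using f by (simp add: F_def m_def)
          finally show ?thesis unfolding G_def K_def
            using norm_triangle_ineq4[of "2 * cauchy_op r F (dir x)" "of_real m"] m by (simp add: norm_mult)
        qed
        have Rd: "cmod (dir x) \<le> R" for x using R by simp
        have npw: "cmod (w powr of_real p) = cmod w powr p" if "w \<noteq> 0" for w
          using that by (simp add: powr_def)
        have i1: "integrable circ (\<lambda>x. cmod (G (dir x)) powr p)"
          using GK p by (intro circ.integrable_const_bound[where B="K powr p"]) (auto intro!: powr_mono2)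
        have i2: "integrable circ (\<lambda>x. Re (G (dir x)) powr p)"
        proof (rule circ.integrable_const_bound[where B="K powr p"])
          have "Re (G (dir x)) powr p \<le> K powr p" for x
            using Gpos[OF Rd, of x] abs_Re_le_cmod[of "G (dir x)"] GK[of x] p
            by (intro powr_mono2) auto
          then show "AE x in circ. norm (Re (G (dir x)) powr p) \<le> K powr p" by auto
        qed simp
        have i3: "integrable circ (\<lambda>x. G (dir x) powr of_real p)"
        proof (rule ccontr)
          \<comment> \<open>A non-integrable function would have Bochner integral 0, whereas the
            mean just computed is m^p > 0.\<close>
          assume "\<not> ?thesis"
          from not_integrable_integral_eq[OF this] mean m show False by simp
        qed
        have "(\<integral> x. cmod (G (dir x)) powr p \<partial>circ)
            \<le> (\<integral> x. C * Re (G (dir x)) powr p - B * Re (G (dir x) powr of_real p) \<partial>circ)"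
          using trig Gpos[OF Rd] i1 i2 integrable_Re[OF i3] by (intro integral_mono) auto
        also have "\<dots> = C * (\<integral> x. Re (G (dir x)) powr p \<partial>circ) - B * Re (complex_of_real (m powr p))"
          using i2 integrable_Re[OF i3] by (simp add: integral_Re[OF i3] mean)
        also have "\<dots> \<le> C * (\<integral> x. Re (G (dir x)) powr p \<partial>circ)" using B by simp
        finally have le1: "(\<integral> x. cmod (G (dir x)) powr p \<partial>circ) \<le> C * (\<integral> x. Re (G (dir x)) powr p \<partial>circ)" .
        have "pmean p G = ennreal (\<integral> x. cmod (G (dir x)) powr p \<partial>circ)"
          unfolding pmean_def using i1 by (intro nn_integral_eq_integral) auto
        also have "\<dots> \<le> ennreal (C * (\<integral> x. Re (G (dir x)) powr p \<partial>circ))" using le1 by (rule ennreal_leI)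
        also have "\<dots> = ennreal C * (\<integral>\<^sup>+ x. ennreal (Re (G (dir x)) powr p) \<partial>circ)"
          using C i2 by (subst nn_integral_eq_integral) (auto simp: ennreal_mult')
        also have "(\<integral>\<^sup>+ x. ennreal (Re (G (dir x)) powr p) \<partial>circ)
            \<le> (\<integral>\<^sup>+ x. (\<integral>\<^sup>+ y. ennreal (P (dir x) (dir y)) * ennreal (f (dir y) powr p) \<partial>circ) \<partial>circ)"
        proof (rule nn_integral_mono)
          fix x
          have P0: "0 \<le> P (dir x) (dir y)" for y using Plow[OF Rd, of x y] R by simp
          \<comment> \<open>Symmetry makes the Poisson kernel a probability density in either
            variable: in \<open>y\<close> for Jensen's inequality, in \<open>x\<close> after
            Fubini.\<close>
          have Psym: "P (dir x) (dir y) = P (dir y) (dir x)" for y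
          proof -
            have "(1 + of_real r * dir y * cnj (dir x)) / (1 - of_real r * dir y * cnj (dir x))
              = cnj ((1 + of_real r * dir x * cnj (dir y)) / (1 - of_real r * dir x * cnj (dir y)))"
              by (simp add: mult_ac)
            then show ?thesis unfolding P_def by (metis complex_cnj(1) complex_surj complex.sel(1) cnj.simps(1))
          qed
          have "(\<integral> y. f (dir y) * P (dir x) (dir y) \<partial>circ) = Re (G (dir x))" by (rule ReG[OF Rd, symmetric])
          then have "complex_of_real (Re (G (dir x))) = (\<integral> y. complex_of_real (f (dir y) * P (dir x) (dir y)) \<partial>circ)"
            by (subst integral_complex_of_real) simp
          then have "ennreal (Re (G (dir x)) powr p) = ennreal (cmod (\<integral> y. complex_of_real (f (dir y) * P (dir x) (dir y)) \<partial>circ) powr p)"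
            using Gpos[OF Rd, of x] by (metis abs_of_pos norm_of_real)
          also have "\<dots> \<le> ennreal (1 powr (p - 1)) * (\<integral>\<^sup>+ y. ennreal (P (dir x) (dir y) * f (dir y) powr p) \<partial>circ)"
          proof (rule Jensen_integral)
            show "(\<integral>\<^sup>+ y. ennreal (P (dir x) (dir y)) \<partial>circ) \<le> ennreal 1"
              unfolding Psym using circ_integral_poisson[OF r, of "dir x"] by (simp add: P_def)
          qed (use p f P0 in \<open>auto simp: norm_mult\<close>)
          finally show "ennreal (Re (G (dir x)) powr p) \<le> (\<integral>\<^sup>+ y. ennreal (P (dir x) (dir y)) * ennreal (f (dir y) powr p) \<partial>circ)"
            using P0 by (simp add: ennreal_mult')
        qed
        also have "(\<integral>\<^sup>+ x. (\<integral>\<^sup>+ y. ennreal (P (dir x) (dir y)) * ennreal (f (dir y) powr p) \<partial>circ) \<partial>circ)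
          = (\<integral>\<^sup>+ y. (\<integral>\<^sup>+ x. ennreal (P (dir x) (dir y)) * ennreal (f (dir y) powr p) \<partial>circ) \<partial>circ)"
          unfolding P_def by (rule PP.Fubini'[symmetric]) measurable
        also have "\<dots> = pmean p F"
          unfolding pmean_def
        proof (rule nn_integral_cong)
          fix y
          have "(\<integral>\<^sup>+ x. ennreal (P (dir x) (dir y)) * ennreal (f (dir y) powr p) \<partial>circ)
            = (\<integral>\<^sup>+ x. ennreal (P (dir x) (dir y)) \<partial>circ) * ennreal (f (dir y) powr p)"
            by (rule nn_integral_multc) simp
          also have "(\<integral>\<^sup>+ x. ennreal (P (dir x) (dir y)) \<partial>circ) = 1"
            using circ_integral_poisson[OF r, of "dir y"] by (simp add: P_def)
          finally show "(\<integral>\<^sup>+ x. ennreal (P (dir x) (dir y)) * ennreal (f (dir y) powr p) \<partial>circ)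
              = ennreal (cmod (F (dir y)) powr p)" using f by (simp add: F_def)
        qed
        finally have leG: "pmean p G \<le> ennreal C * pmean p F" by (simp add: mult_left_mono)
        from mF have "ennreal (m powr p) = ennreal (cmod (\<integral> x. F (dir x) \<partial>circ) powr p)"
          using m by (metis abs_of_pos norm_of_real)
        also have "\<dots> \<le> ennreal (1 powr (p - 1)) * (\<integral>\<^sup>+ x. ennreal (1 * f (dir x) powr p) \<partial>circ)"
          by (rule Jensen_integral) (use p f circ.emeasure_space_1 in \<open>auto simp: F_def\<close>)
        also have "\<dots> = pmean p F" using f by (simp add: pmean_def F_def)
        finally have lem: "ennreal (m powr p) \<le> pmean p F" .
        have "pmean p (cauchy_op r F) \<le> (\<integral>\<^sup>+ x. ennreal (2 powr p) * (ennreal (cmod (G (dir x)) powr p) + ennreal (m powr p)) \<partial>circ)"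
          unfolding pmean_def
        proof (rule nn_integral_mono)
          fix x
          have "2 * cauchy_op r F (dir x) = G (dir x) + of_real m" by (simp add: G_def)
          then have "2 * cmod (cauchy_op r F (dir x)) \<le> cmod (G (dir x)) + m"
            using norm_triangle_ineq[of "G (dir x)" "of_real m"] m by (metis abs_of_pos norm_mult norm_numeral norm_of_real)
          then have "cmod (cauchy_op r F (dir x)) \<le> cmod (G (dir x)) + m"
            using norm_ge_zero[of "cauchy_op r F (dir x)"] by linarith
          then have "cmod (cauchy_op r F (dir x)) powr p \<le> (cmod (G (dir x)) + m) powr p"
            using p by (intro powr_mono2) auto
          also have "\<dots> \<le> 2 powr p * (cmod (G (dir x)) powr p + m powr p)"
            using m p by (intro powr_add_le) auto
          finally show "ennreal (cmod (cauchy_op r F (dir x)) powr p)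
              \<le> ennreal (2 powr p) * (ennreal (cmod (G (dir x)) powr p) + ennreal (m powr p))"
            by (simp flip: ennreal_plus ennreal_mult')
        qed
        also have "\<dots> = ennreal (2 powr p) * (pmean p G + ennreal (m powr p))"
          using circ.emeasure_space_1 by (simp add: nn_integral_cmult nn_integral_add pmean_def)
        also have "\<dots> \<le> ennreal (2 powr p) * (ennreal C * pmean p F + pmean p F)"
          by (intro mult_left_mono add_mono leG lem) auto
        also have "\<dots> = ennreal (2 powr p * (C + 1)) * pmean p F"
          using C by (simp add: ennreal_mult' ennreal_plus ring_distribs mult.assoc)
        finally show ?thesis .
      qed
    qed
  qed
qed

lemma pmean_mono:
  assumes "\<And>u. cmod u = 1 \<Longrightarrow> cmod (f u) \<le> cmod (g u)" "0 \<le> p"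
  shows "pmean p f \<le> pmean p g"
  unfolding pmean_def using assms by (intro nn_integral_mono ennreal_leI powr_mono2) auto

lemma pmean_add_le:
  assumes [measurable]: "f \<in> borel_measurable borel" "g \<in> borel_measurable borel" and p: "0 \<le> p"
  shows "pmean p (\<lambda>u. f u + g u) \<le> ennreal (2 powr p) * (pmean p f + pmean p g)"
proof -
  have "pmean p (\<lambda>u. f u + g u)
    \<le> (\<integral>\<^sup>+ x. ennreal (2 powr p) * (ennreal (cmod (f (dir x)) powr p) + ennreal (cmod (g (dir x)) powr p)) \<partial>circ)"
    unfolding pmean_def
  proof (rule nn_integral_mono)
    fix x
    have "cmod (f (dir x) + g (dir x)) powr p \<le> (cmod (f (dir x)) + cmod (g (dir x))) powr p"
      using p by (intro powr_mono2 norm_triangle_ineq) auto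
    also have "\<dots> \<le> 2 powr p * (cmod (f (dir x)) powr p + cmod (g (dir x)) powr p)"
      using p by (intro powr_add_le) auto
    finally show "ennreal (cmod (f (dir x) + g (dir x)) powr p)
       \<le> ennreal (2 powr p) * (ennreal (cmod (f (dir x)) powr p) + ennreal (cmod (g (dir x)) powr p))"
      by (simp flip: ennreal_plus ennreal_mult')
  qed
  also have "\<dots> = ennreal (2 powr p) * (pmean p f + pmean p g)"
    by (simp add: nn_integral_cmult nn_integral_add pmean_def)
  finally show ?thesis .
qed

lemma cauchy_op_diff:
  assumes [measurable]: "f \<in> borel_measurable borel" "g \<in> borel_measurable borel"
    and i: "integrable circ (\<lambda>x. f (dir x))" "integrable circ (\<lambda>x. g (dir x))"
    and r: "0 \<le> r" "r < 1" "cmod u \<le> 1"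
  shows "cauchy_op r (\<lambda>x. f x - c * g x) u = cauchy_op r f u - c * cauchy_op r g u"
proof -
  have "integrable circ (\<lambda>x. f (dir x) / (1 - of_real r * u * cnj (dir x)))"
       "integrable circ (\<lambda>x. g (dir x) / (1 - of_real r * u * cnj (dir x)))"
    using r i by (auto intro!: integrable_cauchy_kernel[where R=1])
  then have "(\<integral> x. f (dir x) / (1 - of_real r * u * cnj (dir x)) - c * (g (dir x) / (1 - of_real r * u * cnj (dir x))) \<partial>circ)
     = cauchy_op r f u - c * cauchy_op r g u"
    unfolding cauchy_op_def integral_mult_right_zero[symmetric]
    by (intro Bochner_Integration.integral_diff integrable_mult_right)
  then show ?thesis by (simp add: cauchy_op_def diff_divide_distrib)
qed

text \<open>Linearity extends the nonnegative case to complex functions. \<open>comb\<close> handles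
  one splitting g - c h with |c| = 1; it is applied to positive and negative parts, which gives the
  constant \<open>B\<close>, and then to real and imaginary parts.\<close>

lemma cauchy_op_bounded_le2:
  fixes p :: real
  assumes p: "1 < p" "p \<le> 2"
  obtains A where "A > 0"
    "\<And>r f. 0 \<le> r \<Longrightarrow> r < 1 \<Longrightarrow> f \<in> borel_measurable borel \<Longrightarrow>
       pmean p (cauchy_op r f) \<le> ennreal A * pmean p f"
proof -
  obtain A where A: "A > 0" and
    nn: "\<And>r (f :: complex \<Rightarrow> real). 0 \<le> r \<Longrightarrow> r < 1 \<Longrightarrow> f \<in> borel_measurable borel \<Longrightarrow> (\<And>x. 0 \<le> f x) \<Longrightarrow>
       pmean p (cauchy_op r (\<lambda>x. of_real (f x))) \<le> ennreal A * pmean p (\<lambda>x. of_real (f x))"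
    using cauchy_op_nonneg_bounded[OF p] by metis
  define B where "B = 2 powr p * (A + A)"
  have B: "B > 0" using A by (simp add: B_def)
  have comb: "pmean p (cauchy_op r (\<lambda>x. g x - c * h x)) \<le> ennreal (2 powr p * (a + a)) * pmean p f"
    if r: "0 \<le> r" "r < 1" and c: "cmod c = 1" and [measurable]: "f \<in> borel_measurable borel" "g \<in> borel_measurable borel" "h \<in> borel_measurable borel"
    and a: "a > 0" and fin: "pmean p f < \<infinity>"
    and g: "pmean p (cauchy_op r g) \<le> ennreal a * pmean p g" "\<And>x. cmod (g x) \<le> cmod (f x)"
    and h: "pmean p (cauchy_op r h) \<le> ennreal a * pmean p h" "\<And>x. cmod (h x) \<le> cmod (f x)"
    for r c f g h a
  proof -
    have le: "pmean p g \<le> pmean p f" "pmean p h \<le> pmean p f" using g h p by (auto intro!: pmean_mono)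
    then have i: "integrable circ (\<lambda>x. g (dir x))" "integrable circ (\<lambda>x. h (dir x))"
      using p le_less_trans[OF _ fin] by (auto intro!: integrable_circ_if_pmean_finite(1)[where p=p])
    have "pmean p (cauchy_op r (\<lambda>x. g x - c * h x)) \<le> pmean p (\<lambda>u. cauchy_op r g u + (- c) * cauchy_op r h u)"
      using r p i by (intro pmean_mono) (auto simp: cauchy_op_diff)
    also have "\<dots> \<le> ennreal (2 powr p) * (pmean p (cauchy_op r g) + pmean p (\<lambda>u. (- c) * cauchy_op r h u))"
      using p by (intro pmean_add_le) auto
    also have "pmean p (\<lambda>u. (- c) * cauchy_op r h u) = pmean p (cauchy_op r h)"
      using c by (simp add: pmean_def norm_mult)
    also have "ennreal (2 powr p) * (pmean p (cauchy_op r g) + pmean p (cauchy_op r h))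
      \<le> ennreal (2 powr p) * (ennreal a * pmean p f + ennreal a * pmean p f)"
      by (intro mult_left_mono add_mono order_trans[OF g(1)] order_trans[OF h(1)] le) auto
    also have "ennreal a * pmean p f + ennreal a * pmean p f = ennreal (a + a) * pmean p f"
      using a by (subst ennreal_plus) (auto simp: distrib_right)
    also have "ennreal (2 powr p) * (ennreal (a + a) * pmean p f) = ennreal (2 powr p * (a + a)) * pmean p f"
      by (subst ennreal_mult') (auto simp: mult.assoc)
    finally show ?thesis .
  qed
  show thesis
  proof (rule that)
    show C: "2 powr p * (B + B) > 0" using B by simp
    fix r :: real and f :: "complex \<Rightarrow> complex"
    assume r: "0 \<le> r" "r < 1" and [measurable]: "f \<in> borel_measurable borel"
    show "pmean p (cauchy_op r f) \<le> ennreal (2 powr p * (B + B)) * pmean p f"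
    proof (cases "pmean p f < \<infinity>")
      case False
      then have "pmean p f = top" by (metis infinity_ennreal_def top.not_eq_extremum)
      then show ?thesis using B by (simp add: ennreal_mult_top)
    next
      case True
      have real: "pmean p (cauchy_op r (\<lambda>x. of_real (g x))) \<le> ennreal B * pmean p (\<lambda>x. of_real (g x))"
        if [measurable]: "g \<in> borel_measurable borel" and le: "\<And>x. \<bar>g x\<bar> \<le> cmod (f x)" for g :: "complex \<Rightarrow> real"
      proof -
        have fin: "pmean p (\<lambda>x. of_real (g x)) < \<infinity>"
          using le p by (intro le_less_trans[OF pmean_mono True]) auto
        have "pmean p (cauchy_op r (\<lambda>x. of_real (max 0 (g x)) - 1 * of_real (max 0 (- g x))))
            \<le> ennreal (2 powr p * (A + A)) * pmean p (\<lambda>x. of_real (g x))"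
          by (rule comb[OF r _ _ _ _ A fin nn[OF r] _ nn[OF r]]) auto
        also have "(\<lambda>x. complex_of_real (max 0 (g x)) - 1 * of_real (max 0 (- g x))) = (\<lambda>x. of_real (g x))"
          by (auto simp: max_def)
        finally show ?thesis by (simp add: B_def)
      qed
      have "pmean p (cauchy_op r (\<lambda>x. of_real (Re (f x)) - (- \<i>) * of_real (Im (f x))))
          \<le> ennreal (2 powr p * (B + B)) * pmean p f"
        by (rule comb[OF r _ _ _ _ B True real _ real]) (auto simp: abs_Re_le_cmod abs_Im_le_cmod)
      also have "(\<lambda>x. of_real (Re (f x)) - (- \<i>) * of_real (Im (f x))) = f"
        by (auto simp: complex_eq_iff)
      finally show ?thesis .
    qed
  qed
qed

text \<open>The kernel 1 / (1 - r u cnj v) becomes its conjugate when u and v are exchanged, so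
  Fubini moves the operator to the other factor. With \<open>f\<close> integrable, \<open>g\<close>
  bounded and r < 1 the double integral converges absolutely.\<close>

lemma cauchy_op_adjoint:
  assumes r: "0 \<le> r" "r < 1" and [measurable]: "f \<in> borel_measurable borel" "g \<in> borel_measurable borel"
    and int: "integrable circ (\<lambda>x. f (dir x))" and g: "\<And>x. cmod (g (dir x)) \<le> K"
  shows "(\<integral> x. cauchy_op r f (dir x) * g (dir x) \<partial>circ)
       = (\<integral> y. f (dir y) * cnj (cauchy_op r (\<lambda>u. cnj (g u)) (dir y)) \<partial>circ)"
proof -
  interpret PP: pair_sigma_finite circ circ ..
  have K: "0 \<le> K" using g[of 0] norm_ge_zero order_trans by blast
  define k where "k x y = f (dir y) / (1 - of_real r * dir x * cnj (dir y)) * g (dir x)" for x y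
  have kb: "cmod (k x y) \<le> K / (1 - r) * cmod (f (dir y))" for x y
  proof -
    have "cmod (f (dir y)) / cmod (1 - of_real r * dir x * cnj (dir y)) \<le> cmod (f (dir y)) / (1 - r)"
      using le_norm_one_minus[OF r(1), of "dir x" 1 y] r by (intro divide_left_mono mult_pos_pos) auto
    then have "cmod (f (dir y)) / cmod (1 - of_real r * dir x * cnj (dir y)) * cmod (g (dir x)) \<le> cmod (f (dir y)) / (1 - r) * K"
      using g r K by (intro mult_mono) auto
    then show ?thesis by (simp add: k_def norm_mult norm_divide mult_ac)
  qed
  have kmeas[measurable]: "(\<lambda>(x, y). k x y) \<in> borel_measurable (circ \<Otimes>\<^sub>M circ)" unfolding k_def by measurable
  have "integrable (circ \<Otimes>\<^sub>M circ) (\<lambda>(x, y). k x y)"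
  proof (rule integrableI_bounded)
    have "(\<integral>\<^sup>+ z. ennreal (norm (case z of (x, y) \<Rightarrow> k x y)) \<partial>(circ \<Otimes>\<^sub>M circ))
      = (\<integral>\<^sup>+ x. \<integral>\<^sup>+ y. ennreal (norm (k x y)) \<partial>circ \<partial>circ)"
      by (subst circ.nn_integral_fst[symmetric]) auto
    also have "\<dots> \<le> (\<integral>\<^sup>+ x. \<integral>\<^sup>+ y. ennreal (K / (1 - r) * cmod (f (dir y))) \<partial>circ \<partial>circ)"
      by (intro nn_integral_mono ennreal_leI kb)
    also have "\<dots> = (\<integral>\<^sup>+ y. ennreal (K / (1 - r) * cmod (f (dir y))) \<partial>circ)"
      using circ.emeasure_space_1 by simp
    also have "\<dots> < \<infinity>"
    proof -
      have "integrable circ (\<lambda>y. K / (1 - r) * cmod (f (dir y)))" using int by simp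
      then show ?thesis using K r by (subst nn_integral_eq_integral) auto
    qed
    finally show "(\<integral>\<^sup>+ z. ennreal (norm (case z of (x, y) \<Rightarrow> k x y)) \<partial>(circ \<Otimes>\<^sub>M circ)) < \<infinity>" .
  qed simp
  from PP.Fubini_integral[OF this]
  have fub: "(\<integral> y. \<integral> x. k x y \<partial>circ \<partial>circ) = (\<integral> x. \<integral> y. k x y \<partial>circ \<partial>circ)" .
  have "(\<integral> y. k x y \<partial>circ) = cauchy_op r f (dir x) * g (dir x)" for x
    unfolding k_def cauchy_op_def by (rule integral_mult_left_zero)
  moreover have "(\<integral> x. k x y \<partial>circ) = f (dir y) * cnj (cauchy_op r (\<lambda>u. cnj (g u)) (dir y))" for y
  proof -
    have "cnj (cauchy_op r (\<lambda>u. cnj (g u)) (dir y)) = (\<integral> x. g (dir x) / (1 - of_real r * dir x * cnj (dir y)) \<partial>circ)"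
      unfolding cauchy_op_def by (subst Bochner_Integration.integral_cnj[symmetric]) (simp add: mult_ac)
    then have "f (dir y) * cnj (cauchy_op r (\<lambda>u. cnj (g u)) (dir y))
        = (\<integral> x. f (dir y) * (g (dir x) / (1 - of_real r * dir x * cnj (dir y))) \<partial>circ)"
      by (simp only: integral_mult_right_zero)
    also have "(\<lambda>x. f (dir y) * (g (dir x) / (1 - of_real r * dir x * cnj (dir y)))) = (\<lambda>x. k x y)"
      by (simp add: k_def fun_eq_iff)
    finally show ?thesis by simp
  qed
  ultimately show ?thesis using fub by simp
qed

text \<open>The case \<open>p > 2\<close> is dual to the case \<open>p < 2\<close>.\<close>

theorem cauchy_op_bounded:
  fixes p :: real
  assumes p: "1 < p"
  obtains A where "A > 0"
    "\<And>r f. 0 \<le> r \<Longrightarrow> r < 1 \<Longrightarrow> f \<in> borel_measurable borel \<Longrightarrow>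
       pmean p (cauchy_op r f) \<le> ennreal A * pmean p f"
proof (cases "p \<le> 2")
  case True
  then show thesis using cauchy_op_bounded_le2[OF p] that by metis
next
  case False
  define q where "q = p / (p - 1)"
  have q: "1 < q" "q \<le> 2" using False by (auto simp: q_def field_simps)
  have pq: "1 / p + 1 / q = 1" using p by (simp add: q_def field_simps)
  have pqm: "(p - 1) * q = p" using p by (simp add: q_def)
  obtain A where A: "A > 0" and
    bd: "\<And>r f. 0 \<le> r \<Longrightarrow> r < 1 \<Longrightarrow> f \<in> borel_measurable borel \<Longrightarrow>
       pmean q (cauchy_op r f) \<le> ennreal A * pmean q f"
    using cauchy_op_bounded_le2[OF q] by metis
  \<comment> \<open>This scale in Young's inequality makes the term containing \<open>H\<close> at
    most \<open>X / 2\<close>, so that it can be absorbed.\<close>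
  define t where "t = (2 * A) powr (1 / q)"
  have t: "t > 0" using A by (simp add: t_def)
  have tq: "t powr q = 2 * A" using A q by (simp add: t_def powr_powr)
  show thesis
  proof (rule that)
    show C: "2 * t powr p > 0" using t by simp
    fix r :: real and f :: "complex \<Rightarrow> complex"
    assume r: "0 \<le> r" "r < 1" and [measurable]: "f \<in> borel_measurable borel"
    show "pmean p (cauchy_op r f) \<le> ennreal (2 * t powr p) * pmean p f"
    proof (cases "pmean p f < \<infinity>")
      case False
      then have "pmean p f = top" by (metis infinity_ennreal_def top.not_eq_extremum)
      then show ?thesis using C by (simp add: ennreal_mult_top)
    next
      case True
      have int: "integrable circ (\<lambda>x. f (dir x))" "integrable circ (\<lambda>x. cmod (f (dir x)) powr p)"
        using integrable_circ_if_pmean_finite[of f p] True p by auto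
      define F where "F = cauchy_op r f"
      have [measurable]: "F \<in> borel_measurable borel" unfolding F_def by measurable
      define K where "K = (\<integral> x. cmod (f (dir x)) \<partial>circ) / (1 - r * 1)"
      have FK: "cmod (F (dir x)) \<le> K" for x
        unfolding F_def K_def using r by (intro norm_cauchy_op_le int) auto
      \<comment> \<open>The extremal function of the duality between L^p and L^q: it satisfies F g =
        |F|^p and |g|^q = |F|^p.\<close>
      define g where "g u = of_real (cmod (F u) powr (p - 2)) * cnj (F u)" for u
      have [measurable]: "g \<in> borel_measurable borel" unfolding g_def by measurable
      have ng: "cmod (g u) = cmod (F u) powr (p - 1)" for u
      proof (cases "F u = 0")
        case False
        then have "cmod (F u) powr (p - 1) = cmod (F u) powr (p - 2) * cmod (F u) powr 1"
          by (subst powr_add[symmetric]) simp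
        then show ?thesis using False by (simp add: g_def norm_mult)
      qed (simp add: g_def)
      have Fg: "F u * g u = of_real (cmod (F u) powr p)" for u
      proof (cases "F u = 0")
        case False
        have "F u * g u = of_real (cmod (F u) powr (p - 2) * (cmod (F u))\<^sup>2)"
          using complex_norm_square[of "F u"] by (simp add: g_def mult_ac)
        also have "(cmod (F u))\<^sup>2 = cmod (F u) powr 2" using False by simp
        also have "cmod (F u) powr (p - 2) * cmod (F u) powr 2 = cmod (F u) powr p"
          by (subst powr_add[symmetric]) simp
        finally show ?thesis .
      qed (use p in simp)
      define gc where "gc = (\<lambda>u. cnj (g u))"
      have [measurable]: "gc \<in> borel_measurable borel" unfolding gc_def by measurable
      have gK: "cmod (g (dir x)) \<le> K powr (p - 1)" for x
        unfolding ng using FK p by (intro powr_mono2) auto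
      define H where "H = cauchy_op r gc"
      have [measurable]: "H \<in> borel_measurable borel" unfolding H_def by measurable
      have intg: "integrable circ (\<lambda>x. gc (dir x))"
        using gK by (intro circ.integrable_const_bound[where B="K powr (p - 1)"]) (auto simp: gc_def)
      define L where "L = (\<integral> x. cmod (gc (dir x)) \<partial>circ) / (1 - r * 1)"
      have HL: "cmod (H (dir x)) \<le> L" for x
        unfolding H_def L_def using r by (intro norm_cauchy_op_le intg) auto
      \<comment> \<open>Boundedness on the circle for r < 1 makes the p-mean of \<open>F\<close>
        finite, which is what allows \<open>X / 2\<close> to be subtracted at the end.\<close>
      have iF: "integrable circ (\<lambda>x. cmod (F (dir x)) powr p)"
        using FK p by (intro circ.integrable_const_bound[where B="K powr p"]) (auto intro!: powr_mono2)
      have iH: "integrable circ (\<lambda>x. cmod (H (dir x)) powr q)"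
        using HL q by (intro circ.integrable_const_bound[where B="L powr q"]) (auto intro!: powr_mono2)
      define X where "X = (\<integral> x. cmod (F (dir x)) powr p \<partial>circ)"
      define Y where "Y = (\<integral> x. cmod (f (dir x)) powr p \<partial>circ)"
      define Z where "Z = (\<integral> x. cmod (H (dir x)) powr q \<partial>circ)"
      have X: "pmean p F = ennreal X" and Y: "pmean p f = ennreal Y" and Z: "pmean q H = ennreal Z"
        unfolding X_def Y_def Z_def pmean_def using iF iH int(2) by (auto intro!: nn_integral_eq_integral)
      have X0: "X \<ge> 0" by (simp add: X_def)
      have "pmean q H \<le> ennreal A * pmean q gc" unfolding H_def by (rule bd[OF r]) simp
      also have "pmean q gc = pmean p F"
        unfolding pmean_def by (simp add: gc_def ng powr_powr pqm)
      finally have "ennreal Z \<le> ennreal (A * X)" using A X0 by (simp add: X Z ennreal_mult')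
      then have ZX: "Z \<le> A * X" using A X0 by simp
      have "complex_of_real X = (\<integral> x. F (dir x) * g (dir x) \<partial>circ)"
        unfolding Fg X_def by (rule integral_complex_of_real[symmetric])
      also have "\<dots> = (\<integral> y. f (dir y) * cnj (H (dir y)) \<partial>circ)"
        unfolding F_def H_def gc_def by (rule cauchy_op_adjoint[where g=g, OF r _ _ int(1) gK]) auto
      finally have "X = cmod (\<integral> y. f (dir y) * cnj (H (dir y)) \<partial>circ)" using X0
        by (metis abs_of_nonneg norm_of_real)
      also have "\<dots> \<le> (\<integral> y. t powr p / p * cmod (f (dir y)) powr p + 1 / (q * (2 * A)) * cmod (H (dir y)) powr q \<partial>circ)"
      proof (rule Bochner_Integration.integral_norm_bound_integral)
        show "integrable circ (\<lambda>y. f (dir y) * cnj (H (dir y)))"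
        proof (rule Bochner_Integration.integrable_bound)
          show "integrable circ (\<lambda>y. L * cmod (f (dir y)))" using int by simp
          have L: "0 \<le> L" using HL[of 0] norm_ge_zero order_trans by blast
          show "AE y in circ. norm (f (dir y) * cnj (H (dir y))) \<le> norm (L * cmod (f (dir y)))"
            using HL L by (intro AE_I2) (simp add: norm_mult abs_mult mult.commute mult_right_mono)
        qed simp
        show "integrable circ (\<lambda>y. t powr p / p * cmod (f (dir y)) powr p + 1 / (q * (2 * A)) * cmod (H (dir y)) powr q)"
          using int iH by simp
        fix y
        have "(t * cmod (f (dir y))) * (cmod (H (dir y)) / t)
            \<le> (t * cmod (f (dir y))) powr p / p + (cmod (H (dir y)) / t) powr q / q"
          using p q pq t by (intro Youngs_inequality) auto
        also have "\<dots> = t powr p / p * cmod (f (dir y)) powr p + 1 / (q * (2 * A)) * cmod (H (dir y)) powr q"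
          using t by (simp add: powr_mult powr_divide tq mult_ac)
        finally show "norm (f (dir y) * cnj (H (dir y))) \<le> t powr p / p * cmod (f (dir y)) powr p + 1 / (q * (2 * A)) * cmod (H (dir y)) powr q"
          using t by (simp add: norm_mult)
      qed
      also have "\<dots> = t powr p / p * Y + 1 / (q * (2 * A)) * Z"
        using int iH by (simp add: Y_def Z_def)
      also have "\<dots> \<le> t powr p * Y + X / 2"
      proof (rule add_mono)
        have "Y \<ge> 0" by (simp add: Y_def)
        then have "t powr p * Y * 1 \<le> t powr p * Y * p" using p by (intro mult_left_mono) auto
        then show "t powr p / p * Y \<le> t powr p * Y" using p by (simp add: divide_simps)
        have "1 / (q * (2 * A)) * Z \<le> 1 / (q * (2 * A)) * (A * X)" using ZX q A by (intro mult_left_mono) auto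
        also have "\<dots> = (X / 2) / q" using A by simp
        also have "\<dots> \<le> (X / 2) / 1" using X0 q by (intro divide_left_mono) auto
        finally show "1 / (q * (2 * A)) * Z \<le> X / 2" by simp
      qed
      finally have "X \<le> 2 * t powr p * Y" by simp
      then have "ennreal X \<le> ennreal (2 * t powr p * Y)" by (rule ennreal_leI)
      also have "\<dots> = ennreal (2 * t powr p) * ennreal Y" using t by (intro ennreal_mult') auto
      finally show ?thesis using X Y by (simp add: F_def)
    qed
  qed
qed

section \<open>Multipliers of bounded variation\<close>

definition trunc_op :: "real \<Rightarrow> nat \<Rightarrow> (complex \<Rightarrow> complex) \<Rightarrow> complex \<Rightarrow> complex" where
  "trunc_op r n f u = (\<integral> x. f (dir x) * (\<Sum>j<n. (of_real r * u * cnj (dir x)) ^ j) \<partial>circ)"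

lemma measurable_trunc_op [measurable]:
  assumes [measurable]: "f \<in> borel_measurable borel"
  shows "trunc_op r n f \<in> borel_measurable borel"
  unfolding trunc_op_def[abs_def] by measurable

lemma trunc_op_eq:
  assumes [measurable]: "f \<in> borel_measurable borel" and int: "integrable circ (\<lambda>x. f (dir x))"
    and r: "0 \<le> r" "r < 1" "cmod u \<le> 1"
  shows "trunc_op r n f u
    = cauchy_op r f u - (of_real r * u) ^ n * cauchy_op r (\<lambda>v. f v * cnj v ^ n) u"
proof -
  have intn: "integrable circ (\<lambda>x. f (dir x) * cnj (dir x) ^ n)"
    by (rule Bochner_Integration.integrable_bound[OF int]) (auto simp: norm_mult norm_power)
  have i: "integrable circ (\<lambda>x. f (dir x) / (1 - of_real r * u * cnj (dir x)))"
    "integrable circ (\<lambda>x. (f (dir x) * cnj (dir x) ^ n) / (1 - of_real r * u * cnj (dir x)))"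
    using r by (auto intro!: integrable_cauchy_kernel[where R=1 and f=f, OF _ int]
        integrable_cauchy_kernel[where R=1 and f="\<lambda>v. f v * cnj v ^ n", OF _ intn])
  have eq: "f (dir x) * (\<Sum>j<n. (of_real r * u * cnj (dir x)) ^ j)
    = f (dir x) / (1 - of_real r * u * cnj (dir x))
      - (of_real r * u) ^ n * ((f (dir x) * cnj (dir x) ^ n) / (1 - of_real r * u * cnj (dir x)))" for x
  proof -
    have "1 - of_real r * u * cnj (dir x) \<noteq> 0"
      using le_norm_one_minus[OF r(1,3), of x] r by auto
    then have "(\<Sum>j<n. (of_real r * u * cnj (dir x)) ^ j)
        = (1 - (of_real r * u) ^ n * cnj (dir x) ^ n) / (1 - of_real r * u * cnj (dir x))"
      by (subst sum_gp_strict) (simp add: power_mult_distrib)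
    then show ?thesis by (simp add: diff_divide_distrib right_diff_distrib mult_ac)
  qed
  show ?thesis
    unfolding trunc_op_def eq cauchy_op_def integral_mult_right_zero[symmetric]
    by (intro Bochner_Integration.integral_diff integrable_mult_right i)
qed

text \<open>By the finite geometric sum, truncation is the Cauchy operator minus r^n times the same
  operator conjugated by the unimodular factor u^n. Hence the bound does not depend on
  \<open>n\<close> or \<open>r\<close>.\<close>

lemma trunc_op_bounded:
  fixes p :: real
  assumes p: "1 < p"
  obtains A where "A > 0"
    "\<And>r n f. 0 \<le> r \<Longrightarrow> r < 1 \<Longrightarrow> f \<in> borel_measurable borel \<Longrightarrow>
       pmean p (trunc_op r n f) \<le> ennreal A * pmean p f"
proof -
  obtain A where A: "A > 0" and
    bd: "\<And>r f. 0 \<le> r \<Longrightarrow> r < 1 \<Longrightarrow> f \<in> borel_measurable borel \<Longrightarrow>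
       pmean p (cauchy_op r f) \<le> ennreal A * pmean p f"
    using cauchy_op_bounded[OF p] by metis
  show thesis
  proof (rule that)
    show C: "2 powr p * (A + A) > 0" using A by simp
    fix r :: real and n and f :: "complex \<Rightarrow> complex"
    assume r: "0 \<le> r" "r < 1" and [measurable]: "f \<in> borel_measurable borel"
    show "pmean p (trunc_op r n f) \<le> ennreal (2 powr p * (A + A)) * pmean p f"
    proof (cases "pmean p f < \<infinity>")
      case False
      then have "pmean p f = top" by (metis infinity_ennreal_def top.not_eq_extremum)
      then show ?thesis using A by (simp add: ennreal_mult_top)
    next
      case True
      have int: "integrable circ (\<lambda>x. f (dir x))"
        using integrable_circ_if_pmean_finite[of f p] True p by auto
      let ?g = "\<lambda>v. f v * cnj v ^ n"
      let ?h = "\<lambda>u. - ((of_real r * u) ^ n) * cauchy_op r ?g u"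
      have "pmean p (trunc_op r n f) \<le> pmean p (\<lambda>u. cauchy_op r f u + ?h u)"
        using p r int by (intro pmean_mono) (auto simp: trunc_op_eq)
      also have "\<dots> \<le> ennreal (2 powr p) * (pmean p (cauchy_op r f) + pmean p ?h)"
        using p by (intro pmean_add_le) auto
      also have "\<dots> \<le> ennreal (2 powr p) * (ennreal A * pmean p f + ennreal A * pmean p f)"
      proof (intro mult_left_mono add_mono bd r)
        have "pmean p ?h \<le> pmean p (cauchy_op r ?g)"
          using p r by (intro pmean_mono) (auto simp: norm_mult norm_power power_le_one intro!: mult_left_le_one_le)
        also have "\<dots> \<le> ennreal A * pmean p ?g" by (rule bd[OF r]) simp
        also have "pmean p ?g = pmean p f" by (simp add: pmean_def norm_mult norm_power)
        finally show "pmean p ?h \<le> ennreal A * pmean p f" .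
      qed auto
      also have "ennreal A * pmean p f + ennreal A * pmean p f = ennreal (A + A) * pmean p f"
        using A by (subst ennreal_plus) (auto simp: distrib_right)
      also have "ennreal (2 powr p) * (ennreal (A + A) * pmean p f) = ennreal (2 powr p * (A + A)) * pmean p f"
        by (subst ennreal_mult') (auto simp: mult.assoc)
      finally show ?thesis .
    qed
  qed
qed

lemma norm_trunc_op_le:
  assumes [measurable]: "f \<in> borel_measurable borel" and int: "integrable circ (\<lambda>x. f (dir x))"
    and r: "0 \<le> r" "r < 1" "cmod u \<le> 1"
  shows "cmod (\<Sum>j<n. (of_real r * u * cnj (dir x)) ^ j) \<le> 1 / (1 - r)"
    and "integrable circ (\<lambda>x. f (dir x) * (\<Sum>j<n. (of_real r * u * cnj (dir x)) ^ j))"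
    and "cmod (trunc_op r n f u) \<le> (\<integral> x. cmod (f (dir x)) \<partial>circ) / (1 - r)"
proof -
  show k: "cmod (\<Sum>j<n. (of_real r * u * cnj (dir x)) ^ j) \<le> 1 / (1 - r)" for x
  proof -
    have "cmod (\<Sum>j<n. (of_real r * u * cnj (dir x)) ^ j) \<le> (\<Sum>j<n. r ^ j)"
    proof (rule sum_norm_le)
      fix j
      have "r * cmod u \<le> r * 1" using r by (intro mult_left_mono) auto
      then show "cmod ((of_real r * u * cnj (dir x)) ^ j) \<le> r ^ j"
        using r by (simp add: norm_power norm_mult power_mono)
    qed
    also have "\<dots> = (1 - r ^ n) / (1 - r)" using r by (simp add: sum_gp_strict)
    also have "\<dots> \<le> 1 / (1 - r)" using r by (intro divide_right_mono) auto
    finally show ?thesis .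
  qed
  have kf: "cmod (f (dir x) * (\<Sum>j<n. (of_real r * u * cnj (dir x)) ^ j)) \<le> cmod (f (dir x)) * (1 / (1 - r))" for x
    unfolding norm_mult by (intro mult_left_mono k) auto
  show i: "integrable circ (\<lambda>x. f (dir x) * (\<Sum>j<n. (of_real r * u * cnj (dir x)) ^ j))"
  proof (rule Bochner_Integration.integrable_bound)
    show "integrable circ (\<lambda>x. cmod (f (dir x)) * (1 / (1 - r)))" using int by simp
    show "AE x in circ. norm (f (dir x) * (\<Sum>j<n. (of_real r * u * cnj (dir x)) ^ j)) \<le> norm (cmod (f (dir x)) * (1 / (1 - r)))"
      using kf order_trans[OF kf abs_ge_self] by (intro AE_I2) simp
  qed simp
  have "cmod (trunc_op r n f u) \<le> (\<integral> x. cmod (f (dir x)) * (1 / (1 - r)) \<partial>circ)"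
    unfolding trunc_op_def
    by (rule Bochner_Integration.integral_norm_bound_integral[OF i _ kf]) (use int in simp)
  then show "cmod (trunc_op r n f u) \<le> (\<integral> x. cmod (f (dir x)) \<partial>circ) / (1 - r)" by simp
qed

text \<open>Multiplied by 1 - x, the second claim combines three convergent series: the telescoping
  series with sum \<open>b 0\<close>, plus the shifted series with sum \<open>S - b 0\<close>, minus
  the one with sum \<open>x * S\<close>. No boundary terms of partial sums arise.\<close>

lemma power_series_summation_by_parts:
  fixes b :: "nat \<Rightarrow> real" and x :: complex
  assumes b0: "b \<longlonglongrightarrow> 0" and x: "cmod x < 1"
  shows "summable (\<lambda>j. of_real (b j) * x ^ j)"
    and "(\<lambda>n. of_real (b n - b (Suc n)) * (\<Sum>j<Suc n. x ^ j)) sums (\<Sum>j. of_real (b j) * x ^ j)"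
proof -
  obtain K where K: "\<And>n. \<bar>b n\<bar> \<le> K"
    using convergent_imp_Bseq[OF convergentI[OF b0]] by (auto simp: Bseq_def)
  show s: "summable (\<lambda>j. of_real (b j) * x ^ j)"
  proof (rule summable_comparison_test')
    show "summable (\<lambda>j. K * cmod x ^ j)" using x by (intro summable_mult summable_geometric) simp
    show "norm (of_real (b n) * x ^ n) \<le> K * cmod x ^ n" for n
      using K by (simp add: norm_mult norm_power mult_right_mono)
  qed
  define S where "S = (\<Sum>j. of_real (b j) * x ^ j)"
  have x1: "1 - x \<noteq> 0" using x by auto
  have S: "(\<lambda>j. of_real (b j) * x ^ j) sums S" using s by (simp add: S_def summable_sums)
  then have S1: "(\<lambda>j. of_real (b (Suc j)) * x ^ Suc j) sums (S - of_real (b 0))"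
    by (subst sums_Suc_iff) simp
  have S2: "(\<lambda>j. of_real (b j) * x ^ Suc j) sums (x * S)"
    using sums_mult[OF S, of x] by (simp add: mult_ac)
  have "(\<lambda>n. b n - b (Suc n)) sums (b 0 - 0)" by (rule telescope_sums'[OF b0])
  then have "(\<lambda>n. complex_of_real (b n - b (Suc n))) sums of_real (b 0)"
    by (subst sums_of_real_iff) simp
  from sums_add[OF this sums_diff[OF S1 S2]]
  have "(\<lambda>n. of_real (b n - b (Suc n)) * (1 - x ^ Suc n)) sums ((1 - x) * S)"
    by (simp add: algebra_simps)
  from sums_divide[OF this, of "1 - x"]
  show "(\<lambda>n. of_real (b n - b (Suc n)) * (\<Sum>j<Suc n. x ^ j)) sums S"
    using x1 by (simp add: sum_gp_strict del: sum.lessThan_Suc)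
qed

text \<open>
  Summation by parts writes a multiplier of bounded variation as an average of truncations.
\<close>

theorem bounded_variation_multiplier:
  fixes p :: real
  assumes p: "1 < p"
  obtains A where "A > 0"
    "\<And>r b V f. 0 \<le> r \<Longrightarrow> r < 1 \<Longrightarrow> f \<in> borel_measurable borel \<Longrightarrow>
       b \<longlonglongrightarrow> 0 \<Longrightarrow> summable (\<lambda>n. \<bar>b n - b (Suc n)\<bar>) \<Longrightarrow>
       (\<Sum>n. \<bar>b n - b (Suc n)\<bar>) \<le> V \<Longrightarrow> 0 < V \<Longrightarrow>
       pmean p (\<lambda>u. \<integral> x. f (dir x) * (\<Sum>j. of_real (b j) * (of_real r * u * cnj (dir x)) ^ j) \<partial>circ)
       \<le> ennreal (V powr p * A) * pmean p f"
proof -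
  obtain A where A: "A > 0" and
    bd: "\<And>r n f. 0 \<le> r \<Longrightarrow> r < 1 \<Longrightarrow> f \<in> borel_measurable borel \<Longrightarrow>
       pmean p (trunc_op r n f) \<le> ennreal A * pmean p f"
    using trunc_op_bounded[OF p] by metis
  show thesis
  proof (rule that[OF A])
    fix r V :: real and b :: "nat \<Rightarrow> real" and f :: "complex \<Rightarrow> complex"
    assume r: "0 \<le> r" "r < 1" and [measurable]: "f \<in> borel_measurable borel"
      and b0: "b \<longlonglongrightarrow> 0" and sb: "summable (\<lambda>n. \<bar>b n - b (Suc n)\<bar>)"
      and V: "(\<Sum>n. \<bar>b n - b (Suc n)\<bar>) \<le> V" "0 < V"
    define d where "d n = b n - b (Suc n)" for n
    define T where "T u = (\<integral> x. f (dir x) * (\<Sum>j. of_real (b j) * (of_real r * u * cnj (dir x)) ^ j) \<partial>circ)" for u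
    show "pmean p T \<le> ennreal (V powr p * A) * pmean p f"
    proof (cases "pmean p f < \<infinity>")
      case False
      then have "pmean p f = top" by (metis infinity_ennreal_def top.not_eq_extremum)
      then show ?thesis using A V by (simp add: ennreal_mult_top)
    next
      case True
      have int: "integrable circ (\<lambda>x. f (dir x))"
        using integrable_circ_if_pmean_finite[of f p] True p by auto
      have sd: "summable (\<lambda>n. \<bar>d n\<bar>)" using sb by (simp add: d_def)
      have Vn: "(\<Sum>n. ennreal \<bar>d n\<bar>) \<le> ennreal V"
        using V sd by (subst suminf_ennreal2) (auto simp: d_def intro!: ennreal_leI)
      have ptw: "ennreal (cmod (T u) powr p)
          \<le> ennreal (V powr (p - 1)) * (\<Sum>n. ennreal (\<bar>d n\<bar> * cmod (trunc_op r (Suc n) f u) powr p))"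
        if u: "cmod u = 1" for u
      proof -
        have u': "cmod u \<le> 1" using u by simp
        let ?t = "\<lambda>n x. f (dir x) * (\<Sum>j<Suc n. (of_real r * u * cnj (dir x)) ^ j)"
        have i: "integrable circ (\<lambda>x. of_real (d n) * ?t n x)" for n
          by (intro integrable_mult_right norm_trunc_op_le(2) int r u') simp
        have nb: "norm (of_real (d n) * ?t n x)
            \<le> \<bar>d n\<bar> * (cmod (f (dir x)) * (1 / (1 - r)))" for n x
          unfolding norm_mult norm_of_real
          by (intro mult_left_mono norm_trunc_op_le(1)[OF _ int r u']) auto
        have "(\<lambda>n. \<integral> x. of_real (d n) * ?t n x \<partial>circ)
           sums (\<integral> x. (\<Sum>n. of_real (d n) * ?t n x) \<partial>circ)"
        proof (rule sums_integral[OF i])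
          show "AE x in circ. summable (\<lambda>n. norm (of_real (d n) * ?t n x))"
            using nb by (intro AE_I2 summable_comparison_test'[OF summable_mult2[OF sd]]) (auto simp only: real_norm_def abs_norm_cancel)
          show "summable (\<lambda>n. \<integral> x. norm (of_real (d n) * ?t n x) \<partial>circ)"
          proof (rule summable_comparison_test'[OF summable_mult2[OF sd]])
            fix n
            have "(\<integral> x. norm (of_real (d n) * ?t n x) \<partial>circ)
                \<le> (\<integral> x. \<bar>d n\<bar> * (cmod (f (dir x)) * (1 / (1 - r))) \<partial>circ)"
              using int by (intro integral_mono integrable_norm i nb) auto
            also have "\<dots> = \<bar>d n\<bar> * ((\<integral> x. cmod (f (dir x)) \<partial>circ) * (1 / (1 - r)))" by simp
            finally show "norm (\<integral> x. norm (of_real (d n) * ?t n x) \<partial>circ)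
               \<le> \<bar>d n\<bar> * ((\<integral> x. cmod (f (dir x)) \<partial>circ) * (1 / (1 - r)))"
              by (subst real_norm_def, subst abs_of_nonneg) auto
          qed
        qed
        also have "(\<lambda>n. \<integral> x. of_real (d n) * ?t n x \<partial>circ)
           = (\<lambda>n. of_real (d n) * trunc_op r (Suc n) f u)"
          unfolding trunc_op_def by (simp only: integral_mult_right_zero)
        also have "(\<integral> x. (\<Sum>n. of_real (d n) * ?t n x) \<partial>circ) = T u"
          unfolding T_def
        proof (intro Bochner_Integration.integral_cong refl)
          fix x
          have "cmod (of_real r * u * cnj (dir x)) < 1" using r u by (simp add: norm_mult)
          from sums_mult[OF power_series_summation_by_parts(2)[OF b0 this], of "f (dir x)"]
          show "(\<Sum>n. of_real (d n) * ?t n x)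
             = f (dir x) * (\<Sum>j. of_real (b j) * (of_real r * u * cnj (dir x)) ^ j)"
            by (simp add: sums_iff d_def mult_ac del: sum.lessThan_Suc)
        qed
        finally have sums: "(\<lambda>n. of_real (d n) * trunc_op r (Suc n) f u) sums T u" .
        have "summable (\<lambda>n. norm (of_real (d n) * trunc_op r (Suc n) f u))"
        proof (rule summable_comparison_test'[OF summable_mult2[OF sd]])
          fix n
          show "norm (norm (of_real (d n) * trunc_op r (Suc n) f u)) \<le> \<bar>d n\<bar> * ((\<integral> x. cmod (f (dir x)) \<partial>circ) / (1 - r))"
            unfolding norm_mult norm_of_real real_norm_def abs_mult abs_abs abs_norm_cancel
            by (intro mult_left_mono norm_trunc_op_le(3) int r u') auto
        qed
        \<comment> \<open>Reading the series as an integral over counting measure makes Jensen's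
          inequality available, with weights |d n| of total mass at most V.\<close>
        then have Tu: "T u = (\<integral> n. of_real (d n) * trunc_op r (Suc n) f u \<partial>count_space UNIV)"
          using sums by (subst integral_count_space_nat) (auto simp: integrable_count_space_nat_iff sums_iff)
        have "ennreal (cmod (T u) powr p)
          \<le> ennreal (V powr (p - 1)) * (\<integral>\<^sup>+ n. ennreal (\<bar>d n\<bar> * cmod (trunc_op r (Suc n) f u) powr p) \<partial>count_space UNIV)"
          unfolding Tu
        proof (rule Jensen_integral[OF p])
          show "(\<integral>\<^sup>+ n. ennreal \<bar>d n\<bar> \<partial>count_space UNIV) \<le> ennreal V"
            using Vn by (simp add: nn_integral_count_space_nat)
        qed (use V in \<open>auto simp: norm_mult\<close>)
        then show ?thesis by (simp add: nn_integral_count_space_nat)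
      qed
      have "pmean p T \<le> (\<integral>\<^sup>+ x. ennreal (V powr (p - 1)) * (\<Sum>n. ennreal (\<bar>d n\<bar> * cmod (trunc_op r (Suc n) f (dir x)) powr p)) \<partial>circ)"
        unfolding pmean_def by (intro nn_integral_mono ptw) simp
      also have "\<dots> = ennreal (V powr (p - 1)) * (\<Sum>n. \<integral>\<^sup>+ x. ennreal (\<bar>d n\<bar> * cmod (trunc_op r (Suc n) f (dir x)) powr p) \<partial>circ)"
        by (subst nn_integral_cmult) (auto simp: nn_integral_suminf)
      also have "\<dots> = ennreal (V powr (p - 1)) * (\<Sum>n. ennreal \<bar>d n\<bar> * pmean p (trunc_op r (Suc n) f))"
        by (simp add: ennreal_mult' nn_integral_cmult pmean_def)
      also have "\<dots> \<le> ennreal (V powr (p - 1)) * (\<Sum>n. ennreal \<bar>d n\<bar> * (ennreal A * pmean p f))"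
        by (intro mult_left_mono suminf_le bd r) auto
      also have "\<dots> = ennreal (V powr (p - 1)) * ((\<Sum>n. ennreal \<bar>d n\<bar>) * (ennreal A * pmean p f))"
        by (simp add: ennreal_suminf_multc)
      also have "\<dots> \<le> ennreal (V powr (p - 1)) * (ennreal V * (ennreal A * pmean p f))"
        by (intro mult_left_mono mult_right_mono Vn) auto
      also have "\<dots> = ennreal (V powr (p - 1) * V * A) * pmean p f"
        using A V by (simp add: ennreal_mult' mult_ac)
      also have "V powr (p - 1) * V = V powr p" using V by (simp add: powr_diff)
      finally show ?thesis .
    qed
  qed
qed

section \<open>Radial measures on the disc\<close>

text \<open>The properties of \<nu> dA on which the analysis rests. A Borel measure on the whole
  plane, instead of a weighted Lebesgue measure on the disc, keeps products with \<open>circ\<close>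
  and compositions with rotations measurable.\<close>

locale radial_measure = finite_measure M for M :: "complex measure" +
  assumes sets_M [measurable_cong, simp]: "sets M = sets borel"
    and rotation: "\<And>e. cmod e = 1 \<Longrightarrow> distr M borel ((*) e) = M"
    and AE_disc: "AE z in M. cmod z < 1"
    and tail_pos: "\<And>r. r < 1 \<Longrightarrow> 0 < measure M {z. r \<le> cmod z}"
begin

definition tail :: "real \<Rightarrow> real" where
  "tail r = measure M {z. r \<le> cmod z}"

text \<open>For M = \<nu> dA these are the numbers 2 \<nu>_(2n+1) in the denominators of the kernel
  series.\<close>

definition moment :: "nat \<Rightarrow> real" where
  "moment n = (\<integral> z. cmod z ^ (2 * n) \<partial>M)"

lemma space_M [simp]: "space M = UNIV"
  using sets_eq_imp_space_eq[OF sets_M] by simp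

lemma tail_nonneg [simp]: "0 \<le> tail r"
  and tail_gt_0: "r < 1 \<Longrightarrow> 0 < tail r"
  using tail_pos by (simp_all add: tail_def)

lemma tail_ge_1 [simp]: "1 \<le> r \<Longrightarrow> tail r = 0"
proof -
  assume r: "1 \<le> r"
  have "{z. r \<le> cmod z} \<in> sets M" by simp
  moreover have "AE z in M. z \<notin> {z. r \<le> cmod z}" using AE_disc by eventually_elim (use r in auto)
  ultimately have "{z. r \<le> cmod z} \<in> null_sets M" by (simp add: AE_iff_null_sets)
  then show ?thesis by (simp add: tail_def measure_eq_0_null_sets)
qed

lemma emeasure_tail: "emeasure M {z. r \<le> cmod z} = ennreal (tail r)"
  by (simp add: tail_def emeasure_eq_measure)

lemma tail_antimono: "r \<le> s \<Longrightarrow> tail s \<le> tail r"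
  unfolding tail_def by (intro finite_measure_mono) auto

lemma measurable_tail [measurable]: "tail \<in> borel_measurable borel"
proof -
  have "mono (\<lambda>r. - tail r)" using tail_antimono by (auto simp: mono_def)
  then have "(\<lambda>r. - (- tail r)) \<in> borel_measurable borel"
    by (intro borel_measurable_uminus borel_measurable_mono)
  then show ?thesis by simp
qed

text \<open>Sublevel sets of the tail are contained in an exterior |z| \<ge> r0 or |z| > r0. In the
  first case the tail at r0 is the bound; in the second, where the tail jumps at r0, the open
  exterior is exhausted by closed ones, each of measure at most t.\<close>

lemma emeasure_tail_le:
  assumes t: "t > 0"
  shows "emeasure M {z. tail (cmod z) \<le> t} \<le> ennreal t"
proof -
  define R where "R = {r. 0 \<le> r \<and> tail r \<le> t}"
  have R1: "1 \<in> R" using t by (simp add: R_def)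
  have bdd: "bdd_below R" by (auto simp: R_def bdd_below_def)
  define r0 where "r0 = Inf R"
  have sub: "r0 \<le> cmod z" if "tail (cmod z) \<le> t" for z
    unfolding r0_def using that by (intro cInf_lower bdd) (simp add: R_def)
  show ?thesis
  proof (cases "tail r0 \<le> t")
    case True
    have "emeasure M {z. tail (cmod z) \<le> t} \<le> emeasure M {z. r0 \<le> cmod z}"
      using sub by (intro emeasure_mono) auto
    also have "\<dots> \<le> ennreal t" using True by (simp add: emeasure_tail ennreal_leI)
    finally show ?thesis .
  next
    case False
    define A where "A k = {z. r0 + 1 / Suc k \<le> cmod z}" for k :: nat
    have "R \<noteq> {}" using R1 by auto
    then have r0: "0 \<le> r0" unfolding r0_def by (rule cInf_greatest) (simp add: R_def)
    have "tail (r0 + 1 / Suc k) \<le> t" for k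
    proof -
      have "r0 < r0 + 1 / Suc k" by simp
      then obtain r where "r \<in> R" "r < r0 + 1 / Suc k"
        unfolding r0_def using cInf_lessD[of R] R1 by blast
      then show ?thesis using tail_antimono[of r "r0 + 1 / Suc k"] by (auto simp: R_def)
    qed
    then have mA: "measure M (A k) \<le> t" for k by (simp add: A_def tail_def)
    have "(\<lambda>k. measure M (A k)) \<longlonglongrightarrow> measure M (\<Union>k. A k)"
    proof (rule finite_Lim_measure_incseq)
      show "range A \<subseteq> sets M" by (auto simp: A_def)
      show "incseq A"
      proof (rule incseq_SucI)
        fix n
        have "1 / real (Suc (Suc n)) \<le> 1 / real (Suc n)" by (simp add: frac_le)
        then show "A n \<subseteq> A (Suc n)" by (auto simp: A_def)
      qed
    qed
    then have le: "measure M (\<Union>k. A k) \<le> t" by (rule LIMSEQ_le_const2) (use mA in auto)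
    have "{z. tail (cmod z) \<le> t} \<subseteq> (\<Union>k. A k)"
    proof
      fix z assume z: "z \<in> {z. tail (cmod z) \<le> t}"
      then have "r0 \<le> cmod z" "r0 \<noteq> cmod z" using sub False by auto
      then obtain k where "inverse (real (Suc k)) < cmod z - r0"
        using reals_Archimedean[of "cmod z - r0"] by auto
      then show "z \<in> (\<Union>k. A k)" by (auto simp: A_def inverse_eq_divide intro!: exI[of _ k])
    qed
    then have "emeasure M {z. tail (cmod z) \<le> t} \<le> emeasure M (\<Union>k. A k)"
      by (intro emeasure_mono) (auto simp: A_def)
    also have "\<dots> \<le> ennreal t" using le by (simp add: emeasure_eq_measure ennreal_leI)
    finally show ?thesis .
  qed
qed

lemma dyadic_above:
  fixes y :: real assumes "1 < y" obtains i :: nat where "2 ^ i < y" "y \<le> 2 ^ Suc i"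
proof -
  obtain n :: nat where n: "y \<le> 2 ^ n" using real_arch_pow[of 2 y] by (auto intro: less_imp_le)
  define k where "k = (LEAST n. y \<le> 2 ^ n)"
  have k: "y \<le> 2 ^ k" unfolding k_def by (rule LeastI[of _ n]) (rule n)
  have "k \<noteq> 0" using k assms by (intro notI) simp
  then obtain i where i: "k = Suc i" by (cases k) auto
  have "\<not> y \<le> 2 ^ i" using not_less_Least[of i "\<lambda>n. y \<le> 2 ^ n"] i by (simp add: k_def)
  then show thesis using that[of i] k i by auto
qed

lemma dyadic_below:
  fixes y :: real assumes "0 < y" "y \<le> 1" obtains j :: nat where "1 / 2 ^ Suc j < y" "y \<le> 1 / 2 ^ j"
proof -
  obtain n :: nat where n: "1 / 2 ^ n < y"
    using real_arch_pow_inv[of y "1/2"] assms by (auto simp: power_one_over)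
  define k where "k = (LEAST n. 1 / 2 ^ n < y)"
  have k: "1 / 2 ^ k < y" unfolding k_def by (rule LeastI[of _ n]) (rule n)
  have "k \<noteq> 0" using k assms by (intro notI) simp
  then obtain i where i: "k = Suc i" by (cases k) auto
  have "\<not> 1 / 2 ^ i < y" using not_less_Least[of i "\<lambda>n. 1 / 2 ^ n < y"] i by (simp add: k_def)
  then show thesis using that[of i] k i by auto
qed

text \<open>Only \<open>M {tail \<le> t} \<le> t\<close> is used, on dyadic levels of the tail.\<close>

lemma schur_test:
  assumes a: "0 < a" "a < 1"
  obtains C where "C > 0"
    "\<And>T. T > 0 \<Longrightarrow> (\<integral>\<^sup>+ z. ennreal (tail (cmod z) powr (- a) / max (tail (cmod z)) T) \<partial>M)
       \<le> ennreal (C * T powr (- a))"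
proof
  \<comment> \<open>The ratios of two geometric series. On T 2^i < tail \<le> T 2^(i+1) the
    integrand is at most (T 2^i)^(-a-1), on a set of mass at most T 2^(i+1), which gives \<alpha>^i;
    on T / 2^(j+1) < tail \<le> T / 2^j the same count gives \<beta>^j. Both series converge because
    0 < a < 1.\<close>
  define \<alpha> \<beta> where "\<alpha> = 2 powr (- a)" and "\<beta> = 2 powr (a - 1)"
  have ab: "0 < \<alpha>" "\<alpha> < 1" "0 < \<beta>" "\<beta> < 1"
    using a powr_less_mono[of "- a" 0 2] powr_less_mono[of "a - 1" 0 2] by (auto simp: \<alpha>_def \<beta>_def)
  show "2 / (1 - \<alpha>) + 2 powr a / (1 - \<beta>) > 0" using ab by (simp add: add_pos_pos)
  fix T :: real assume T: "T > 0"
  define \<phi> where "\<phi> x = x powr (- a) / max x T" for x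
  have \<phi>0: "0 \<le> \<phi> x" for x using T by (simp add: \<phi>_def)
  have \<phi>mono: "\<phi> y \<le> \<phi> x" if "0 < x" "x \<le> y" for x y
    unfolding \<phi>_def using that T a by (intro frac_le powr_mono2') auto
  define U where "U i = {z. tail (cmod z) \<le> T * 2 ^ Suc i}" for i :: nat
  define L where "L j = {z. tail (cmod z) \<le> T / 2 ^ j}" for j :: nat
  have [measurable]: "U i \<in> sets borel" "L j \<in> sets borel" for i j unfolding U_def L_def by measurable
  let ?up = "\<lambda>z. \<Sum>i. ennreal (\<phi> (T * 2 ^ i)) * indicator (U i) z"
  let ?lo = "\<lambda>z. \<Sum>j. ennreal (\<phi> (T / 2 ^ Suc j)) * indicator (L j) z"
  have single_le: "f i \<le> suminf f" for f :: "nat \<Rightarrow> ennreal" and i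
    using sum_le_suminf[of f "{i}"] by simp
  have "(\<integral>\<^sup>+ z. ennreal (\<phi> (tail (cmod z))) \<partial>M) \<le>
      (\<integral>\<^sup>+ z. ?up z + ?lo z \<partial>M)"
  proof (rule nn_integral_mono)
    fix z
    define x where "x = tail (cmod z)"
    have "0 \<le> x" by (simp add: x_def)
    then consider "x = 0" | "x > T" | "0 < x" "x \<le> T" by (cases "x = 0"; cases "x \<le> T") auto
    then show "ennreal (\<phi> (tail (cmod z))) \<le> ?up z + ?lo z"
      unfolding x_def[symmetric]
    proof cases
      \<comment> \<open>\<open>0 powr (- a)\<close> is 0, so points of zero tail contribute
        nothing.\<close>
      case 1 then show "ennreal (\<phi> x) \<le> ?up z + ?lo z"
        by (simp add: \<phi>_def)
    next
      case 2
      then obtain i where i: "2 ^ i < x / T" "x / T \<le> 2 ^ Suc i" using dyadic_above[of "x / T"] T by auto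
      then have i': "T * 2 ^ i < x" "x \<le> T * 2 ^ Suc i" using T by (auto simp: field_simps)
      then have "\<phi> x \<le> \<phi> (T * 2 ^ i)" using T by (intro \<phi>mono) auto
      then have "ennreal (\<phi> x) \<le> ennreal (\<phi> (T * 2 ^ i)) * indicator (U i) z"
        using i' by (simp add: U_def x_def ennreal_leI)
      also have "\<dots> \<le> ?up z" by (rule single_le)
      finally show "ennreal (\<phi> x) \<le> ?up z + ?lo z"
        by (rule add_increasing2[rotated]) simp
    next
      case 3
      then obtain j where j: "1 / 2 ^ Suc j < x / T" "x / T \<le> 1 / 2 ^ j" using dyadic_below[of "x / T"] T by auto
      then have j': "T / 2 ^ Suc j < x" "x \<le> T / 2 ^ j" using T by (auto simp: field_simps)
      then have "\<phi> x \<le> \<phi> (T / 2 ^ Suc j)" using T by (intro \<phi>mono) auto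
      then have "ennreal (\<phi> x) \<le> ennreal (\<phi> (T / 2 ^ Suc j)) * indicator (L j) z"
        using j' by (simp add: L_def x_def ennreal_leI)
      also have "\<dots> \<le> ?lo z" by (rule single_le)
      finally show "ennreal (\<phi> x) \<le> ?up z + ?lo z"
        by (rule add_increasing[rotated]) simp
    qed
  qed
  also have "\<dots> = (\<Sum>i. ennreal (\<phi> (T * 2 ^ i)) * emeasure M (U i)) + (\<Sum>j. ennreal (\<phi> (T / 2 ^ Suc j)) * emeasure M (L j))"
    by (subst nn_integral_add) (auto simp: nn_integral_suminf nn_integral_cmult)
  also have "\<dots> \<le> (\<Sum>i. ennreal (2 * T powr (- a) * \<alpha> ^ i)) + (\<Sum>j. ennreal (T powr (- a) * 2 powr a * \<beta> ^ j))"
  proof (intro add_mono suminf_le summableI)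
    fix i
    have "ennreal (\<phi> (T * 2 ^ i)) * emeasure M (U i) \<le> ennreal (\<phi> (T * 2 ^ i)) * ennreal (T * 2 ^ Suc i)"
      unfolding U_def using T by (intro mult_left_mono emeasure_tail_le) auto
    also have "\<dots> = ennreal (\<phi> (T * 2 ^ i) * (T * 2 ^ Suc i))" by (rule ennreal_mult'[symmetric, OF \<phi>0])
    also have "\<phi> (T * 2 ^ i) * (T * 2 ^ Suc i) = 2 * T powr (- a) * \<alpha> ^ i"
    proof -
      have "(T * 2 ^ i) powr (- a) = T powr (- a) * \<alpha> ^ i"
        using T by (simp add: powr_mult \<alpha>_def powr_realpow[symmetric] powr_powr mult.commute)
      moreover have "T * 1 \<le> T * 2 ^ i" using T by (intro mult_left_mono) auto
      then have "max (T * 2 ^ i) T = T * 2 ^ i" by (intro max_absorb1) simp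
      ultimately show ?thesis using T by (simp add: \<phi>_def)
    qed
    finally show "ennreal (\<phi> (T * 2 ^ i)) * emeasure M (U i) \<le> ennreal (2 * T powr (- a) * \<alpha> ^ i)" .
  next
    fix j
    have "ennreal (\<phi> (T / 2 ^ Suc j)) * emeasure M (L j) \<le> ennreal (\<phi> (T / 2 ^ Suc j)) * ennreal (T / 2 ^ j)"
      unfolding L_def using T by (intro mult_left_mono emeasure_tail_le) auto
    also have "\<dots> = ennreal (\<phi> (T / 2 ^ Suc j) * (T / 2 ^ j))" by (rule ennreal_mult'[symmetric, OF \<phi>0])
    also have "\<phi> (T / 2 ^ Suc j) * (T / 2 ^ j) = T powr (- a) * 2 powr a * \<beta> ^ j"
    proof -
      have "(T / 2 ^ Suc j) powr (- a) = T powr (- a) * (2 ^ Suc j) powr a"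
        using T by (simp add: powr_divide powr_minus_divide powr_mult divide_simps)
      also have "(2 ^ Suc j) powr a = 2 powr a * (2 ^ j) powr a" by (simp add: powr_mult)
      also have "(2 ^ j) powr a = \<beta> ^ j * 2 ^ j"
        by (simp add: \<beta>_def powr_realpow[symmetric] powr_powr powr_add[symmetric] algebra_simps)
      finally have "(T / 2 ^ Suc j) powr (- a) = T powr (- a) * (2 powr a * (\<beta> ^ j * 2 ^ j))" .
      moreover have "T / 2 ^ Suc j \<le> T / 1"
        using T one_le_power[of "2::real" "Suc j"] by (intro divide_left_mono) auto
      then have "max (T / 2 ^ Suc j) T = T" by (intro max_absorb2) simp
      ultimately show ?thesis using T by (simp add: \<phi>_def)
    qed
    finally show "ennreal (\<phi> (T / 2 ^ Suc j)) * emeasure M (L j) \<le> ennreal (T powr (- a) * 2 powr a * \<beta> ^ j)" .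
  qed
  also have "(\<Sum>i. ennreal (2 * T powr (- a) * \<alpha> ^ i)) = ennreal (2 * T powr (- a) * (1 / (1 - \<alpha>)))"
    using ab by (subst suminf_ennreal2) (auto simp: suminf_mult suminf_geometric)
  also have "(\<Sum>j. ennreal (T powr (- a) * 2 powr a * \<beta> ^ j)) = ennreal (T powr (- a) * 2 powr a * (1 / (1 - \<beta>)))"
    using ab by (subst suminf_ennreal2) (auto simp: suminf_mult suminf_geometric)
  also have "ennreal (2 * T powr (- a) * (1 / (1 - \<alpha>))) + ennreal (T powr (- a) * 2 powr a * (1 / (1 - \<beta>)))
     = ennreal ((2 / (1 - \<alpha>) + 2 powr a / (1 - \<beta>)) * T powr (- a))"
    using ab by (subst ennreal_plus[symmetric]) (auto simp: algebra_simps)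
  finally show "(\<integral>\<^sup>+ z. ennreal (tail (cmod z) powr (- a) / max (tail (cmod z)) T) \<partial>M)
       \<le> ennreal ((2 / (1 - \<alpha>) + 2 powr a / (1 - \<beta>)) * T powr (- a))" by (simp add: \<phi>_def)
qed

end

text \<open>\<open>d\<close> is half the distance to the boundary, so the function F (z + d w) of w
  is holomorphic on the disc of radius 2, and the coefficient formula applies on its unit
  circle.\<close>

lemma higher_deriv_mean_value:
  assumes F: "F holomorphic_on ball 0 1" and z: "cmod z < 1" and d: "d = (1 - cmod z) / 2"
  shows "(deriv ^^ k) F z = fact k / of_real d ^ k * (\<integral> x. F (z + of_real d * dir x) * cnj (dir x) ^ k \<partial>circ)"
proof -
  have d0: "d > 0" using z d by simp
  have sub: "of_real d * w + z \<in> ball 0 1" if "w \<in> ball 0 2" for w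
  proof -
    have "cmod (of_real d * w + z) \<le> d * cmod w + cmod z"
      using d0 norm_triangle_ineq[of "of_real d * w" z] by (simp add: norm_mult)
    also have "\<dots> < d * 2 + cmod z" using that d0 by simp
    also have "\<dots> = 1" using d by simp
    finally show ?thesis by simp
  qed
  have "(\<lambda>w. F (of_real d * w + z)) holomorphic_on ball 0 2"
    using sub by (intro holomorphic_on_compose_gen[OF _ F, unfolded o_def] holomorphic_intros) auto
  from circ_integral_coeff[OF this, of k]
  have "(\<integral> x. F (of_real d * dir x + z) * cnj (dir x) ^ k \<partial>circ) = (deriv ^^ k) (\<lambda>w. F (of_real d * w + z)) 0 / fact k" by simp
  also have "(deriv ^^ k) (\<lambda>w. F (of_real d * w + z)) 0 = of_real d ^ k * (deriv ^^ k) F (of_real d * 0 + z)"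
    by (rule higher_deriv_compose_linear'[OF F, where S="ball 0 2"]) (use sub in auto)
  finally show ?thesis using d0 by (simp add: add.commute)
qed

section \<open>Moments, kernel coefficients and circle averages\<close>

context radial_measure
begin

lemma integrable_power [simp]: "integrable M (\<lambda>z. cmod z ^ n)"
  using AE_disc by (intro integrable_const_bound[where B=1]) (auto simp: power_le_one elim!: eventually_mono)

lemma moment_antimono: "m \<le> n \<Longrightarrow> moment n \<le> moment m"
  unfolding moment_def
proof (intro integral_mono_AE integrable_power)
  assume mn: "m \<le> n"
  show "AE z in M. cmod z ^ (2 * n) \<le> cmod z ^ (2 * m)"
    using AE_disc by eventually_elim (use mn in \<open>auto intro!: power_decreasing\<close>)
qed

text \<open>Only the part of the integral with |z|^2 \<ge> q is kept, where |z|^(2n) \<ge>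
  q^n.\<close>

lemma moment_ge:
  assumes q: "0 \<le> q" "q < 1"
  shows "q ^ n * tail (sqrt q) \<le> moment n"
proof -
  have "q ^ n * tail (sqrt q) = (\<integral> z. q ^ n * indicator {z. sqrt q \<le> cmod z} z \<partial>M)"
    by (simp add: tail_def)
  also have "\<dots> \<le> moment n" unfolding moment_def
  proof (rule integral_mono)
    show "integrable M (\<lambda>z. q ^ n * indicator {z. sqrt q \<le> cmod z} z)"
      by (intro integrable_mult_right) (simp add: emeasure_tail)
    fix z
    have "q ^ n \<le> cmod z ^ (2 * n)" if "sqrt q \<le> cmod z"
    proof -
      have "(sqrt q ^ 2) ^ n \<le> (cmod z ^ 2) ^ n" using that q by (intro power_mono) auto
      then show ?thesis using q by (simp add: power_mult)
    qed
    then show "q ^ n * indicator {z. sqrt q \<le> cmod z} z \<le> cmod z ^ (2 * n)"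
      by (simp add: indicator_def)
  qed simp
  finally show ?thesis .
qed

lemma moment_pos: "0 < moment n"
proof -
  have "0 < (1/4) ^ n * tail (sqrt (1/4))"
    using tail_gt_0[of "sqrt (1/4)"] real_sqrt_lt_1_iff[of "1/4"] by simp
  also have "\<dots> \<le> moment n" by (rule moment_ge) auto
  finally show ?thesis .
qed

text \<open>The Bergman kernel as a function of one variable: B_z(w) is its value at
  \<open>cnj z * w\<close>.\<close>

definition kern :: "complex \<Rightarrow> complex" where
  "kern x = (\<Sum>n. of_real (1 / moment n) * x ^ n)"

lemma coeff_le:
  assumes q: "0 < q" "q < 1" and s: "0 \<le> s"
  shows "s ^ n / moment n \<le> (s / q) ^ n / tail (sqrt q)"
proof -
  have t: "tail (sqrt q) > 0" using q by (intro tail_gt_0) simp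
  have "s ^ n / moment n \<le> s ^ n / (q ^ n * tail (sqrt q))"
    using moment_ge[of q n] q s t moment_pos[of n] by (intro divide_left_mono) auto
  then show ?thesis by (simp add: power_divide)
qed

text \<open>The moments are compared with \<open>q ^ n * tail (sqrt q)\<close> for q halfway between
  s and 1, which leaves a geometric series of ratio s / q. Since 1 - s / q = (1 - s) / (2 q), the
  factor 1 - s is cancelled and 2 q \<le> 2 remains.\<close>

lemma summable_coeff:
  assumes s: "0 \<le> s" "s < 1"
  shows "summable (\<lambda>n. s ^ n / moment n)"
    and "(\<Sum>n. s ^ n / moment n) * (1 - s) \<le> 2 / tail (sqrt ((1 + s) / 2))"
proof -
  define q where "q = (1 + s) / 2"
  have q: "0 < q" "q < 1" "s < q" using s by (auto simp: q_def)
  have t: "tail (sqrt q) > 0" using q by (intro tail_gt_0) simp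
  have g: "(\<lambda>n. (s / q) ^ n / tail (sqrt q)) sums (1 / (1 - s / q) / tail (sqrt q))"
    using q s by (intro sums_divide geometric_sums) (simp add: divide_simps)
  show sm: "summable (\<lambda>n. s ^ n / moment n)"
    by (rule summable_comparison_test'[OF sums_summable[OF g]])
       (use coeff_le[OF q(1,2) s(1)] s moment_pos in \<open>auto simp: less_imp_le abs_of_nonneg\<close>)
  have "(\<Sum>n. s ^ n / moment n) \<le> 1 / (1 - s / q) / tail (sqrt q)"
    using suminf_le[OF coeff_le[OF q(1,2) s(1)] sm sums_summable[OF g]] g by (simp add: sums_iff)
  then have "(\<Sum>n. s ^ n / moment n) * (1 - s) \<le> 1 / (1 - s / q) / tail (sqrt q) * (1 - s)"
    using s by (intro mult_right_mono) auto
  also have "\<dots> = (1 - s) / (1 - s / q) / tail (sqrt q)" by simp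
  also have "\<dots> \<le> 2 / tail (sqrt q)"
  proof (intro divide_right_mono)
    have "1 - s / q = (1 - s) / (2 * q)" using q by (simp add: q_def field_simps)
    then show "(1 - s) / (1 - s / q) \<le> 2" using q s by simp
  qed simp
  finally show "(\<Sum>n. s ^ n / moment n) * (1 - s) \<le> 2 / tail (sqrt ((1 + s) / 2))" by (simp add: q_def)
qed

lemma norm_kern_term: "norm (of_real (1 / moment n) * x ^ n) = cmod x ^ n / moment n"
  for x :: complex
  using moment_pos[of n] by (simp add: norm_mult norm_power norm_divide)

lemma summable_kern: "cmod x < 1 \<Longrightarrow> summable (\<lambda>n. norm (of_real (1 / moment n) * x ^ n))"
  for x :: complex
  unfolding norm_kern_term by (rule summable_coeff(1)) auto

lemma kern_sums: "cmod x < 1 \<Longrightarrow> (\<lambda>n. of_real (1 / moment n) * x ^ n) sums kern x"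
  unfolding kern_def by (rule summable_sums[OF summable_norm_cancel[OF summable_kern]])

lemma norm_kern_le:
  assumes "cmod x \<le> s" "s < 1"
  shows "cmod (kern x) \<le> (\<Sum>n. s ^ n / moment n)"
proof -
  have s: "0 \<le> s" using assms norm_ge_zero[of x] by linarith
  have "cmod (kern x) \<le> (\<Sum>n. norm (of_real (1 / moment n) * x ^ n))"
    unfolding kern_def using assms by (intro summable_norm summable_kern) auto
  also have "\<dots> \<le> (\<Sum>n. s ^ n / moment n)"
    unfolding norm_kern_term using assms s moment_pos
    by (intro suminf_le summable_coeff divide_right_mono power_mono) (auto simp: less_imp_le)
  finally show ?thesis .
qed

lemma measurable_kern [measurable]: "kern \<in> borel_measurable borel"
  unfolding kern_def[abs_def] by measurable

lemma kern_holomorphic: "kern holomorphic_on ball 0 1"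
proof (rule power_series_holomorphic)
  fix x :: complex assume "x \<in> ball 0 1"
  then show "(\<lambda>n. of_real (1 / moment n) * (x - 0) ^ n) sums kern x" using kern_sums[of x] by simp
qed

text \<open>
  The moments decrease, so the negative part of \<open>b (n + 1) - b n\<close> is at most \<open>(1 - s) b n\<close>, while the sum
  of all these increments telescopes.
\<close>

lemma coeff_variation:
  assumes s: "0 \<le> s" "s < 1"
  defines "b \<equiv> \<lambda>n. s ^ n / moment n"
  shows "b \<longlonglongrightarrow> 0" "summable (\<lambda>n. \<bar>b n - b (Suc n)\<bar>)"
    "(\<Sum>n. \<bar>b n - b (Suc n)\<bar>) \<le> 4 / tail (sqrt ((1 + s) / 2))"
proof -
  have sb: "summable b" unfolding b_def by (rule summable_coeff(1)[OF s])
  show b0: "b \<longlonglongrightarrow> 0" by (rule summable_LIMSEQ_zero[OF sb])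
  have le: "\<bar>b n - b (Suc n)\<bar> \<le> (b (Suc n) - b n) + 2 * (b n * (1 - s))" for n
  proof -
    have b: "0 \<le> b n" using s moment_pos[of n] by (simp add: b_def)
    have "s * b n \<le> b (Suc n)"
      using s moment_antimono[of n "Suc n"] moment_pos[of n] moment_pos[of "Suc n"]
      by (auto simp: b_def intro!: divide_left_mono mult_nonneg_nonneg)
    moreover have "0 \<le> b n * (1 - s)" using b s by simp
    ultimately show ?thesis by (simp add: abs_if algebra_simps)
  qed
  have sums: "(\<lambda>n. (b (Suc n) - b n) + 2 * (b n * (1 - s))) sums ((0 - b 0) + 2 * (suminf b * (1 - s)))"
    by (intro sums_add telescope_sums b0 sums_mult sums_mult2 summable_sums sb)
  show sv: "summable (\<lambda>n. \<bar>b n - b (Suc n)\<bar>)"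
    by (rule summable_comparison_test'[OF sums_summable[OF sums]]) (use le in simp)
  have "(\<Sum>n. \<bar>b n - b (Suc n)\<bar>) \<le> (0 - b 0) + 2 * (suminf b * (1 - s))"
    using suminf_le[OF le sv sums_summable[OF sums]] sums by (simp add: sums_iff)
  also have "\<dots> \<le> 2 * (suminf b * (1 - s))" using moment_pos[of 0] by (simp add: b_def)
  also have "\<dots> \<le> 4 / tail (sqrt ((1 + s) / 2))"
    using summable_coeff(2)[OF s] unfolding b_def by simp
  finally show "(\<Sum>n. \<bar>b n - b (Suc n)\<bar>) \<le> 4 / tail (sqrt ((1 + s) / 2))" .
qed

text \<open>By rotation invariance all rotated copies of \<open>g\<close> have the same integral, so
  an average over rotations can be inserted at no cost. This stands in for polar
  coordinates.\<close>

lemma nn_integral_circle_average: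
  assumes [measurable]: "g \<in> borel_measurable borel"
  shows "(\<integral>\<^sup>+ z. (\<integral>\<^sup>+ x. g (dir x * z) \<partial>circ) \<partial>M) = (\<integral>\<^sup>+ z. g z \<partial>M)"
proof -
  interpret PP: pair_sigma_finite circ M ..
  have "(\<integral>\<^sup>+ z. (\<integral>\<^sup>+ x. g (dir x * z) \<partial>circ) \<partial>M) = (\<integral>\<^sup>+ x. (\<integral>\<^sup>+ z. g (dir x * z) \<partial>M) \<partial>circ)"
    by (rule PP.Fubini') measurable
  also have "\<dots> = (\<integral>\<^sup>+ x. (\<integral>\<^sup>+ z. g z \<partial>M) \<partial>circ)"
  proof (rule nn_integral_cong)
    fix x
    have "(\<integral>\<^sup>+ z. g (dir x * z) \<partial>M) = (\<integral>\<^sup>+ z. g z \<partial>distr M borel ((*) (dir x)))"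
      by (subst nn_integral_distr) auto
    then show "(\<integral>\<^sup>+ z. g (dir x * z) \<partial>M) = (\<integral>\<^sup>+ z. g z \<partial>M)" by (simp add: rotation)
  qed
  finally show ?thesis using circ.emeasure_space_1 by simp
qed

lemma integral_circle_average:
  fixes g :: "complex \<Rightarrow> complex"
  assumes int: "integrable M g"
  shows "(\<integral> z. (\<integral> x. g (dir x * z) \<partial>circ) \<partial>M) = (\<integral> z. g z \<partial>M)"
proof -
  interpret PP: pair_sigma_finite circ M ..
  have [measurable]: "g \<in> borel_measurable borel" using int by auto
  have "integrable (circ \<Otimes>\<^sub>M M) (\<lambda>(x, z). g (dir x * z))"
  proof (rule integrableI_bounded)
    have "(\<integral>\<^sup>+ y. ennreal (norm (case y of (x, z) \<Rightarrow> g (dir x * z))) \<partial>(circ \<Otimes>\<^sub>M M))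
      = (\<integral>\<^sup>+ z. (\<integral>\<^sup>+ x. ennreal (norm (g (dir x * z))) \<partial>circ) \<partial>M)"
      by (subst PP.nn_integral_snd[symmetric]) auto
    also have "\<dots> = (\<integral>\<^sup>+ z. ennreal (norm (g z)) \<partial>M)" by (rule nn_integral_circle_average) simp
    also have "\<dots> < \<infinity>" using int by (simp add: integrable_iff_bounded)
    finally show "(\<integral>\<^sup>+ y. ennreal (norm (case y of (x, z) \<Rightarrow> g (dir x * z))) \<partial>(circ \<Otimes>\<^sub>M M)) < \<infinity>" .
  qed measurable
  from PP.Fubini_integral[OF this]
  have "(\<integral> z. (\<integral> x. g (dir x * z) \<partial>circ) \<partial>M) = (\<integral> x. (\<integral> z. g (dir x * z) \<partial>M) \<partial>circ)" .
  also have "\<dots> = (\<integral> x. (\<integral> z. g z \<partial>M) \<partial>circ)"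
  proof (rule Bochner_Integration.integral_cong[OF refl])
    fix x
    have "(\<integral> z. g (dir x * z) \<partial>M) = (\<integral> z. g z \<partial>distr M borel ((*) (dir x)))"
      by (subst integral_distr) auto
    then show "(\<integral> z. g (dir x * z) \<partial>M) = (\<integral> z. g z \<partial>M)" by (simp add: rotation)
  qed
  finally show ?thesis by simp
qed

end

section \<open>Circle multipliers under the doubling condition\<close>

locale doubling_measure = radial_measure +
  fixes D :: real
  assumes D: "1 \<le> D" and doubling: "\<And>r. 0 \<le> r \<Longrightarrow> r < 1 \<Longrightarrow> tail r \<le> D * tail ((1 + r) / 2)"
begin

lemma tail_sqrt_ge:
  assumes "0 \<le> r" "r < 1" shows "tail r \<le> D * tail (sqrt r)"
proof -
  have "sqrt r \<le> (1 + r) / 2" using arith_geo_mean_sqrt[of 1 r] assms by simp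
  then have "tail ((1 + r) / 2) \<le> tail (sqrt r)" by (rule tail_antimono)
  then have "D * tail ((1 + r) / 2) \<le> D * tail (sqrt r)" using D by (intro mult_left_mono) auto
  with doubling[OF assms] show ?thesis by (rule order_trans)
qed

text \<open>Three doublings lead from r to its root s, then to (1 + s) / 2 and to the root of that,
  the radius at which \<open>coeff_variation\<close> evaluates the tail.\<close>

lemma tail_triple:
  assumes r: "0 \<le> r" "r < 1" defines "s \<equiv> sqrt r"
  shows "tail r \<le> D ^ 3 * tail (sqrt ((1 + s) / 2))"
proof -
  have s: "0 \<le> s" "s < 1" using r by (auto simp: s_def)
  have "tail r \<le> D * tail s" using tail_sqrt_ge[OF r] by (simp add: s_def)
  also have "\<dots> \<le> D * (D * tail ((1 + s) / 2))" using D by (intro mult_left_mono doubling s) auto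
  also have "\<dots> \<le> D * (D * (D * tail (sqrt ((1 + s) / 2))))"
    using D s by (intro mult_left_mono tail_sqrt_ge) auto
  finally show ?thesis by (simp add: power3_eq_cube mult_ac)
qed

text \<open>The modulus of \<open>y\<close> is split as s * s. One factor goes into the coefficients
  s^n / m_n, which then have bounded variation and limit 0; the other is the radius r < 1 of the
  multiplier theorem. The argument of \<open>y\<close> only rotates \<open>u\<close>, which leaves
  p-means unchanged.\<close>

lemma kern_circle_multiplier:
  fixes p :: real
  assumes p: "1 < p"
  obtains A where "A > 0"
    "\<And>y f. cmod y < 1 \<Longrightarrow> f \<in> borel_measurable borel \<Longrightarrow>
       pmean p (\<lambda>u. \<integral> x. f (dir x) * kern (y * u * cnj (dir x)) \<partial>circ)
       \<le> ennreal (A / tail (cmod y) powr p) * pmean p f"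
proof -
  obtain A where A: "A > 0" and
    bd: "\<And>r b V f. 0 \<le> r \<Longrightarrow> r < 1 \<Longrightarrow> f \<in> borel_measurable borel \<Longrightarrow>
       b \<longlonglongrightarrow> 0 \<Longrightarrow> summable (\<lambda>n. \<bar>b n - b (Suc n)\<bar>) \<Longrightarrow>
       (\<Sum>n. \<bar>b n - b (Suc n)\<bar>) \<le> V \<Longrightarrow> 0 < V \<Longrightarrow>
       pmean p (\<lambda>u. \<integral> x. f (dir x) * (\<Sum>j. of_real (b j) * (of_real r * u * cnj (dir x)) ^ j) \<partial>circ)
       \<le> ennreal (V powr p * A) * pmean p f"
    by (rule bounded_variation_multiplier[OF p]) (rule that)
  show thesis
  proof (rule that)
    show "(4 * D ^ 3) powr p * A > 0" using A D by simp
    fix y :: complex and f :: "complex \<Rightarrow> complex"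
    assume y: "cmod y < 1" and [measurable]: "f \<in> borel_measurable borel"
    define s where "s = sqrt (cmod y)"
    have s: "0 \<le> s" "s < 1" using y by (auto simp: s_def)
    have ss: "s * s = cmod y" by (simp add: s_def)
    define b where "b n = s ^ n / moment n" for n
    define V where "V = 4 * D ^ 3 / tail (cmod y)"
    have ty: "tail (cmod y) > 0" using y by (rule tail_gt_0)
    have V: "V > 0" using D ty by (simp add: V_def)
    have tq: "tail (sqrt ((1 + s) / 2)) > 0" using s by (intro tail_gt_0) simp
    have "4 / tail (sqrt ((1 + s) / 2)) = (4 * D ^ 3) / (D ^ 3 * tail (sqrt ((1 + s) / 2)))"
      using D by simp
    also have "\<dots> \<le> V"
      unfolding V_def s_def using tail_triple[of "cmod y"] y ty tq[unfolded s_def] D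
      by (intro divide_left_mono mult_pos_pos) auto
    finally have "4 / tail (sqrt ((1 + s) / 2)) \<le> V" .
    then have V2: "(\<Sum>n. \<bar>b n - b (Suc n)\<bar>) \<le> V"
      using coeff_variation(3)[OF s] unfolding b_def by linarith
    define e where "e = (if y = 0 then 1 else sgn y)"
    have e: "cmod e = 1" by (simp add: e_def norm_sgn)
    have ye: "y = of_real (s * s) * e" by (simp add: ss e_def sgn_div_norm scaleR_conv_of_real)
    define T where "T u = (\<integral> x. f (dir x) * (\<Sum>j. of_real (b j) * (of_real s * u * cnj (dir x)) ^ j) \<partial>circ)" for u
    have [measurable]: "T \<in> borel_measurable borel" unfolding T_def[abs_def] by measurable
    have eq: "(\<integral> x. f (dir x) * kern (y * u * cnj (dir x)) \<partial>circ) = T (e * u)" for u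
    proof -
      have "of_real (1 / moment j) * (y * u * cnj (dir x)) ^ j = of_real (b j) * (of_real s * (e * u) * cnj (dir x)) ^ j" for x j
        by (simp add: ye b_def power_mult_distrib)
      then show ?thesis unfolding T_def kern_def by simp
    qed
    have "pmean p (\<lambda>u. T (e * u)) = pmean p T"
      unfolding pmean_def by (rule circ_nn_integral_rotate[OF e, where g="\<lambda>u. ennreal (cmod (T u) powr p)"]) simp
    also have "\<dots> \<le> ennreal (V powr p * A) * pmean p f"
      unfolding T_def using coeff_variation(1,2)[OF s] V V2 by (intro bd s) (auto simp: b_def[abs_def])
    also have "V powr p * A = ((4 * D ^ 3) powr p * A) / tail (cmod y) powr p"
      using D by (simp add: V_def powr_divide)
    finally show "pmean p (\<lambda>u. \<integral> x. f (dir x) * kern (y * u * cnj (dir x)) \<partial>circ)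
       \<le> ennreal (((4 * D ^ 3) powr p * A) / tail (cmod y) powr p) * pmean p f" unfolding eq .
  qed
qed

end

context radial_measure
begin

section \<open>The projection of a radial measure\<close>

definition proj :: "(complex \<Rightarrow> complex) \<Rightarrow> complex \<Rightarrow> complex" where
  "proj f z = (\<integral> \<zeta>. f \<zeta> * kern (z * cnj \<zeta>) \<partial>M)"

text \<open>
  Outside the disc the series \<open>kern\<close> may diverge and has no meaning, so functions are required to vanish there.
\<close>

definition Lp_disc :: "real \<Rightarrow> (complex \<Rightarrow> complex) \<Rightarrow> bool" where
  "Lp_disc p f \<longleftrightarrow> f \<in> borel_measurable borel \<and> (\<forall>z. 1 \<le> cmod z \<longrightarrow> f z = 0) \<and>
     (\<integral>\<^sup>+ z. ennreal (cmod (f z) powr p) \<partial>M) < \<infinity>"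

lemma Lp_discD:
  assumes "Lp_disc p f"
  shows "f \<in> borel_measurable borel" "1 \<le> cmod z \<Longrightarrow> f z = 0"
  using assms by (auto simp: Lp_disc_def)

lemma integrable_Lp_disc:
  assumes f: "Lp_disc p f" and p: "1 \<le> p"
  shows "integrable M f"
proof -
  have [measurable]: "f \<in> borel_measurable borel" using f by (rule Lp_discD)
  have int: "integrable M (\<lambda>x. cmod (f x) powr p)"
    using f by (intro integrableI_bounded) (auto simp: Lp_disc_def)
  show ?thesis
  proof (rule Bochner_Integration.integrable_bound)
    show "integrable M (\<lambda>x. 1 + cmod (f x) powr p)" using int by simp
    show "AE x in M. norm (f x) \<le> norm (1 + cmod (f x) powr p)"
    proof (rule AE_I2)
      fix x
      have "cmod (f x) \<le> 1 + cmod (f x) powr p"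
        using powr_mono[of 1 p "cmod (f x)"] p by (cases "cmod (f x) \<le> 1") (auto simp: add_increasing2)
      then show "norm (f x) \<le> norm (1 + cmod (f x) powr p)" by simp
    qed
  qed simp
qed

lemma measurable_proj [measurable]:
  assumes [measurable]: "f \<in> borel_measurable borel"
  shows "proj f \<in> borel_measurable borel"
  unfolding proj_def[abs_def] by measurable

lemma integrable_proj:
  assumes f: "Lp_disc p f" and p: "1 \<le> p" and z: "cmod z < 1"
  shows "integrable M (\<lambda>\<zeta>. f \<zeta> * kern (z * cnj \<zeta>))"
proof -
  have [measurable]: "f \<in> borel_measurable borel" using f by (rule Lp_discD)
  define K where "K = (\<Sum>n. cmod z ^ n / moment n)"
  have K: "0 \<le> K" unfolding K_def using z moment_pos by (intro suminf_nonneg summable_coeff) (auto simp: less_imp_le)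
  show ?thesis
  proof (rule Bochner_Integration.integrable_bound)
    show "integrable M (\<lambda>\<zeta>. K * cmod (f \<zeta>))" using integrable_Lp_disc[OF f p] by simp
    show "AE \<zeta> in M. norm (f \<zeta> * kern (z * cnj \<zeta>)) \<le> norm (K * cmod (f \<zeta>))"
    proof (rule AE_I2)
      fix \<zeta>
      show "norm (f \<zeta> * kern (z * cnj \<zeta>)) \<le> norm (K * cmod (f \<zeta>))"
      proof (cases "cmod \<zeta> < 1")
        case True
        have "cmod z * cmod \<zeta> \<le> cmod z * 1" using True by (intro mult_left_mono) auto
        then have "cmod (kern (z * cnj \<zeta>)) \<le> K"
          unfolding K_def using z by (intro norm_kern_le) (auto simp: norm_mult)
        from mult_left_mono[OF this, of "cmod (f \<zeta>)"] show ?thesis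
          using K by (simp add: norm_mult abs_mult mult.commute)
      next
        case False
        then show ?thesis using Lp_discD(2)[OF f, of \<zeta>] by simp
      qed
    qed
  qed simp
qed

text \<open>For fixed z the terms are dominated by |z|^n / m_n times |f|, which allows integration
  term by term. The expansion gives holomorphy of the projection and, in
  \<open>proj_reproduces\<close>, the comparison of coefficients.\<close>

lemma proj_sums:
  assumes f: "Lp_disc p f" and p: "1 \<le> p" and z: "cmod z < 1"
  shows "(\<lambda>n. of_real (1 / moment n) * (\<integral> \<zeta>. f \<zeta> * cnj \<zeta> ^ n \<partial>M) * z ^ n) sums proj f z"
proof -
  have [measurable]: "f \<in> borel_measurable borel" using f by (rule Lp_discD)
  have fi: "integrable M f" by (rule integrable_Lp_disc[OF f p])
  let ?t = "\<lambda>n \<zeta>. f \<zeta> * (of_real (1 / moment n) * (z * cnj \<zeta>) ^ n)"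
  have le: "norm (?t n \<zeta>) \<le> cmod z ^ n / moment n * cmod (f \<zeta>)" for \<zeta> n
  proof (cases "cmod \<zeta> < 1")
    case True
    have "cmod (z * cnj \<zeta>) ^ n \<le> cmod z ^ n"
      using True by (intro power_mono) (auto simp: norm_mult mult_left_le)
    then have "cmod (f \<zeta>) * (cmod (z * cnj \<zeta>) ^ n / moment n) \<le> cmod (f \<zeta>) * (cmod z ^ n / moment n)"
      using moment_pos[of n] by (intro mult_left_mono divide_right_mono) auto
    then show ?thesis unfolding norm_mult[of "f \<zeta>"] norm_kern_term by (simp add: mult.commute)
  next
    case False
    then show ?thesis using Lp_discD(2)[OF f, of \<zeta>] by simp
  qed
  have int: "integrable M (\<lambda>\<zeta>. ?t n \<zeta>)" for n
  proof (rule Bochner_Integration.integrable_bound)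
    show "integrable M (\<lambda>\<zeta>. cmod z ^ n / moment n * cmod (f \<zeta>))" using fi by simp
    show "AE \<zeta> in M. norm (?t n \<zeta>) \<le> norm (cmod z ^ n / moment n * cmod (f \<zeta>))"
      by (intro AE_I2 order_trans[OF le]) (simp only: real_norm_def abs_ge_self)
  qed simp
  have sm: "summable (\<lambda>n. cmod z ^ n / moment n)" using z by (intro summable_coeff) auto
  have "(\<lambda>n. \<integral> \<zeta>. ?t n \<zeta> \<partial>M) sums
      (\<integral> \<zeta>. (\<Sum>n. ?t n \<zeta>) \<partial>M)"
  proof (rule sums_integral[OF int])
    show "AE \<zeta> in M. summable (\<lambda>n. norm (?t n \<zeta>))"
      by (intro AE_I2 summable_comparison_test'[OF summable_mult2[OF sm]]) (use le in simp)
    show "summable (\<lambda>n. \<integral> \<zeta>. norm (?t n \<zeta>) \<partial>M)"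
    proof (rule summable_comparison_test'[OF summable_mult2[OF sm]])
      fix n
      have "(\<integral> \<zeta>. norm (?t n \<zeta>) \<partial>M) \<le> (\<integral> \<zeta>. cmod z ^ n / moment n * cmod (f \<zeta>) \<partial>M)"
        by (intro integral_mono integrable_norm int le integrable_mult_right fi)
      also have "\<dots> = cmod z ^ n / moment n * (\<integral> \<zeta>. cmod (f \<zeta>) \<partial>M)" by (rule integral_mult_right_zero)
      finally show "norm (\<integral> \<zeta>. norm (?t n \<zeta>) \<partial>M)
         \<le> cmod z ^ n / moment n * (\<integral> \<zeta>. cmod (f \<zeta>) \<partial>M)"
        by (subst real_norm_def, subst abs_of_nonneg) auto
    qed
  qed
  also have "(\<integral> \<zeta>. (\<Sum>n. ?t n \<zeta>) \<partial>M) = proj f z"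
    unfolding proj_def
  proof (rule Bochner_Integration.integral_cong[OF refl])
    fix \<zeta>
    show "(\<Sum>n. ?t n \<zeta>) = f \<zeta> * kern (z * cnj \<zeta>)"
    proof (cases "cmod \<zeta> < 1")
      case True
      have "cmod z * cmod \<zeta> \<le> cmod z * 1" using True by (intro mult_left_mono) auto
      then have "cmod (z * cnj \<zeta>) < 1" using z by (simp add: norm_mult)
      from sums_mult[OF kern_sums[OF this], of "f \<zeta>"] show ?thesis by (simp add: sums_iff)
    next
      case False
      then show ?thesis using Lp_discD(2)[OF f, of \<zeta>] by simp
    qed
  qed
  also have "(\<lambda>n. \<integral> \<zeta>. ?t n \<zeta> \<partial>M)
      = (\<lambda>n. of_real (1 / moment n) * (\<integral> \<zeta>. f \<zeta> * cnj \<zeta> ^ n \<partial>M) * z ^ n)"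
  proof
    fix n
    have "(\<lambda>\<zeta>. ?t n \<zeta>) = (\<lambda>\<zeta>. of_real (1 / moment n) * z ^ n * (f \<zeta> * cnj \<zeta> ^ n))"
      by (auto simp: power_mult_distrib mult_ac)
    then have "(\<integral> \<zeta>. ?t n \<zeta> \<partial>M)
       = of_real (1 / moment n) * z ^ n * (\<integral> \<zeta>. f \<zeta> * cnj \<zeta> ^ n \<partial>M)"
      by (simp only: integral_mult_right_zero)
    then show "(\<integral> \<zeta>. ?t n \<zeta> \<partial>M)
        = of_real (1 / moment n) * (\<integral> \<zeta>. f \<zeta> * cnj \<zeta> ^ n \<partial>M) * z ^ n"
      by (simp add: mult_ac)
  qed
  finally show ?thesis .
qed

lemma proj_holomorphic:
  assumes f: "Lp_disc p f" and p: "1 \<le> p"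
  shows "proj f holomorphic_on ball 0 1"
proof (rule power_series_holomorphic)
  fix z :: complex assume "z \<in> ball 0 1"
  then show "(\<lambda>n. (of_real (1 / moment n) * (\<integral> \<zeta>. f \<zeta> * cnj \<zeta> ^ n \<partial>M)) * (z - 0) ^ n) sums proj f z"
    using proj_sums[OF f p, of z] by simp
qed

text \<open>With T the tail at |z| this controls the p-mean of the projection over the circle
  through z: it is what Hoelder's inequality leaves of the kernel 1 / max when Schur's test is used
  with exponent 1/p. The test with exponent 1 - 1/p then integrates it over z.\<close>

definition majorant :: "real \<Rightarrow> (complex \<Rightarrow> complex) \<Rightarrow> real \<Rightarrow> ennreal" where
  "majorant p f T = ennreal (T powr (- (1 - 1 / p))) *
     (\<integral>\<^sup>+ \<zeta>. ennreal (tail (cmod \<zeta>) powr (1 - 1 / p) / max (tail (cmod \<zeta>)) T * cmod (f \<zeta>) powr p) \<partial>M)"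

text \<open>At radius 0 \<open>T\<close> is the total mass and dominates all tails, so the whole
  weight in front of |f|^p is at most a constant. This case serves the derivatives at 0.\<close>

lemma majorant_tail_0:
  assumes p: "1 < p" and [measurable]: "f \<in> borel_measurable borel"
  shows "majorant p f (tail 0) \<le> ennreal (1 / tail 0) * (\<integral>\<^sup>+ z. ennreal (cmod (f z) powr p) \<partial>M)"
proof -
  define g where "g = 1 - 1 / p"
  have g: "0 < g" using p by (simp add: g_def)
  have t0: "0 < tail 0" by (rule tail_gt_0) simp
  have "majorant p f (tail 0) = (\<integral>\<^sup>+ \<zeta>. ennreal (tail 0 powr (- g)) * ennreal (tail (cmod \<zeta>) powr g / max (tail (cmod \<zeta>)) (tail 0) * cmod (f \<zeta>) powr p) \<partial>M)"
    unfolding majorant_def g_def[symmetric] by (rule nn_integral_cmult[symmetric]) measurable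
  also have "\<dots> \<le> (\<integral>\<^sup>+ \<zeta>. ennreal (1 / tail 0) * ennreal (cmod (f \<zeta>) powr p) \<partial>M)"
  proof (rule nn_integral_mono)
    fix \<zeta>
    have le: "tail (cmod \<zeta>) \<le> tail 0" by (intro tail_antimono) simp
    have "tail 0 powr (- g) * (tail (cmod \<zeta>) powr g / max (tail (cmod \<zeta>)) (tail 0) * cmod (f \<zeta>) powr p)
        \<le> tail 0 powr (- g) * (tail 0 powr g / tail 0 * cmod (f \<zeta>) powr p)"
      using le g t0 by (intro mult_left_mono mult_right_mono frac_le powr_mono2) (auto simp: max_def)
    also have "\<dots> = 1 / tail 0 * cmod (f \<zeta>) powr p" using t0 by (simp add: powr_minus)
    finally show "ennreal (tail 0 powr (- g)) * ennreal (tail (cmod \<zeta>) powr g / max (tail (cmod \<zeta>)) (tail 0) * cmod (f \<zeta>) powr p)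
       \<le> ennreal (1 / tail 0) * ennreal (cmod (f \<zeta>) powr p)"
      by (subst (1 2) ennreal_mult'[symmetric]) (auto intro!: ennreal_leI)
  qed
  also have "\<dots> = ennreal (1 / tail 0) * (\<integral>\<^sup>+ z. ennreal (cmod (f z) powr p) \<partial>M)"
    by (rule nn_integral_cmult) measurable
  finally show ?thesis .
qed

text \<open>The outer power of \<open>T\<close> and the kernel 1 / max each change by at most a
  factor \<open>E\<close>. It is applied to tails at nearby radii, with \<open>E\<close> the
  doubling constant.\<close>

lemma majorant_le:
  assumes p: "1 < p" and [measurable]: "f \<in> borel_measurable borel"
    and T: "0 < T" "0 < T'" "T \<le> E * T'" and E: "1 \<le> E"
  shows "majorant p f T' \<le> ennreal (E * E) * majorant p f T"
proof -
  define g where "g = 1 - 1 / p"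
  have g: "0 < g" "g < 1" using p by (auto simp: g_def)
  have "T' powr (- g) \<le> (T / E) powr (- g)" using T E g by (intro powr_mono2') (auto simp: field_simps)
  also have "\<dots> = E powr g * T powr (- g)" using T E by (simp add: powr_divide powr_minus field_simps)
  also have "\<dots> \<le> E powr 1 * T powr (- g)" using E g by (intro mult_right_mono powr_mono) auto
  finally have 1: "T' powr (- g) \<le> E * T powr (- g)" using E by simp
  have 2: "x powr g / max x T' * y \<le> E * (x powr g / max x T * y)" if "0 \<le> y" "0 \<le> x" for x y
  proof -
    have "1 * max x T' \<le> E * max x T'" "E * T' \<le> E * max x T'"
      using that T E by (intro mult_right_mono mult_left_mono; simp)+
    then have "max x T \<le> E * max x T'" using T by (intro max.boundedI) auto
    then have "max x T / E \<le> max x T'" using E by (simp add: field_simps)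
    then have "x powr g / max x T' \<le> x powr g / (max x T / E)"
      using T E by (intro divide_left_mono) auto
    then have "x powr g / max x T' * y \<le> x powr g / (max x T / E) * y" using that by (intro mult_right_mono) auto
    then show ?thesis by (simp add: mult_ac)
  qed
  have "majorant p f T' \<le> ennreal (E * T powr (- g)) *
     (\<integral>\<^sup>+ \<zeta>. ennreal E * ennreal (tail (cmod \<zeta>) powr g / max (tail (cmod \<zeta>)) T * cmod (f \<zeta>) powr p) \<partial>M)"
    unfolding majorant_def g_def[symmetric] using 1 2 E
    by (intro mult_mono nn_integral_mono ennreal_leI) (auto simp: ennreal_mult'[symmetric] intro!: ennreal_leI)
  also have "\<dots> = ennreal E * ennreal (T powr (- g)) * (ennreal E *
     (\<integral>\<^sup>+ \<zeta>. ennreal (tail (cmod \<zeta>) powr g / max (tail (cmod \<zeta>)) T * cmod (f \<zeta>) powr p) \<partial>M))"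
    using E by (subst nn_integral_cmult) (auto simp: ennreal_mult')
  also have "\<dots> = ennreal (E * E) * majorant p f T"
    using E by (simp add: majorant_def g_def ennreal_mult' mult_ac)
  finally show ?thesis .
qed

text \<open>After Fubini the integral in z is that of Schur's test with exponent g = 1 - 1/p, where
  T is the tail at |\<zeta>|; its bound C T^(-g) cancels the factor T^g inside the majorant.\<close>

lemma nn_integral_majorant_le:
  assumes p: "1 < p"
  obtains C where "C > 0"
    "\<And>f. Lp_disc p f \<Longrightarrow> (\<integral>\<^sup>+ z. majorant p f (tail (cmod z)) \<partial>M) \<le> ennreal C * (\<integral>\<^sup>+ z. ennreal (cmod (f z) powr p) \<partial>M)"
proof -
  define g where "g = 1 - 1 / p"
  have g: "0 < g" "g < 1" using p by (auto simp: g_def)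
  obtain C where C: "C > 0" and schur: "\<And>T. T > 0 \<Longrightarrow>
     (\<integral>\<^sup>+ z. ennreal (tail (cmod z) powr (- g) / max (tail (cmod z)) T) \<partial>M) \<le> ennreal (C * T powr (- g))"
    by (rule schur_test[OF g]) (rule that)
  interpret PP: pair_sigma_finite M M ..
  show thesis
  proof (rule that[OF C])
    fix f assume f: "Lp_disc p f"
    have [measurable]: "f \<in> borel_measurable borel" using f by (rule Lp_discD)
    have "(\<integral>\<^sup>+ z. majorant p f (tail (cmod z)) \<partial>M) =
       (\<integral>\<^sup>+ z. \<integral>\<^sup>+ \<zeta>. ennreal (tail (cmod z) powr (- g)) * ennreal (tail (cmod \<zeta>) powr g / max (tail (cmod \<zeta>)) (tail (cmod z)) * cmod (f \<zeta>) powr p) \<partial>M \<partial>M)"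
      unfolding majorant_def g_def[symmetric] by (intro nn_integral_cong nn_integral_cmult[symmetric]) measurable
    also have "\<dots> = (\<integral>\<^sup>+ \<zeta>. \<integral>\<^sup>+ z. ennreal (tail (cmod z) powr (- g)) * ennreal (tail (cmod \<zeta>) powr g / max (tail (cmod \<zeta>)) (tail (cmod z)) * cmod (f \<zeta>) powr p) \<partial>M \<partial>M)"
      by (rule PP.Fubini'[symmetric]) measurable
    also have "\<dots> \<le> (\<integral>\<^sup>+ \<zeta>. ennreal C * ennreal (cmod (f \<zeta>) powr p) \<partial>M)"
    proof (rule nn_integral_mono)
      fix \<zeta>
      show "(\<integral>\<^sup>+ z. ennreal (tail (cmod z) powr (- g)) * ennreal (tail (cmod \<zeta>) powr g / max (tail (cmod \<zeta>)) (tail (cmod z)) * cmod (f \<zeta>) powr p) \<partial>M)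
         \<le> ennreal C * ennreal (cmod (f \<zeta>) powr p)"
      proof (cases "cmod \<zeta> < 1")
        case False
        then show ?thesis using Lp_discD(2)[OF f, of \<zeta>] by simp
      next
        case True
        define T where "T = tail (cmod \<zeta>)"
        have T: "T > 0" unfolding T_def using True by (rule tail_gt_0)
        have "ennreal (tail (cmod z) powr (- g)) * ennreal (T powr g / max T (tail (cmod z)) * cmod (f \<zeta>) powr p)
          = ennreal (T powr g * cmod (f \<zeta>) powr p) * ennreal (tail (cmod z) powr (- g) / max (tail (cmod z)) T)" for z
          by (subst (1 2) ennreal_mult'[symmetric]) (auto simp: max.commute mult_ac)
        then have "(\<integral>\<^sup>+ z. ennreal (tail (cmod z) powr (- g)) * ennreal (T powr g / max T (tail (cmod z)) * cmod (f \<zeta>) powr p) \<partial>M)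
          = ennreal (T powr g * cmod (f \<zeta>) powr p) * (\<integral>\<^sup>+ z. ennreal (tail (cmod z) powr (- g) / max (tail (cmod z)) T) \<partial>M)"
          by (simp add: nn_integral_cmult)
        also have "\<dots> \<le> ennreal (T powr g * cmod (f \<zeta>) powr p) * ennreal (C * T powr (- g))"
          by (intro mult_left_mono schur T) simp
        also have "\<dots> = ennreal C * ennreal (cmod (f \<zeta>) powr p)"
          using C T by (subst (1 2) ennreal_mult'[symmetric]) (auto simp: powr_minus)
        finally show ?thesis unfolding T_def .
      qed
    qed
    also have "\<dots> = ennreal C * (\<integral>\<^sup>+ z. ennreal (cmod (f z) powr p) \<partial>M)"
      by (rule nn_integral_cmult) measurable
    finally show "(\<integral>\<^sup>+ z. majorant p f (tail (cmod z)) \<partial>M) \<le> ennreal C * (\<integral>\<^sup>+ z. ennreal (cmod (f z) powr p) \<partial>M)" .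
  qed
qed

end

lemma measurable_extend_by_zero:
  assumes "G holomorphic_on ball 0 1"
  shows "(\<lambda>z. if cmod z < 1 then G z else 0) \<in> borel_measurable borel"
proof -
  have "(\<lambda>z. if z \<in> ball 0 1 then G z else 0) \<in> borel_measurable borel"
    by (intro borel_measurable_continuous_on_if holomorphic_on_imp_continuous_on[OF assms]) auto
  then show ?thesis by simp
qed

section \<open>The projection on L^p and on the Dirichlet space\<close>

context doubling_measure
begin

text \<open>
  Hoelder's inequality with the weight \<open>tail^(-1/p) / max (tail, T)\<close>, whose integral is controlled by Schur's
  test, applied to the decomposition of \<open>proj f\<close> into circle multipliers.
\<close>

lemma proj_circle_le:
  fixes p :: real
  assumes p: "1 < p"
  obtains K where "K > 0"
    "\<And>z f. cmod z < 1 \<Longrightarrow> Lp_disc p f \<Longrightarrow>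
       pmean p (\<lambda>u. proj f (u * z)) \<le> ennreal K * majorant p f (tail (cmod z))"
proof -
  define g where "g = 1 - 1 / p"
  have g: "0 < g" "g < 1" using p by (auto simp: g_def)
  obtain A where A: "A > 0" and mult: "\<And>y f. cmod y < 1 \<Longrightarrow> f \<in> borel_measurable borel \<Longrightarrow>
       pmean p (\<lambda>u. \<integral> x. f (dir x) * kern (y * u * cnj (dir x)) \<partial>circ)
       \<le> ennreal (A / tail (cmod y) powr p) * pmean p f"
    by (rule kern_circle_multiplier[OF p]) (rule that)
  have p1: "0 < 1 / p" "1 / p < 1" using p by auto
  obtain C where C: "C > 0" and schur: "\<And>T. T > 0 \<Longrightarrow>
     (\<integral>\<^sup>+ z. ennreal (tail (cmod z) powr (- (1 / p)) / max (tail (cmod z)) T) \<partial>M) \<le> ennreal (C * T powr (- (1 / p)))"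
    by (rule schur_test[OF p1]) (rule that)
  interpret PP: pair_sigma_finite circ M ..
  show thesis
  proof (rule that)
    show "C powr (p - 1) * A > 0" using C A by simp
    fix z :: complex and f assume z: "cmod z < 1" and f: "Lp_disc p f"
    have [measurable]: "f \<in> borel_measurable borel" using f by (rule Lp_discD)
    define T where "T = tail (cmod z)"
    let ?w = "\<lambda>\<zeta>. ennreal (tail (cmod \<zeta>) powr g / max (tail (cmod \<zeta>)) T * cmod (f \<zeta>) powr p)"
    have T: "T > 0" unfolding T_def using z by (rule tail_gt_0)
    define t where "t \<zeta> = tail (cmod \<zeta>)" for \<zeta> :: complex
    have [measurable]: "t \<in> borel_measurable borel" unfolding t_def[abs_def] by measurable
    have t0: "0 \<le> t \<zeta>" for \<zeta> by (simp add: t_def)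
    \<comment> \<open>The contribution to \<open>proj f (u * z)\<close> of the circle through
      \<zeta>, averaged over rotations. As a function of \<open>u\<close> it is a circle multiplier
      applied to the restriction of \<open>f\<close> to that circle.\<close>
    define \<Phi> where "\<Phi> u \<zeta> = (\<integral> x. f (dir x * \<zeta>) * kern (u * z * cnj (dir x * \<zeta>)) \<partial>circ)" for u \<zeta>
    have \<Phi>m: "(\<lambda>x. \<Phi> (fst x) (snd x)) \<in> borel_measurable (borel \<Otimes>\<^sub>M borel)"
      unfolding \<Phi>_def by measurable
    have [measurable]: "(\<lambda>x. \<Phi> (a x) (b x)) \<in> borel_measurable N"
      if [measurable]: "a \<in> borel_measurable N" "b \<in> borel_measurable N" for a b and N :: "'c measure"
      using measurable_compose[OF _ \<Phi>m, of "\<lambda>x. (a x, b x)" N] by simp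
    \<comment> \<open>Where the tail is 0 the Hoelder weight is 0 by the convention on
      \<open>powr\<close>, so \<Phi> has to vanish as well; such points lie outside the open
      disc.\<close>
    have \<Phi>0: "\<Phi> u \<zeta> = 0" if "t \<zeta> = 0" for u \<zeta>
    proof -
      have "1 \<le> cmod \<zeta>" using that tail_gt_0[of "cmod \<zeta>"] by (force simp: t_def)
      then have "f (dir x * \<zeta>) = 0" for x by (intro Lp_discD(2)[OF f]) (simp add: norm_mult)
      then show ?thesis by (simp add: \<Phi>_def)
    qed
    have ptw: "ennreal (cmod (proj f (dir x * z)) powr p)
       \<le> ennreal ((C * T powr (- (1 / p))) powr (p - 1)) * (\<integral>\<^sup>+ \<zeta>. ennreal (t \<zeta> powr g * max (t \<zeta>) T powr (p - 1)) * ennreal (cmod (\<Phi> (dir x) \<zeta>) powr p) \<partial>M)" for x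
    proof -
      have "cmod (dir x * z) < 1" using z by (simp add: norm_mult)
      from integral_circle_average[OF integrable_proj[OF f less_imp_le[OF p] this]]
      have eq: "proj f (dir x * z) = (\<integral> \<zeta>. \<Phi> (dir x) \<zeta> \<partial>M)" by (simp add: proj_def \<Phi>_def)
      define w where "w \<zeta> = t \<zeta> powr (- (1 / p)) / max (t \<zeta>) T" for \<zeta>
      define h where "h \<zeta> = cmod (\<Phi> (dir x) \<zeta>) * (t \<zeta> powr (1 / p) * max (t \<zeta>) T)" for \<zeta>
      have "ennreal (cmod (\<integral> \<zeta>. \<Phi> (dir x) \<zeta> \<partial>M) powr p)
         \<le> ennreal ((C * T powr (- (1 / p))) powr (p - 1)) * (\<integral>\<^sup>+ \<zeta>. ennreal (w \<zeta> * h \<zeta> powr p) \<partial>M)"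
      proof (rule Jensen_integral[OF p])
        show "(\<integral>\<^sup>+ \<zeta>. ennreal (w \<zeta>) \<partial>M) \<le> ennreal (C * T powr (- (1 / p)))"
          unfolding w_def t_def by (rule schur[OF T])
        show "w \<in> borel_measurable M" "h \<in> borel_measurable M" unfolding w_def[abs_def] h_def[abs_def] by measurable
        show "0 < C * T powr (- (1 / p))" using C T by simp
        fix \<zeta>
        show "0 \<le> w \<zeta>" "0 \<le> h \<zeta>" using T by (auto simp: w_def h_def)
        show "cmod (\<Phi> (dir x) \<zeta>) \<le> w \<zeta> * h \<zeta>"
        proof (cases "t \<zeta> = 0")
          case False
          then have "t \<zeta> > 0" using t0[of \<zeta>] by simp
          moreover have "max (t \<zeta>) T > 0" using T by simp
          ultimately have "w \<zeta> * h \<zeta> = cmod (\<Phi> (dir x) \<zeta>)" by (simp add: w_def h_def powr_minus)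
          then show ?thesis by simp
        qed (simp add: \<Phi>0 w_def)
      qed
      also have "(\<lambda>\<zeta>. w \<zeta> * h \<zeta> powr p) = (\<lambda>\<zeta>. t \<zeta> powr g * max (t \<zeta>) T powr (p - 1) * cmod (\<Phi> (dir x) \<zeta>) powr p)"
      proof (rule ext, goal_cases)
       case (1 \<zeta>)
       show ?case
       proof (cases "t \<zeta> = 0")
        case False
        then have tp: "t \<zeta> > 0" using t0[of \<zeta>] by simp
        have mx: "max (t \<zeta>) T > 0" using T by simp
        have "h \<zeta> powr p = cmod (\<Phi> (dir x) \<zeta>) powr p * (t \<zeta> * max (t \<zeta>) T powr p)"
          using tp mx p by (simp add: h_def powr_mult powr_powr)
        moreover have "max (t \<zeta>) T powr p = max (t \<zeta>) T powr (p - 1) * max (t \<zeta>) T"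
          using mx by (simp add: powr_diff)
        moreover have "t \<zeta> powr (- (1 / p)) * t \<zeta> = t \<zeta> powr g"
          using tp by (simp add: g_def powr_diff powr_minus field_simps)
        ultimately show ?thesis using mx by (simp add: w_def mult_ac)
       qed (simp add: w_def)
      qed
      finally show ?thesis unfolding eq by (simp add: ennreal_mult')
    qed
    have \<Phi>p: "ennreal (t \<zeta> powr g * max (t \<zeta>) T powr (p - 1)) * pmean p (\<lambda>u. \<Phi> u \<zeta>)
        \<le> ennreal A * (\<integral>\<^sup>+ x. ?w (dir x * \<zeta>) \<partial>circ)" for \<zeta>
    proof (cases "cmod \<zeta> < 1")
      case False
      then have "t \<zeta> = 0" by (simp add: t_def)
      then show ?thesis by simp
    next
      case True
      define y where "y = z * cnj \<zeta>"
      have "cmod z * cmod \<zeta> \<le> cmod z * 1" "cmod z * cmod \<zeta> \<le> 1 * cmod \<zeta>"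
        using z True by (intro mult_left_mono mult_right_mono; simp)+
      then have y: "cmod y \<le> cmod z" "cmod y \<le> cmod \<zeta>" by (simp_all add: y_def norm_mult)
      \<comment> \<open>The origin of 1 / max: the modulus of z \<zeta> is at most |z| and at most
        |\<zeta>|, and the tail is decreasing.\<close>
      then have mx: "max (t \<zeta>) T \<le> tail (cmod y)"
        unfolding t_def T_def by (intro max.boundedI tail_antimono)
      have mx0: "max (t \<zeta>) T > 0" using T by simp
      have "pmean p (\<lambda>u. \<Phi> u \<zeta>) = pmean p (\<lambda>u. \<integral> x. f (dir x * \<zeta>) * kern (y * u * cnj (dir x)) \<partial>circ)"
        by (simp add: \<Phi>_def y_def mult_ac)
      also have "\<dots> \<le> ennreal (A / tail (cmod y) powr p) * pmean p (\<lambda>v. f (v * \<zeta>))"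
        using y z by (intro mult) auto
      finally have "ennreal (t \<zeta> powr g * max (t \<zeta>) T powr (p - 1)) * pmean p (\<lambda>u. \<Phi> u \<zeta>)
        \<le> ennreal (t \<zeta> powr g * max (t \<zeta>) T powr (p - 1)) * (ennreal (A / tail (cmod y) powr p) * pmean p (\<lambda>v. f (v * \<zeta>)))"
        by (intro mult_left_mono) auto
      also have "\<dots> = ennreal (t \<zeta> powr g * max (t \<zeta>) T powr (p - 1) * (A / tail (cmod y) powr p)) * pmean p (\<lambda>v. f (v * \<zeta>))"
        using A by (subst ennreal_mult'') (auto simp: mult.assoc)
      also have "\<dots> \<le> ennreal (A * (t \<zeta> powr g / max (t \<zeta>) T)) * pmean p (\<lambda>v. f (v * \<zeta>))"
      proof (intro mult_right_mono ennreal_leI)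
        have "A / tail (cmod y) powr p \<le> A / max (t \<zeta>) T powr p"
          using A mx mx0 p by (intro divide_left_mono powr_mono2 mult_pos_pos) auto
        then have "t \<zeta> powr g * max (t \<zeta>) T powr (p - 1) * (A / tail (cmod y) powr p)
          \<le> t \<zeta> powr g * max (t \<zeta>) T powr (p - 1) * (A / max (t \<zeta>) T powr p)"
          by (intro mult_left_mono) auto
        also have "\<dots> = A * (t \<zeta> powr g / max (t \<zeta>) T)" using mx0 by (simp add: powr_diff)
        finally show "t \<zeta> powr g * max (t \<zeta>) T powr (p - 1) * (A / tail (cmod y) powr p) \<le> A * (t \<zeta> powr g / max (t \<zeta>) T)" .
      qed auto
      also have "\<dots> = ennreal A * (ennreal (t \<zeta> powr g / max (t \<zeta>) T) * pmean p (\<lambda>v. f (v * \<zeta>)))"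
        using A by (subst ennreal_mult') (auto simp: mult.assoc)
      also have "ennreal (t \<zeta> powr g / max (t \<zeta>) T) * pmean p (\<lambda>v. f (v * \<zeta>)) =
        (\<integral>\<^sup>+ x. ennreal (t \<zeta> powr g / max (t \<zeta>) T) * ennreal (cmod (f (dir x * \<zeta>)) powr p) \<partial>circ)"
        unfolding pmean_def by (rule nn_integral_cmult[symmetric]) measurable
      also have "\<dots> = (\<integral>\<^sup>+ x. ?w (dir x * \<zeta>) \<partial>circ)"
      proof (rule nn_integral_cong)
        fix x
        have "0 \<le> t \<zeta> powr g / max (t \<zeta>) T" using T by simp
        then show "ennreal (t \<zeta> powr g / max (t \<zeta>) T) * ennreal (cmod (f (dir x * \<zeta>)) powr p)
          = ?w (dir x * \<zeta>)"
          by (subst ennreal_mult'[symmetric]) (simp_all add: norm_mult t_def)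
      qed
      finally show ?thesis .
    qed
    have "pmean p (\<lambda>u. proj f (u * z)) \<le> (\<integral>\<^sup>+ x. ennreal ((C * T powr (- (1 / p))) powr (p - 1)) *
        (\<integral>\<^sup>+ \<zeta>. ennreal (t \<zeta> powr g * max (t \<zeta>) T powr (p - 1)) * ennreal (cmod (\<Phi> (dir x) \<zeta>) powr p) \<partial>M) \<partial>circ)"
      unfolding pmean_def by (intro nn_integral_mono ptw)
    also have "\<dots> = ennreal ((C * T powr (- (1 / p))) powr (p - 1)) *
        (\<integral>\<^sup>+ x. \<integral>\<^sup>+ \<zeta>. ennreal (t \<zeta> powr g * max (t \<zeta>) T powr (p - 1)) * ennreal (cmod (\<Phi> (dir x) \<zeta>) powr p) \<partial>M \<partial>circ)"
      by (rule nn_integral_cmult) measurable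
    also have "(\<integral>\<^sup>+ x. \<integral>\<^sup>+ \<zeta>. ennreal (t \<zeta> powr g * max (t \<zeta>) T powr (p - 1)) * ennreal (cmod (\<Phi> (dir x) \<zeta>) powr p) \<partial>M \<partial>circ)
       = (\<integral>\<^sup>+ \<zeta>. \<integral>\<^sup>+ x. ennreal (t \<zeta> powr g * max (t \<zeta>) T powr (p - 1)) * ennreal (cmod (\<Phi> (dir x) \<zeta>) powr p) \<partial>circ \<partial>M)"
      by (rule PP.Fubini'[symmetric]) measurable
    also have "\<dots> = (\<integral>\<^sup>+ \<zeta>. ennreal (t \<zeta> powr g * max (t \<zeta>) T powr (p - 1)) * pmean p (\<lambda>u. \<Phi> u \<zeta>) \<partial>M)"
      unfolding pmean_def by (intro nn_integral_cong nn_integral_cmult) measurable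
    also have "\<dots> \<le> (\<integral>\<^sup>+ \<zeta>. ennreal A * (\<integral>\<^sup>+ x. ?w (dir x * \<zeta>) \<partial>circ) \<partial>M)"
      by (intro nn_integral_mono \<Phi>p)
    also have "\<dots> = ennreal A * (\<integral>\<^sup>+ \<zeta>. (\<integral>\<^sup>+ x. ?w (dir x * \<zeta>) \<partial>circ) \<partial>M)"
      by (rule nn_integral_cmult) measurable
    also have "(\<integral>\<^sup>+ \<zeta>. (\<integral>\<^sup>+ x. ?w (dir x * \<zeta>) \<partial>circ) \<partial>M)
      = (\<integral>\<^sup>+ \<zeta>. ?w \<zeta> \<partial>M)"
      by (rule nn_integral_circle_average[where g="?w"]) measurable
    also have "(C * T powr (- (1 / p))) powr (p - 1) = C powr (p - 1) * T powr (- g)"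
    proof -
      have "- (1 / p) * (p - 1) = - g" using p by (simp add: g_def field_simps)
      then show ?thesis using C T by (simp add: powr_mult powr_powr)
    qed
    finally have "pmean p (\<lambda>u. proj f (u * z)) \<le> ennreal (C powr (p - 1) * T powr (- g)) * (ennreal A *
       (\<integral>\<^sup>+ \<zeta>. ?w \<zeta> \<partial>M))"
      by (simp add: mult_left_mono)
    also have "\<dots> = ennreal (C powr (p - 1) * A) * majorant p f T"
      using A by (simp add: majorant_def g_def ennreal_mult' mult_ac)
    finally show "pmean p (\<lambda>u. proj f (u * z)) \<le> ennreal (C powr (p - 1) * A) * majorant p f (tail (cmod z))"
      by (simp add: T_def)
  qed
qed

lemma nn_integral_AE_circle_mean_le:
  assumes [measurable]: "G \<in> borel_measurable borel"
    and le: "\<And>z. cmod z < 1 \<Longrightarrow> (\<integral>\<^sup>+ x. G (dir x * z) \<partial>circ) \<le> H z"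
  shows "(\<integral>\<^sup>+ z. G z \<partial>M) \<le> (\<integral>\<^sup>+ z. H z \<partial>M)"
proof -
  have "(\<integral>\<^sup>+ z. G z \<partial>M) = (\<integral>\<^sup>+ z. (\<integral>\<^sup>+ x. G (dir x * z) \<partial>circ) \<partial>M)"
    by (rule nn_integral_circle_average[symmetric]) simp
  also have "\<dots> \<le> (\<integral>\<^sup>+ z. H z \<partial>M)"
    by (rule nn_integral_mono_AE) (use AE_disc in eventually_elim, rule le)
  finally show ?thesis .
qed

theorem proj_Lp_bounded:
  fixes p :: real
  assumes p: "1 < p"
  obtains C where "C > 0"
    "\<And>f. Lp_disc p f \<Longrightarrow> (\<integral>\<^sup>+ z. ennreal (cmod (proj f z) powr p) \<partial>M) \<le> ennreal C * (\<integral>\<^sup>+ z. ennreal (cmod (f z) powr p) \<partial>M)"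
proof -
  obtain K where K: "K > 0" and circle: "\<And>z f. cmod z < 1 \<Longrightarrow> Lp_disc p f \<Longrightarrow>
       pmean p (\<lambda>u. proj f (u * z)) \<le> ennreal K * majorant p f (tail (cmod z))"
    by (rule proj_circle_le[OF p]) (rule that)
  obtain C where C: "C > 0" and maj: "\<And>f. Lp_disc p f \<Longrightarrow>
      (\<integral>\<^sup>+ z. majorant p f (tail (cmod z)) \<partial>M) \<le> ennreal C * (\<integral>\<^sup>+ z. ennreal (cmod (f z) powr p) \<partial>M)"
    by (rule nn_integral_majorant_le[OF p]) (rule that)
  show thesis
  proof (rule that)
    show "K * C > 0" using K C by simp
    fix f assume f: "Lp_disc p f"
    have [measurable]: "f \<in> borel_measurable borel" using f by (rule Lp_discD)
    have [measurable]: "(\<lambda>z. majorant p f (tail (cmod z))) \<in> borel_measurable borel"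
      unfolding majorant_def by measurable
    have "(\<integral>\<^sup>+ z. ennreal (cmod (proj f z) powr p) \<partial>M) \<le> (\<integral>\<^sup>+ z. ennreal K * majorant p f (tail (cmod z)) \<partial>M)"
      using circle[OF _ f] by (intro nn_integral_AE_circle_mean_le) (auto simp: pmean_def)
    also have "\<dots> = ennreal K * (\<integral>\<^sup>+ z. majorant p f (tail (cmod z)) \<partial>M)"
      by (rule nn_integral_cmult) measurable
    also have "\<dots> \<le> ennreal K * (ennreal C * (\<integral>\<^sup>+ z. ennreal (cmod (f z) powr p) \<partial>M))"
      by (intro mult_left_mono maj f) simp
    finally show "(\<integral>\<^sup>+ z. ennreal (cmod (proj f z) powr p) \<partial>M) \<le> ennreal (K * C) * (\<integral>\<^sup>+ z. ennreal (cmod (f z) powr p) \<partial>M)"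
      using K by (simp add: ennreal_mult' mult.assoc)
  qed
qed

text \<open>Cauchy's formula and Jensen's inequality reduce the derivative to p-means of the
  projection through the points z + d dir y. Their moduli are at most (1 + |z|) / 2, where doubling
  controls the tail. The factor k! / d^k cancels (1 - |z|)^k up to k! 2^k.\<close>

lemma proj_deriv_circle_le:
  fixes p :: real
  assumes p: "1 < p"
  obtains K where "K > 0"
    "\<And>z f k. cmod z < 1 \<Longrightarrow> Lp_disc p f \<Longrightarrow>
       ennreal ((1 - cmod z) powr (real k * p)) * pmean p (\<lambda>u. (deriv ^^ k) (proj f) (u * z))
         \<le> ennreal (K * (fact k * 2 ^ k) powr p) * majorant p f (tail (cmod z))"
proof -
  obtain K where K: "K > 0" and circle: "\<And>z f. cmod z < 1 \<Longrightarrow> Lp_disc p f \<Longrightarrow>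
       pmean p (\<lambda>u. proj f (u * z)) \<le> ennreal K * majorant p f (tail (cmod z))"
    by (rule proj_circle_le[OF p]) (rule that)
  interpret PP: pair_sigma_finite circ circ ..
  show thesis
  proof (rule that)
    show "K * (D * D) > 0" using K D by simp
    fix z :: complex and f and k assume z: "cmod z < 1" and f: "Lp_disc p f"
    have [measurable]: "f \<in> borel_measurable borel" using f by (rule Lp_discD)
    define F where "F = proj f"
    have [measurable]: "F \<in> borel_measurable borel" unfolding F_def by measurable
    have hol: "F holomorphic_on ball 0 1" unfolding F_def using p by (intro proj_holomorphic[OF f]) simp
    define d where "d = (1 - cmod z) / 2"
    have d: "d > 0" using z by (simp add: d_def)
    define c where "c = fact k / d ^ k"
    have c: "c > 0" using d by (simp add: c_def)
    have ptw: "ennreal (cmod ((deriv ^^ k) F (dir x * z)) powr p)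
       \<le> ennreal (c powr p) * (\<integral>\<^sup>+ y. ennreal (cmod (F (dir x * (z + of_real d * dir y))) powr p) \<partial>circ)" for x
    proof -
      have zx: "cmod (dir x * z) < 1" "d = (1 - cmod (dir x * z)) / 2" using z by (auto simp: norm_mult d_def)
      have "cmod ((deriv ^^ k) F (dir x * z)) = c * cmod (\<integral> y. F (dir x * z + of_real d * dir y) * cnj (dir y) ^ k \<partial>circ)"
        using d by (subst higher_deriv_mean_value[OF hol zx]) (simp add: norm_mult norm_divide norm_power c_def)
      then have "ennreal (cmod ((deriv ^^ k) F (dir x * z)) powr p)
        = ennreal (c powr p) * ennreal (cmod (\<integral> y. F (dir x * z + of_real d * dir y) * cnj (dir y) ^ k \<partial>circ) powr p)"
        using c by (simp add: powr_mult ennreal_mult')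
      also have "\<dots> \<le> ennreal (c powr p) * (ennreal (1 powr (p - 1)) *
          (\<integral>\<^sup>+ y. ennreal (1 * cmod (F (dir x * z + of_real d * dir y)) powr p) \<partial>circ))"
        using circ.emeasure_space_1
        by (intro mult_left_mono Jensen_integral[OF p]) (auto simp: norm_mult norm_power)
      \<comment> \<open>Turning the small circle along with its center makes the whole figure rotate
        rigidly: for fixed \<open>y\<close> the average over \<open>x\<close> becomes a p-mean over
        a single circle about the origin.\<close>
      also have "(\<integral>\<^sup>+ y. ennreal (1 * cmod (F (dir x * z + of_real d * dir y)) powr p) \<partial>circ)
        = (\<integral>\<^sup>+ y. ennreal (cmod (F (dir x * z + of_real d * (dir x * dir y))) powr p) \<partial>circ)"
        using circ_nn_integral_rotate[of "dir x" "\<lambda>v. ennreal (cmod (F (dir x * z + of_real d * v)) powr p)"] by simp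
      finally show ?thesis by (simp add: ring_distribs mult_ac)
    qed
    have near: "pmean p (\<lambda>u. F (u * (z + of_real d * dir y))) \<le> ennreal (K * (D * D)) * majorant p f (tail (cmod z))" for y
    proof -
      have "cmod (z + of_real d * dir y) \<le> cmod z + d"
        using norm_triangle_ineq[of z "of_real d * dir y"] d by (simp add: norm_mult)
      also have "\<dots> = (1 + cmod z) / 2" by (simp add: d_def field_simps)
      finally have le: "cmod (z + of_real d * dir y) \<le> (1 + cmod z) / 2" .
      then have lt: "cmod (z + of_real d * dir y) < 1" using z by simp
      have "tail (cmod z) \<le> D * tail ((1 + cmod z) / 2)" using z by (intro doubling) auto
      also have "\<dots> \<le> D * tail (cmod (z + of_real d * dir y))"
        using D by (intro mult_left_mono tail_antimono le) auto
      finally have "majorant p f (tail (cmod (z + of_real d * dir y))) \<le> ennreal (D * D) * majorant p f (tail (cmod z))"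
        using z lt D p by (intro majorant_le) (auto intro: tail_gt_0)
      then have "ennreal K * majorant p f (tail (cmod (z + of_real d * dir y))) \<le> ennreal K * (ennreal (D * D) * majorant p f (tail (cmod z)))"
        by (intro mult_left_mono) auto
      with circle[OF lt f] have "pmean p (\<lambda>u. F (u * (z + of_real d * dir y))) \<le> ennreal K * (ennreal (D * D) * majorant p f (tail (cmod z)))"
        unfolding F_def by (rule order_trans)
      also have "\<dots> = ennreal (K * (D * D)) * majorant p f (tail (cmod z))"
        using K by (subst ennreal_mult') (auto simp: mult.assoc)
      finally show ?thesis .
    qed
    have "pmean p (\<lambda>u. (deriv ^^ k) F (u * z)) \<le>
       (\<integral>\<^sup>+ x. ennreal (c powr p) * (\<integral>\<^sup>+ y. ennreal (cmod (F (dir x * (z + of_real d * dir y))) powr p) \<partial>circ) \<partial>circ)"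
      unfolding pmean_def by (intro nn_integral_mono ptw)
    also have "\<dots> = ennreal (c powr p) * (\<integral>\<^sup>+ x. \<integral>\<^sup>+ y. ennreal (cmod (F (dir x * (z + of_real d * dir y))) powr p) \<partial>circ \<partial>circ)"
      by (rule nn_integral_cmult) measurable
    also have "(\<integral>\<^sup>+ x. \<integral>\<^sup>+ y. ennreal (cmod (F (dir x * (z + of_real d * dir y))) powr p) \<partial>circ \<partial>circ)
       = (\<integral>\<^sup>+ y. pmean p (\<lambda>u. F (u * (z + of_real d * dir y))) \<partial>circ)"
      unfolding pmean_def by (rule PP.Fubini'[symmetric]) measurable
    also have "\<dots> \<le> (\<integral>\<^sup>+ y. ennreal (K * (D * D)) * majorant p f (tail (cmod z)) \<partial>circ)"
      by (intro nn_integral_mono near)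
    also have "\<dots> = ennreal (K * (D * D)) * majorant p f (tail (cmod z))"
      using circ.emeasure_space_1 by simp
    finally have "pmean p (\<lambda>u. (deriv ^^ k) F (u * z)) \<le> ennreal (c powr p) * (ennreal (K * (D * D)) * majorant p f (tail (cmod z)))"
      by (simp add: mult_left_mono)
    then have "ennreal ((1 - cmod z) powr (real k * p)) * pmean p (\<lambda>u. (deriv ^^ k) F (u * z))
       \<le> ennreal ((1 - cmod z) powr (real k * p)) * (ennreal (c powr p) * (ennreal (K * (D * D)) * majorant p f (tail (cmod z))))"
      by (intro mult_left_mono) auto
    also have "\<dots> = ennreal ((1 - cmod z) powr (real k * p) * c powr p * (K * (D * D))) * majorant p f (tail (cmod z))"
      using K D by (simp add: ennreal_mult' mult.assoc)
    also have "(1 - cmod z) powr (real k * p) * c powr p * (K * (D * D)) = K * (D * D) * (fact k * 2 ^ k) powr p"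
    proof -
      have "(1 - cmod z) powr (real k * p) = ((1 - cmod z) ^ k) powr p"
        using z by (simp add: powr_powr[symmetric] powr_realpow)
      then have "(1 - cmod z) powr (real k * p) * c powr p = ((1 - cmod z) ^ k * c) powr p"
        using z c by (simp add: powr_mult)
      also have "(1 - cmod z) ^ k * c = fact k * 2 ^ k"
        using z by (simp add: c_def d_def power_divide)
      finally show ?thesis by simp
    qed
    finally show "ennreal ((1 - cmod z) powr (real k * p)) * pmean p (\<lambda>u. (deriv ^^ k) (proj f) (u * z))
         \<le> ennreal (K * (D * D) * (fact k * 2 ^ k) powr p) * majorant p f (tail (cmod z))" by (simp add: F_def)
  qed
qed

theorem proj_Dirichlet_bounded:
  fixes p :: real
  assumes p: "1 < p"
  obtains C where "C > 0"
    "\<And>f. Lp_disc p f \<Longrightarrow>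
      (\<Sum>j<k. ennreal (cmod ((deriv ^^ j) (proj f) 0) powr p)) +
      (\<integral>\<^sup>+ z. ennreal (cmod (if cmod z < 1 then (deriv ^^ k) (proj f) z else 0) powr p * (1 - cmod z) powr (real k * p)) \<partial>M)
      \<le> ennreal C * (\<integral>\<^sup>+ z. ennreal (cmod (f z) powr p) \<partial>M)"
proof -
  obtain K where K: "K > 0" and circle: "\<And>z f k. cmod z < 1 \<Longrightarrow> Lp_disc p f \<Longrightarrow>
       ennreal ((1 - cmod z) powr (real k * p)) * pmean p (\<lambda>u. (deriv ^^ k) (proj f) (u * z))
         \<le> ennreal (K * (fact k * 2 ^ k) powr p) * majorant p f (tail (cmod z))"
    by (rule proj_deriv_circle_le[OF p]) (rule that)
  obtain C where C: "C > 0" and maj: "\<And>f. Lp_disc p f \<Longrightarrow>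
      (\<integral>\<^sup>+ z. majorant p f (tail (cmod z)) \<partial>M) \<le> ennreal C * (\<integral>\<^sup>+ z. ennreal (cmod (f z) powr p) \<partial>M)"
    by (rule nn_integral_majorant_le[OF p]) (rule that)
  have t0: "tail 0 > 0" by (rule tail_gt_0) simp
  define L where "L j = K * (fact j * 2 ^ j) powr p" for j :: nat
  have L: "0 < L j" for j using K by (simp add: L_def)
  show thesis
  proof (rule that)
    show "(\<Sum>j<k. L j * (1 / tail 0)) + L k * C > 0" using L C t0
      by (intro add_nonneg_pos sum_nonneg mult_pos_pos) (auto simp: less_imp_le)
    fix f assume f: "Lp_disc p f"
    have [measurable]: "f \<in> borel_measurable borel" using f by (rule Lp_discD)
    have [measurable]: "(\<lambda>z. majorant p f (tail (cmod z))) \<in> borel_measurable borel"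
      unfolding majorant_def by measurable
    have hol: "proj f holomorphic_on ball 0 1" using p by (intro proj_holomorphic[OF f]) simp
    define I where "I = (\<integral>\<^sup>+ z. ennreal (cmod (f z) powr p) \<partial>M)"
    define G where "G z = (if cmod z < 1 then (deriv ^^ k) (proj f) z else 0)" for z
    have [measurable]: "G \<in> borel_measurable borel"
      unfolding G_def[abs_def] by (intro measurable_extend_by_zero holomorphic_higher_deriv hol) simp
    have "ennreal (cmod ((deriv ^^ j) (proj f) 0) powr p) \<le> ennreal (L j * (1 / tail 0)) * I" for j
    proof -
      \<comment> \<open>At z = 0 the weight (1 - |z|)^(jp) is 1 and the p-mean reduces to the value
        at the origin.\<close>
      have "ennreal (cmod ((deriv ^^ j) (proj f) 0) powr p) \<le> ennreal (L j) * majorant p f (tail 0)"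
        using circle[of 0 f j] f circ.emeasure_space_1 by (simp add: pmean_def L_def)
      also have "\<dots> \<le> ennreal (L j) * (ennreal (1 / tail 0) * I)"
        unfolding I_def by (intro mult_left_mono majorant_tail_0[OF p]) auto
      also have "\<dots> = ennreal (L j * (1 / tail 0)) * I"
        using L by (subst ennreal_mult') (auto simp: mult.assoc less_imp_le)
      finally show ?thesis .
    qed
    then have "(\<Sum>j<k. ennreal (cmod ((deriv ^^ j) (proj f) 0) powr p)) \<le> (\<Sum>j<k. ennreal (L j * (1 / tail 0)) * I)"
      by (rule sum_mono)
    also have "\<dots> = (\<Sum>j<k. ennreal (L j * (1 / tail 0))) * I" by (rule sum_distrib_right[symmetric])
    also have "(\<Sum>j<k. ennreal (L j * (1 / tail 0))) = ennreal (\<Sum>j<k. L j * (1 / tail 0))"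
      using L t0 by (intro sum_ennreal) (auto simp: less_imp_le)
    finally have 1: "(\<Sum>j<k. ennreal (cmod ((deriv ^^ j) (proj f) 0) powr p)) \<le> ennreal (\<Sum>j<k. L j * (1 / tail 0)) * I" .
    have "(\<integral>\<^sup>+ z. ennreal (cmod (G z) powr p * (1 - cmod z) powr (real k * p)) \<partial>M)
       \<le> (\<integral>\<^sup>+ z. ennreal (L k) * majorant p f (tail (cmod z)) \<partial>M)"
    proof (rule nn_integral_AE_circle_mean_le)
      fix z :: complex assume z: "cmod z < 1"
      have "(\<integral>\<^sup>+ x. ennreal (cmod (G (dir x * z)) powr p * (1 - cmod (dir x * z)) powr (real k * p)) \<partial>circ)
        = (\<integral>\<^sup>+ x. ennreal ((1 - cmod z) powr (real k * p)) * ennreal (cmod (G (dir x * z)) powr p) \<partial>circ)"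
        by (simp add: norm_mult ennreal_mult' mult.commute)
      also have "\<dots> = ennreal ((1 - cmod z) powr (real k * p)) * (\<integral>\<^sup>+ x. ennreal (cmod (G (dir x * z)) powr p) \<partial>circ)"
        by (rule nn_integral_cmult) measurable
      also have "(\<integral>\<^sup>+ x. ennreal (cmod (G (dir x * z)) powr p) \<partial>circ) = pmean p (\<lambda>u. (deriv ^^ k) (proj f) (u * z))"
        using z by (simp add: pmean_def G_def norm_mult)
      also have "ennreal ((1 - cmod z) powr (real k * p)) * \<dots> \<le> ennreal (L k) * majorant p f (tail (cmod z))"
        unfolding L_def by (rule circle[OF z f])
      finally show "(\<integral>\<^sup>+ x. ennreal (cmod (G (dir x * z)) powr p * (1 - cmod (dir x * z)) powr (real k * p)) \<partial>circ)
        \<le> ennreal (L k) * majorant p f (tail (cmod z))" .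
    qed measurable
    also have "\<dots> = ennreal (L k) * (\<integral>\<^sup>+ z. majorant p f (tail (cmod z)) \<partial>M)"
      by (rule nn_integral_cmult) measurable
    also have "\<dots> \<le> ennreal (L k) * (ennreal C * I)" unfolding I_def by (intro mult_left_mono maj f) simp
    also have "\<dots> = ennreal (L k * C) * I" using L[of k] by (subst ennreal_mult') (auto simp: mult.assoc)
    finally have 2: "(\<integral>\<^sup>+ z. ennreal (cmod (G z) powr p * (1 - cmod z) powr (real k * p)) \<partial>M) \<le> ennreal (L k * C) * I" .
    have "0 \<le> (\<Sum>j<k. L j * (1 / tail 0))" "0 \<le> L k * C"
      using L t0 C by (auto intro!: sum_nonneg simp: less_imp_le)
    then have "ennreal ((\<Sum>j<k. L j * (1 / tail 0)) + L k * C) * I = ennreal (\<Sum>j<k. L j * (1 / tail 0)) * I + ennreal (L k * C) * I"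
      by (subst ennreal_plus) (auto simp: distrib_right)
    with add_mono[OF 1 2]
    show "(\<Sum>j<k. ennreal (cmod ((deriv ^^ j) (proj f) 0) powr p)) +
      (\<integral>\<^sup>+ z. ennreal (cmod (if cmod z < 1 then (deriv ^^ k) (proj f) z else 0) powr p * (1 - cmod z) powr (real k * p)) \<partial>M)
      \<le> ennreal ((\<Sum>j<k. L j * (1 / tail 0)) + L k * C) * (\<integral>\<^sup>+ z. ennreal (cmod (f z) powr p) \<partial>M)"
      unfolding G_def I_def by simp
  qed
qed

end

section \<open>Doubling tails and reproducing kernels\<close>

text \<open>On [0, 1/2] one has ln (1 - x) \<ge> - x - 2 x^2 \<ge> - 2 x; this is multiplied by n
  and exponentiated.\<close>

lemma exp_le_power:
  fixes r m :: real
  assumes r: "1 / 2 \<le> r" "r < 1" and n: "real n * (1 - r) \<le> m"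
  shows "exp (- 2 * m) \<le> r ^ n"
proof -
  define x where "x = 1 - r"
  have x: "0 \<le> x" "x \<le> 1 / 2" using r by (auto simp: x_def)
  have "x * x \<le> x * (1 / 2)" using x by (intro mult_left_mono) auto
  then have "- 2 * x \<le> - x - 2 * x\<^sup>2" by (simp add: power2_eq_square)
  also have "\<dots> \<le> ln (1 - x)" by (rule ln_one_minus_pos_lower_bound[OF x])
  finally have "- 2 * x \<le> ln r" by (simp add: x_def)
  then have "real n * (- 2 * x) \<le> real n * ln r" by (intro mult_left_mono) auto
  moreover have "real n * (- 2 * x) = - 2 * (real n * (1 - r))" by (simp add: x_def algebra_simps)
  then have "- 2 * m \<le> real n * (- 2 * x)" using n by linarith
  ultimately have "exp (- 2 * m) \<le> exp (real n * ln r)" by simp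
  also have "\<dots> = r ^ n" using r by (simp add: exp_of_nat_mult)
  finally show ?thesis .
qed

context radial_measure
begin

text \<open>Take n about 2 \<Lambda> / (1 - r). Then 1 - \<Lambda> / n \<ge> (1 + r) / 2, while n (1
  - r) stays bounded, so that r^n is bounded below. Radii below 1/2 are covered by the quotient
  \<open>tail 0 / tail (3/4)\<close>.\<close>

lemma doubling_if_power_tail_bound:
  fixes p \<Lambda> :: real and k :: nat
  assumes p: "0 \<le> p" and \<Lambda>: "0 < \<Lambda>"
    and bound: "\<And>n r. k \<le> n \<Longrightarrow> 1 \<le> n \<Longrightarrow> 0 \<le> r \<Longrightarrow> r < 1 \<Longrightarrow>
       (r ^ n) powr p * tail r \<le> 2 * tail (1 - \<Lambda> / real n)"
  obtains D where "1 \<le> D" "\<And>r. 0 \<le> r \<Longrightarrow> r < 1 \<Longrightarrow> tail r \<le> D * tail ((1 + r) / 2)"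
proof -
  define m where "m = 2 * \<Lambda> + 1 + real k"
  have t34: "tail (3/4) > 0" by (rule tail_gt_0) simp
  define D where "D = 1 + 2 * exp (2 * m * p) + tail 0 / tail (3/4)"
  have D1: "1 \<le> D" "2 * exp (2 * m * p) \<le> D" "tail 0 / tail (3/4) \<le> D"
    using t34 by (auto simp: D_def intro: add_nonneg_nonneg)
  show thesis
  proof (rule that[OF D1(1)])
    fix r :: real assume r: "0 \<le> r" "r < 1"
    show "tail r \<le> D * tail ((1 + r) / 2)"
    proof (cases "r < 1 / 2")
      case True
      have "tail r \<le> tail 0 / tail (3/4) * tail (3/4)" using r t34 tail_antimono[of 0 r] by simp
      also have "\<dots> \<le> D * tail ((1 + r) / 2)"
        using True D1 t34 by (intro mult_mono tail_antimono) auto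
      finally show ?thesis .
    next
      case False
      \<comment> \<open>Adding \<open>k\<close> secures the condition \<open>k \<le> n\<close> of
        the bound and enlarges n (1 - r) by at most \<open>k\<close>.\<close>
      define n where "n = nat \<lceil>2 * \<Lambda> / (1 - r)\<rceil> + k"
      have q: "2 * \<Lambda> / (1 - r) > 0" using r \<Lambda> by simp
      then have c: "0 < \<lceil>2 * \<Lambda> / (1 - r)\<rceil>" by (rule less_ceiling_iff[THEN iffD2, OF order.strict_trans1, rotated]) simp
      have n1: "2 * \<Lambda> / (1 - r) \<le> real n" unfolding n_def using q by (simp add: of_nat_nat add_increasing2)
      then have n0: "real n > 0" using q by linarith
      have n2: "real n \<le> 2 * \<Lambda> / (1 - r) + 1 + real k"
        using c of_int_ceiling_le_add_one[of "2 * \<Lambda> / (1 - r)"] by (simp add: n_def)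
      have "real n * (1 - r) \<le> (2 * \<Lambda> / (1 - r) + 1 + real k) * (1 - r)"
        using n2 r by (intro mult_right_mono) auto
      also have "\<dots> = 2 * \<Lambda> + (1 + real k) * (1 - r)" using r by (simp add: field_simps)
      also have "\<dots> \<le> 2 * \<Lambda> + (1 + real k) * 1" using r by (intro add_left_mono mult_left_mono) auto
      finally have nm: "real n * (1 - r) \<le> m" by (simp add: m_def)
      have "exp (- 2 * m) \<le> r ^ n" using False r by (intro exp_le_power nm) auto
      then have "exp (- 2 * m) powr p \<le> (r ^ n) powr p" using p by (intro powr_mono2) auto
      then have "exp (- 2 * m) powr p * tail r \<le> (r ^ n) powr p * tail r" by (intro mult_right_mono) auto
      also have "\<dots> \<le> 2 * tail (1 - \<Lambda> / real n)"
        using n0 r by (intro bound) (auto simp: n_def Suc_le_eq)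
      also have "\<dots> \<le> 2 * tail ((1 + r) / 2)"
      proof (intro mult_left_mono tail_antimono)
        have "\<Lambda> / real n \<le> (1 - r) / 2" using n1 n0 r by (simp add: field_simps)
        then show "(1 + r) / 2 \<le> 1 - \<Lambda> / real n" by (simp add: field_simps)
      qed simp
      finally have "exp (- 2 * m * p) * tail r \<le> 2 * tail ((1 + r) / 2)" by (simp add: powr_def mult_ac)
      then have "exp (2 * m * p) * (exp (- 2 * m * p) * tail r) \<le> exp (2 * m * p) * (2 * tail ((1 + r) / 2))"
        by (intro mult_left_mono) auto
      also have "exp (2 * m * p) * (exp (- 2 * m * p) * tail r) = tail r"
        unfolding mult.assoc[symmetric] mult_exp_exp by simp
      also have "exp (2 * m * p) * (2 * tail ((1 + r) / 2)) = (2 * exp (2 * m * p)) * tail ((1 + r) / 2)" by simp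
      finally have "tail r \<le> (2 * exp (2 * m * p)) * tail ((1 + r) / 2)" .
      also have "\<dots> \<le> D * tail ((1 + r) / 2)" using D1 by (intro mult_right_mono) auto
      finally show ?thesis .
    qed
  qed
qed

text \<open>On each circle the pairing selects the n-th Taylor coefficient times |z|^(2n), and
  integration over M turns this power into a moment. Both the reproducing property and the
  uniqueness of the kernel come from this orthogonality.\<close>

lemma integral_coeff_pairing:
  assumes B: "B holomorphic_on ball 0 1"
    and int: "integrable M (\<lambda>z. if cmod z < 1 then B z else 0)"
  shows "(\<integral> z. (if cmod z < 1 then B z else 0) * cnj z ^ n \<partial>M) = (deriv ^^ n) B 0 / fact n * of_real (moment n)"
proof -
  define B' where "B' z = (if cmod z < 1 then B z else 0)" for z
  have [measurable]: "B' \<in> borel_measurable borel"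
    unfolding B'_def[abs_def] by (rule measurable_extend_by_zero[OF B])
  have int': "integrable M (\<lambda>z. B' z * cnj z ^ n)"
  proof (rule Bochner_Integration.integrable_bound)
    show "integrable M B'" using int by (simp add: B'_def[abs_def])
    show "AE z in M. norm (B' z * cnj z ^ n) \<le> norm (B' z)"
      using AE_disc by eventually_elim (auto simp: norm_mult norm_power power_le_one intro: mult_left_le)
  qed measurable
  have "(\<integral> z. B' z * cnj z ^ n \<partial>M) = (\<integral> z. (\<integral> x. B' (dir x * z) * cnj (dir x * z) ^ n \<partial>circ) \<partial>M)"
    by (rule integral_circle_average[OF int', symmetric])
  also have "\<dots> = (\<integral> z. (deriv ^^ n) B 0 / fact n * of_real (cmod z ^ (2 * n)) \<partial>M)"
  proof (rule integral_cong_AE)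
    show "AE z in M. (\<integral> x. B' (dir x * z) * cnj (dir x * z) ^ n \<partial>circ) = (deriv ^^ n) B 0 / fact n * of_real (cmod z ^ (2 * n))"
      using AE_disc
    proof eventually_elim
      case (elim z)
      define R where "R = 2 / (1 + cmod z)"
      have z1: "1 + cmod z > 0" by (simp add: add_pos_nonneg)
      have R: "R > 1" using elim z1 by (simp add: R_def)
      have Rz: "R * cmod z < 1" using elim z1 by (simp add: R_def)
      have sub: "z * w \<in> ball 0 1" if "w \<in> ball 0 R" for w
      proof -
        have "cmod z * cmod w \<le> cmod z * R" using that by (intro mult_left_mono) auto
        then show ?thesis using Rz by (simp add: norm_mult mult.commute)
      qed
      have "(\<lambda>w. B (z * w)) holomorphic_on ball 0 R"
        using sub by (intro holomorphic_on_compose_gen[OF _ B, unfolded o_def] holomorphic_intros) auto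
      from circ_integral_coeff[OF this R, of n]
      have "(\<integral> x. B (z * dir x) * cnj (dir x) ^ n \<partial>circ) = (deriv ^^ n) (\<lambda>w. B (z * w)) 0 / fact n" .
      also have "(deriv ^^ n) (\<lambda>w. B (z * w)) 0 = z ^ n * (deriv ^^ n) B (z * 0)"
        by (rule higher_deriv_compose_linear[OF B, where S="ball 0 R"]) (use sub R in auto)
      finally have eq: "(\<integral> x. B (z * dir x) * cnj (dir x) ^ n \<partial>circ) = z ^ n * (deriv ^^ n) B 0 / fact n" by simp
      have "(\<integral> x. B' (dir x * z) * cnj (dir x * z) ^ n \<partial>circ) = (\<integral> x. cnj z ^ n * (B (z * dir x) * cnj (dir x) ^ n) \<partial>circ)"
        using elim by (intro Bochner_Integration.integral_cong) (auto simp: B'_def norm_mult power_mult_distrib mult_ac)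
      also have "\<dots> = cnj z ^ n * (z ^ n * (deriv ^^ n) B 0 / fact n)" unfolding integral_mult_right_zero eq ..
      also have "\<dots> = (deriv ^^ n) B 0 / fact n * (z * cnj z) ^ n" by (simp add: power_mult_distrib mult_ac)
      also have "(z * cnj z) ^ n = of_real (cmod z ^ (2 * n))"
        unfolding complex_norm_square[symmetric] by (simp add: power_mult)
      finally show ?case .
    qed
  qed measurable
  also have "\<dots> = (deriv ^^ n) B 0 / fact n * of_real (moment n)"
    unfolding integral_mult_right_zero moment_def by (simp only: integral_complex_of_real)
  finally show ?thesis by (simp add: B'_def)
qed

lemma cnj_kern: "cnj (kern x) = kern (cnj x)" if "cmod x < 1"
proof -
  have "(\<lambda>n. cnj (of_real (1 / moment n) * x ^ n)) sums cnj (kern x)"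
    using kern_sums[OF that] by (simp only: sums_cnj)
  moreover have "(\<lambda>n. of_real (1 / moment n) * cnj x ^ n) sums kern (cnj x)"
    using that by (intro kern_sums) simp
  ultimately show ?thesis by (simp add: sums_iff)
qed

lemma kern_eq_if_coeffs:
  assumes B: "B holomorphic_on ball 0 1" and z: "cmod z < 1"
    and coeffs: "\<And>n. (deriv ^^ n) B 0 / fact n * of_real (moment n) = cnj z ^ n"
    and w: "cmod w < 1"
  shows "B w = kern (cnj z * w)"
proof -
  have "cmod z * cmod w < 1" using z w by (meson le_less_trans mult_left_le norm_ge_zero less_imp_le)
  then have "(\<lambda>n. of_real (1 / moment n) * (cnj z * w) ^ n) sums kern (cnj z * w)"
    by (intro kern_sums) (simp add: norm_mult)
  moreover have "of_real (1 / moment n) * (cnj z * w) ^ n = (deriv ^^ n) B 0 / fact n * w ^ n" for n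
    using moment_pos[of n] by (simp add: power_mult_distrib coeffs[symmetric])
  moreover have "(\<lambda>n. (deriv ^^ n) B 0 / fact n * w ^ n) sums B w"
    using holomorphic_power_series[OF B, of w] w by simp
  ultimately show ?thesis by (simp add: sums_iff)
qed

text \<open>In the power series of the projection the moment in the denominator cancels the one
  produced by the pairing, which leaves the Taylor series of \<open>F\<close>.\<close>

lemma proj_reproduces:
  assumes F: "F holomorphic_on ball 0 1" and f: "Lp_disc p (\<lambda>z. if cmod z < 1 then F z else 0)"
    and p: "1 \<le> p" and z: "cmod z < 1"
  shows "proj (\<lambda>z. if cmod z < 1 then F z else 0) z = F z"
proof -
  let ?f = "\<lambda>z. if cmod z < 1 then F z else 0"
  have "of_real (1 / moment n) * (\<integral> \<zeta>. ?f \<zeta> * cnj \<zeta> ^ n \<partial>M) * z ^ n = (deriv ^^ n) F 0 / fact n * z ^ n" for n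
    using moment_pos[of n] by (subst integral_coeff_pairing[OF F integrable_Lp_disc[OF f p]]) simp
  with proj_sums[OF f p z] have "(\<lambda>n. (deriv ^^ n) F 0 / fact n * z ^ n) sums proj ?f z" by simp
  moreover have "(\<lambda>n. (deriv ^^ n) F 0 / fact n * z ^ n) sums F z"
    using holomorphic_power_series[OF F, of z] z by simp
  ultimately show ?thesis by (simp add: sums_iff)
qed

end

text \<open>
  By the choice of \<open>\<Lambda>\<close>, the hypothesis leaves at most half of the integral of \<open>|z|^(np)\<close> on \<open>{|z| \<le> 1 - \<Lambda>/n}\<close>.
\<close>

lemma (in radial_measure) power_tail_bound:
  fixes p c \<Lambda> r :: real and n k :: nat
  assumes p: "0 < p" and k: "1 \<le> k" "k \<le> n" and c: "0 < c" and \<Lambda>: "0 < \<Lambda>" "2 * c \<le> ((\<Lambda> / real k) ^ k) powr p"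
    and hyp: "(\<integral> z. ((real n / real k) ^ k * cmod z ^ (n - k) * (1 - cmod z) ^ k) powr p \<partial>M)
       \<le> c * (\<integral> z. (cmod z ^ n) powr p \<partial>M)"
    and r: "0 \<le> r" "r < 1"
  shows "(r ^ n) powr p * tail r \<le> 2 * tail (1 - \<Lambda> / real n)"
proof -
  define J where "J = (\<integral> z. (cmod z ^ n) powr p \<partial>M)"
  define A where "A = {z. cmod z \<le> 1 - \<Lambda> / real n}"
  define JA where "JA = (\<integral> z. indicator A z * (cmod z ^ n) powr p \<partial>M)"
  have n: "real n > 0" using k by simp
  have [measurable]: "A \<in> sets borel" unfolding A_def by measurable
  have pw: "(cmod z ^ n) powr p \<le> 1" if "cmod z < 1" for z
  proof -
    have "(cmod z ^ n) powr p \<le> 1 powr p" using that p by (intro powr_mono2 power_le_one) auto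
    then show ?thesis by simp
  qed
  have iJ: "integrable M (\<lambda>z. (cmod z ^ n) powr p)"
    by (rule integrable_const_bound[where B=1]) (use AE_disc in \<open>eventually_elim, use pw in simp\<close>, measurable)
  have iJA: "integrable M (\<lambda>z. indicator A z * (cmod z ^ n) powr p)"
    by (rule Bochner_Integration.integrable_bound[OF iJ]) (auto simp: indicator_def)
  have iA: "integrable M (\<lambda>z. indicator (S :: complex set) z :: real)" if "S \<in> sets borel" for S
    using that by (simp add: emeasure_eq_measure)
  have JA0: "0 \<le> JA" unfolding JA_def by (intro integral_nonneg_AE) auto
  have "((\<Lambda> / real k) ^ k) powr p * JA = (\<integral> z. ((\<Lambda> / real k) ^ k) powr p * (indicator A z * (cmod z ^ n) powr p) \<partial>M)"
    by (simp add: JA_def)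
  also have "\<dots> \<le> (\<integral> z. ((real n / real k) ^ k * cmod z ^ (n - k) * (1 - cmod z) ^ k) powr p \<partial>M)"
  proof (rule integral_mono_AE)
    show "integrable M (\<lambda>z. ((\<Lambda> / real k) ^ k) powr p * (indicator A z * (cmod z ^ n) powr p))" using iJA by simp
    show "integrable M (\<lambda>z. ((real n / real k) ^ k * cmod z ^ (n - k) * (1 - cmod z) ^ k) powr p)"
    proof (rule integrable_const_bound[where B="((real n / real k) ^ k) powr p"])
      show "AE z in M. norm (((real n / real k) ^ k * cmod z ^ (n - k) * (1 - cmod z) ^ k) powr p) \<le> ((real n / real k) ^ k) powr p"
        using AE_disc
      proof eventually_elim
        case (elim z)
        have "(real n / real k) ^ k * cmod z ^ (n - k) * (1 - cmod z) ^ k \<le> (real n / real k) ^ k * 1 * 1"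
          using elim by (intro mult_mono power_le_one) auto
        then show ?case using elim p by (auto intro!: powr_mono2)
      qed
    qed measurable
    show "AE z in M. ((\<Lambda> / real k) ^ k) powr p * (indicator A z * (cmod z ^ n) powr p)
        \<le> ((real n / real k) ^ k * cmod z ^ (n - k) * (1 - cmod z) ^ k) powr p"
      using AE_disc
    proof eventually_elim
      case (elim z)
      show ?case
      proof (cases "z \<in> A")
        case True
        \<comment> \<open>On \<open>A\<close> the distance to the boundary is at least \<Lambda> /
          n, so the integrand on the left of the hypothesis is at least (\<Lambda> / k)^(kp)
          |z|^(np).\<close>
        then have "\<Lambda> / real n \<le> 1 - cmod z" by (simp add: A_def)
        then have "\<Lambda> / real k \<le> real n / real k * (1 - cmod z)"
          using n k by (simp add: field_simps)
        then have "(\<Lambda> / real k) ^ k \<le> (real n / real k * (1 - cmod z)) ^ k" using \<Lambda> by (intro power_mono) auto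
        moreover have "cmod z ^ n \<le> cmod z ^ (n - k)" using elim by (intro power_decreasing) auto
        ultimately have "(\<Lambda> / real k) ^ k * cmod z ^ n \<le> (real n / real k * (1 - cmod z)) ^ k * cmod z ^ (n - k)"
          using elim \<Lambda> by (intro mult_mono) auto
        also have "\<dots> = (real n / real k) ^ k * cmod z ^ (n - k) * (1 - cmod z) ^ k"
          by (simp only: power_mult_distrib mult_ac)
        finally have "((\<Lambda> / real k) ^ k * cmod z ^ n) powr p \<le> ((real n / real k) ^ k * cmod z ^ (n - k) * (1 - cmod z) ^ k) powr p"
          using \<Lambda> p by (intro powr_mono2) auto
        then show ?thesis using True \<Lambda> by (simp add: powr_mult)
      qed simp
    qed
  qed
  also have "\<dots> \<le> c * J" using hyp by (simp add: J_def)
  finally have "((\<Lambda> / real k) ^ k) powr p * JA \<le> c * J" .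
  moreover have "2 * c * JA \<le> ((\<Lambda> / real k) ^ k) powr p * JA" using \<Lambda> JA0 by (intro mult_right_mono) auto
  ultimately have "c * (2 * JA) \<le> c * J" by simp
  then have JA: "2 * JA \<le> J" using c by simp
  \<comment> \<open>Off \<open>A\<close> the integrand is at most 1, so this part is bounded by the
    tail at 1 - \<Lambda> / n; as \<open>JA\<close> is at most half of \<open>J\<close>, the tail is
    at least the other half.\<close>
  have "J \<le> (\<integral> z. indicator A z * (cmod z ^ n) powr p + indicator {z. 1 - \<Lambda> / real n \<le> cmod z} z \<partial>M)"
    unfolding J_def
  proof (rule integral_mono_AE[OF iJ])
    show "integrable M (\<lambda>z. indicator A z * (cmod z ^ n) powr p + indicator {z. 1 - \<Lambda> / real n \<le> cmod z} z)"
      by (intro Bochner_Integration.integrable_add iJA iA) measurable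
    show "AE z in M. (cmod z ^ n) powr p \<le> indicator A z * (cmod z ^ n) powr p + indicator {z. 1 - \<Lambda> / real n \<le> cmod z} z"
      using AE_disc by eventually_elim (use pw in \<open>auto simp: A_def indicator_def\<close>)
  qed
  also have "\<dots> = JA + tail (1 - \<Lambda> / real n)"
    unfolding JA_def using iJA iA by (subst Bochner_Integration.integral_add) (auto simp: tail_def)
  finally have J2: "J \<le> 2 * tail (1 - \<Lambda> / real n)" using JA by linarith
  have "(r ^ n) powr p * tail r = (\<integral> z. (r ^ n) powr p * indicator {z. r \<le> cmod z} z \<partial>M)"
    by (simp add: tail_def)
  also have "\<dots> \<le> J"
    unfolding J_def
  proof (rule integral_mono[OF _ iJ])
    show "integrable M (\<lambda>z. (r ^ n) powr p * indicator {z. r \<le> cmod z} z)"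
      by (intro integrable_mult_right iA) measurable
    show "(r ^ n) powr p * indicator {z. r \<le> cmod z} z \<le> (cmod z ^ n) powr p" for z
      using r p by (auto simp: indicator_def intro!: powr_mono2 power_mono)
  qed
  finally show ?thesis using J2 by linarith
qed

section \<open>Radial weights\<close>

lemma space_disc_area [simp]: "space disc_area = ball 0 1"
  by (simp add: disc_area_def)

lemma measurable_disc_area_iff:
  "f \<in> measurable disc_area N \<longleftrightarrow> f \<in> measurable (lebesgue_on (ball 0 1)) N"
  unfolding disc_area_def by (intro arg_cong[where f="\<lambda>A. f \<in> A"] measurable_cong_sets) auto

lemma borel_measurable_disc_area:
  "f \<in> measurable borel N \<Longrightarrow> f \<in> measurable disc_area N"
  unfolding measurable_disc_area_iff
  by (intro measurable_restrict_space1 measurable_completion) simp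

lemma measurable_extend_lebesgue:
  fixes f :: "complex \<Rightarrow> 'b::{topological_space, zero}"
  assumes "f \<in> borel_measurable disc_area"
  shows "(\<lambda>z. if z \<in> ball 0 1 then f z else 0) \<in> borel_measurable lebesgue"
  using assms unfolding measurable_disc_area_iff
  by (subst (asm) measurable_restrict_space_iff[where c=0]) auto

lemma AE_disc_area_iff:
  "(AE z in disc_area. P z) \<longleftrightarrow> (AE z in lebesgue. z \<in> ball 0 1 \<longrightarrow> P z)"
  unfolding disc_area_def by (subst AE_density) (auto simp: AE_restrict_space_iff)

lemma nn_integral_disc_area:
  assumes [measurable]: "f \<in> borel_measurable disc_area"
  shows "(\<integral>\<^sup>+ z. f z \<partial>disc_area) = (\<integral>\<^sup>+ z. ennreal (1 / pi) * f z * indicator (ball 0 1) z \<partial>lebesgue)"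
proof -
  have "f \<in> borel_measurable (lebesgue_on (ball 0 1))" using assms by (simp add: measurable_disc_area_iff)
  then have "(\<integral>\<^sup>+ z. f z \<partial>disc_area) = (\<integral>\<^sup>+ z. ennreal (1 / pi) * f z \<partial>lebesgue_on (ball 0 1))"
    unfolding disc_area_def by (subst nn_integral_density) auto
  also have "\<dots> = (\<integral>\<^sup>+ z. ennreal (1 / pi) * f z * indicator (ball 0 1) z \<partial>lebesgue)"
    by (rule nn_integral_restrict_space) simp
  finally show ?thesis .
qed

text \<open>Pushing forward under the identity restricts \<nu> dA to Borel sets and extends it by
  zero to the plane, as \<open>radial_measure\<close> requires.\<close>

definition weight_measure :: "(complex \<Rightarrow> real) \<Rightarrow> complex measure" where
  "weight_measure \<nu> = distr (density disc_area (\<lambda>z. ennreal (\<nu> z))) borel (\<lambda>z. z)"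

lemma radial_weightD:
  assumes "radial_weight \<nu>"
  shows "cmod z < 1 \<Longrightarrow> 0 \<le> \<nu> z" "integrable disc_area \<nu>" "\<nu> \<in> borel_measurable disc_area"
    "cmod z < 1 \<Longrightarrow> \<nu> z = \<nu> (of_real (cmod z))"
    "cmod z < 1 \<Longrightarrow> 0 < (\<integral>\<^sup>+ s\<in>{cmod z<..<1}. ennreal (\<nu> (complex_of_real s)) \<partial>lebesgue)"
proof -
  have m: "cmod z < 1 \<Longrightarrow> z \<in> ball 0 1" by simp
  show "cmod z < 1 \<Longrightarrow> 0 \<le> \<nu> z" "cmod z < 1 \<Longrightarrow> \<nu> z = \<nu> (of_real (cmod z))"
    "cmod z < 1 \<Longrightarrow> 0 < (\<integral>\<^sup>+ s\<in>{cmod z<..<1}. ennreal (\<nu> (complex_of_real s)) \<partial>lebesgue)"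
    and int: "integrable disc_area \<nu>"
    using assms m unfolding radial_weight_def by blast+
  show "\<nu> \<in> borel_measurable disc_area" by (rule borel_measurable_integrable[OF int])
qed

context
  fixes \<nu> :: "complex \<Rightarrow> real"
  assumes rw: "radial_weight \<nu>"
begin

lemmas \<nu> = radial_weightD[OF rw]
lemmas [measurable] = radial_weightD(3)[OF rw]

lemma measurable_id_weight:
  "(\<lambda>z. z) \<in> measurable (density disc_area (\<lambda>z. ennreal (\<nu> z))) borel"
proof -
  have "(\<lambda>z. z) \<in> measurable disc_area (borel :: complex measure)"
    by (rule borel_measurable_disc_area) simp
  then show ?thesis by (simp cong: measurable_cong_sets)
qed

lemma nn_integral_weight_measure:
  assumes [measurable]: "g \<in> borel_measurable borel"
  shows "(\<integral>\<^sup>+ z. g z \<partial>weight_measure \<nu>) = (\<integral>\<^sup>+ z. ennreal (\<nu> z) * g z \<partial>disc_area)"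
proof -
  have g: "g \<in> borel_measurable disc_area" by (rule borel_measurable_disc_area) simp
  have "(\<integral>\<^sup>+ z. g z \<partial>weight_measure \<nu>) = (\<integral>\<^sup>+ z. g z \<partial>density disc_area (\<lambda>z. ennreal (\<nu> z)))"
    unfolding weight_measure_def by (subst nn_integral_distr[OF measurable_id_weight]) auto
  also have "\<dots> = (\<integral>\<^sup>+ z. ennreal (\<nu> z) * g z \<partial>disc_area)"
    by (rule nn_integral_density[OF _ g]) measurable
  finally show ?thesis .
qed

lemma
  fixes g :: "complex \<Rightarrow> 'b::{banach, second_countable_topology}"
  assumes [measurable]: "g \<in> borel_measurable borel"
  shows integral_weight_measure: "(\<integral> z. g z \<partial>weight_measure \<nu>) = (\<integral> z. \<nu> z *\<^sub>R g z \<partial>disc_area)"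
    and integrable_weight_measure: "integrable (weight_measure \<nu>) g \<longleftrightarrow> integrable disc_area (\<lambda>z. \<nu> z *\<^sub>R g z)"
proof -
  have g: "g \<in> borel_measurable disc_area" by (rule borel_measurable_disc_area) simp
  have nn: "AE z in disc_area. 0 \<le> \<nu> z" using \<nu>(1) by (intro AE_I2) auto
  show "(\<integral> z. g z \<partial>weight_measure \<nu>) = (\<integral> z. \<nu> z *\<^sub>R g z \<partial>disc_area)"
    unfolding weight_measure_def
    using integral_distr[OF measurable_id_weight assms] integral_density[OF g \<nu>(3) nn] by simp
  show "integrable (weight_measure \<nu>) g \<longleftrightarrow> integrable disc_area (\<lambda>z. \<nu> z *\<^sub>R g z)"
    unfolding weight_measure_def
    using integrable_distr_eq[OF measurable_id_weight assms] integrable_density[OF g \<nu>(3) nn] by simp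
qed

text \<open>The weight is only Lebesgue measurable, and a Borel version of its density is rotation
  invariant only almost everywhere, with a null set depending on \<open>e\<close>. This suffices for
  the invariance of the measure under each rotation.\<close>

lemma weight_measure_density:
  obtains W where "W \<in> borel_measurable borel"
    "\<And>g. g \<in> borel_measurable borel \<Longrightarrow> (\<integral>\<^sup>+ z. g z \<partial>weight_measure \<nu>) = (\<integral>\<^sup>+ z. W z * g z \<partial>lborel)"
    "\<And>e. cmod e = 1 \<Longrightarrow> AE z in lborel. W (e * z) = W z"
proof -
  define U where "U z = ennreal (1 / pi) * ennreal (if z \<in> ball 0 1 then \<nu> z else 0)" for z
  have "(\<lambda>z. if z \<in> ball 0 1 then \<nu> z else 0) \<in> borel_measurable lebesgue"
    by (rule measurable_extend_lebesgue) measurable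
  then have U: "U \<in> borel_measurable (completion lborel)" unfolding U_def[abs_def] by measurable
  then obtain W where W[measurable]: "W \<in> borel_measurable lborel" and AE: "AE z in lborel. U z = W z"
    using completion_ex_borel_measurable by blast
  show thesis
  proof (rule that)
    show "W \<in> borel_measurable borel" using W by simp
    fix g :: "complex \<Rightarrow> ennreal" assume [measurable]: "g \<in> borel_measurable borel"
    have [measurable]: "g \<in> borel_measurable disc_area" by (rule borel_measurable_disc_area) simp
    have "(\<integral>\<^sup>+ z. g z \<partial>weight_measure \<nu>) = (\<integral>\<^sup>+ z. ennreal (1 / pi) * (ennreal (\<nu> z) * g z) * indicator (ball 0 1) z \<partial>lebesgue)"
      by (simp add: nn_integral_weight_measure nn_integral_disc_area)
    also have "\<dots> = (\<integral>\<^sup>+ z. U z * g z \<partial>lebesgue)"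
      by (intro nn_integral_cong) (auto simp: U_def indicator_def mult.assoc)
    also have "\<dots> = (\<integral>\<^sup>+ z. U z * g z \<partial>lborel)" by (rule nn_integral_completion)
    also have "\<dots> = (\<integral>\<^sup>+ z. W z * g z \<partial>lborel)"
      by (rule nn_integral_cong_AE) (use AE in eventually_elim, simp)
    finally show "(\<integral>\<^sup>+ z. g z \<partial>weight_measure \<nu>) = (\<integral>\<^sup>+ z. W z * g z \<partial>lborel)" .
  next
    fix e :: complex assume e: "cmod e = 1"
    have Ue: "U (e * z) = U z" for z
    proof (cases "cmod z < 1")
      case True
      then have "\<nu> (e * z) = \<nu> (of_real (cmod (e * z)))" using e by (intro \<nu>(4)) (simp add: norm_mult)
      also have "\<dots> = \<nu> z" using \<nu>(4)[OF True] e by (simp add: norm_mult)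
      finally show ?thesis using e by (simp add: U_def norm_mult)
    qed (use e in \<open>simp add: U_def norm_mult\<close>)
    have "AE z in distr lborel borel ((*) e). U z = W z"
      unfolding lborel_distr_rotation[OF e] by (rule AE)
    then have "AE z in lborel. U (e * z) = W (e * z)" by (rule AE_distrD[rotated]) simp
    with AE show "AE z in lborel. W (e * z) = W z"
      by eventually_elim (simp add: Ue)
  qed
qed

lemma weight_measure_rotation:
  assumes e: "cmod e = 1"
  shows "distr (weight_measure \<nu>) borel ((*) e) = weight_measure \<nu>"
proof (rule measure_eqI)
  show "sets (distr (weight_measure \<nu>) borel ((*) e)) = sets (weight_measure \<nu>)" by (simp add: weight_measure_def)
  have sets_wm[measurable_cong]: "sets (weight_measure \<nu>) = sets borel" by (simp add: weight_measure_def)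
  obtain W where [measurable]: "W \<in> borel_measurable borel" and
    W: "\<And>g. g \<in> borel_measurable borel \<Longrightarrow> (\<integral>\<^sup>+ z. g z \<partial>weight_measure \<nu>) = (\<integral>\<^sup>+ z. W z * g z \<partial>lborel)"
    and We: "AE z in lborel. W (e * z) = W z"
    using weight_measure_density e by metis
  fix A assume "A \<in> sets (distr (weight_measure \<nu>) borel ((*) e))"
  then have [measurable]: "A \<in> sets borel" by simp
  have "emeasure (distr (weight_measure \<nu>) borel ((*) e)) A = (\<integral>\<^sup>+ z. indicator A (e * z) \<partial>weight_measure \<nu>)"
    by (subst nn_integral_distr[of "(*) e" "weight_measure \<nu>" borel "indicator A", symmetric]) auto
  also have "\<dots> = (\<integral>\<^sup>+ z. W z * indicator A (e * z) \<partial>lborel)" by (rule W) measurable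
  also have "\<dots> = (\<integral>\<^sup>+ z. W (e * z) * indicator A (e * z) \<partial>lborel)"
    by (rule nn_integral_cong_AE) (use We in eventually_elim, simp)
  also have "\<dots> = (\<integral>\<^sup>+ z. W z * indicator A z \<partial>distr lborel borel ((*) e))"
    by (subst nn_integral_distr) auto
  also have "\<dots> = (\<integral>\<^sup>+ z. indicator A z \<partial>weight_measure \<nu>)"
    by (subst W) (auto simp: lborel_distr_rotation[OF e])
  also have "\<dots> = emeasure (weight_measure \<nu>) A" using sets_wm by simp
  finally show "emeasure (distr (weight_measure \<nu>) borel ((*) e)) A = emeasure (weight_measure \<nu>) A" .
qed

text \<open>
  The map \<open>z \<mapsto> (Im z, |z|)\<close> carries a null annular set onto a null set containing a product,
  which transfers the radial tail condition to area measure without polar coordinates.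
\<close>

lemma radial_null_set:
  assumes r: "0 < r" "r < 1" and ae: "AE z in lebesgue. r < cmod z \<and> cmod z < 1 \<longrightarrow> \<nu> z = 0"
  shows "AE s in lebesgue. r < s \<and> s < 1 \<longrightarrow> \<nu> (complex_of_real s) = 0"
proof -
  define Z where "Z = {z. r < cmod z \<and> cmod z < 1 \<and> \<nu> z \<noteq> 0}"
  define h where "h z = (Im z, cmod z)" for z
  have "AE z in lebesgue. z \<notin> Z" using ae by eventually_elim (auto simp: Z_def)
  then obtain Y where "{z \<in> space lebesgue. \<not> z \<notin> Z} \<subseteq> Y" "Y \<in> null_sets lebesgue"
    unfolding eventually_ae_filter by blast
  then have "negligible Z" using negligible_subset[of Y Z] by (auto simp: negligible_iff_null_sets)
  then have neg: "negligible (h ` Z)"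
  proof (rule negligible_differentiable_image_negligible[rotated])
    show "h differentiable_on Z"
      unfolding h_def differentiable_on_def
    proof (intro ballI differentiable_Pair)
      fix z assume "z \<in> Z"
      then have "z \<noteq> 0" using r by (auto simp: Z_def)
      then show "cmod differentiable at z within Z"
        by (rule differentiable_at_withinI[OF differentiable_norm_at])
      show "Im differentiable at z within Z"
        using bounded_linear_Im by (rule bounded_linear_imp_differentiable)
    qed
  qed simp
  have "h ` Z \<in> null_sets (completion (lborel \<Otimes>\<^sub>M lborel))"
    using neg by (simp add: negligible_iff_null_sets lborel_prod)
  then obtain N where N: "h ` Z \<subseteq> N" "N \<in> null_sets (lborel \<Otimes>\<^sub>M lborel :: (real \<times> real) measure)"
    by (auto simp: null_sets_completion_iff2)
  have "AE x in (lborel \<Otimes>\<^sub>M lborel :: (real \<times> real) measure). x \<notin> N" using N(2) by (rule AE_not_in)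
  then have "AE y in lborel. AE s in lborel. (y, s) \<notin> N" by (rule lborel_pair.AE_pair)
  moreover have "\<not> (AE y in lborel. y \<notin> {0<..<r})"
    using r by (subst AE_iff_null_sets[symmetric]) (auto simp: null_sets_def)
  \<comment> \<open>A generic height in (0, r): by Fubini almost every slice of the null set
    \<open>N\<close> is null, and the interval has positive length.\<close>
  ultimately obtain y where y: "y \<in> {0<..<r}" and s: "AE s in lborel. (y, s) \<notin> N"
    by (metis (mono_tags, lifting) eventually_mono)
  have "AE s in lborel. r < s \<and> s < 1 \<longrightarrow> \<nu> (complex_of_real s) = 0"
    using s
  proof eventually_elim
    case (elim s)
    show ?case
    proof (intro impI, rule ccontr)
      assume s: "r < s \<and> s < 1" and n: "\<nu> (complex_of_real s) \<noteq> 0"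
      \<comment> \<open>The point of the circle of radius s at height y, which exists because y < r
        < s. By radiality the weight is nonzero there too, so its image lies in
        \<open>N\<close>.\<close>
      define z where "z = Complex (sqrt (s\<^sup>2 - y\<^sup>2)) y"
      have "y\<^sup>2 \<le> s\<^sup>2" using y s by (intro power_mono) auto
      then have cz: "cmod z = s" using s r by (simp add: z_def cmod_def)
      then have "z \<in> Z" using s n \<nu>(4)[of z] by (simp add: Z_def)
      then have "h z \<in> N" using N(1) by blast
      then show False using elim cz by (simp add: h_def z_def)
    qed
  qed
  then show ?thesis by (rule AE_completion)
qed

lemma weight_measure_tail_pos:
  assumes r: "r < 1"
  shows "0 < emeasure (weight_measure \<nu>) {z. r \<le> cmod z}"
proof (rule ccontr)
  assume "\<not> ?thesis"
  then have "emeasure (weight_measure \<nu>) {z. r \<le> cmod z} = 0" by simp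
  also have "emeasure (weight_measure \<nu>) {z. r \<le> cmod z} = (\<integral>\<^sup>+ z. indicator {z. r \<le> cmod z} z \<partial>weight_measure \<nu>)"
    by (simp add: weight_measure_def)
  also have "\<dots> = (\<integral>\<^sup>+ z. ennreal (\<nu> z) * indicator {z. r \<le> cmod z} z \<partial>disc_area)"
    by (rule nn_integral_weight_measure) measurable
  finally have 0: "(\<integral>\<^sup>+ z. ennreal (\<nu> z) * indicator {z. r \<le> cmod z} z \<partial>disc_area) = 0" .
  have [measurable]: "(\<lambda>z. indicator {z. r \<le> cmod z} z :: ennreal) \<in> borel_measurable disc_area"
    by (rule borel_measurable_disc_area) measurable
  have "AE z in disc_area. ennreal (\<nu> z) * indicator {z. r \<le> cmod z} z = 0"
    using 0 by (subst (asm) nn_integral_0_iff_AE) auto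
  then have ae: "AE z in lebesgue. z \<in> ball 0 1 \<longrightarrow> ennreal (\<nu> z) * indicator {z. r \<le> cmod z} z = 0"
    by (simp only: AE_disc_area_iff)
  \<comment> \<open>\<open>radial_null_set\<close> works at a positive radius, since |z| is not
    differentiable at 0.\<close>
  define q where "q = max r (1 / 2)"
  have q: "0 < q" "q < 1" "r \<le> q" using r by (auto simp: q_def)
  have "AE z in lebesgue. q < cmod z \<and> cmod z < 1 \<longrightarrow> \<nu> z = 0"
    using ae
  proof eventually_elim
    case (elim z)
    then show ?case using q \<nu>(1)[of z] by (auto simp: indicator_def ennreal_eq_0_iff)
  qed
  then have "AE s in lebesgue. q < s \<and> s < 1 \<longrightarrow> \<nu> (complex_of_real s) = 0" by (rule radial_null_set[OF q(1,2)])
  then have "AE s in lebesgue. ennreal (\<nu> (complex_of_real s)) * indicator {q<..<1} s = 0"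
    by eventually_elim (auto simp: indicator_def)
  then have "(\<integral>\<^sup>+ s\<in>{q<..<1}. ennreal (\<nu> (complex_of_real s)) \<partial>lebesgue) = (\<integral>\<^sup>+ s. 0 \<partial>(lebesgue :: real measure))"
    by (rule nn_integral_cong_AE)
  then show False using \<nu>(5)[of "complex_of_real q"] q by simp
qed

lemma weight_radial_measure: "radial_measure (weight_measure \<nu>)"
proof (rule radial_measure.intro)
  have "emeasure (weight_measure \<nu>) (space (weight_measure \<nu>)) = (\<integral>\<^sup>+ z. 1 \<partial>weight_measure \<nu>)"
    by (simp only: nn_integral_const mult_1)
  also have "\<dots> = (\<integral>\<^sup>+ z. ennreal (\<nu> z) * 1 \<partial>disc_area)" by (rule nn_integral_weight_measure) simp
  also have "\<dots> < \<infinity>"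
  proof -
    have "(\<integral>\<^sup>+ z. ennreal (\<nu> z) * 1 \<partial>disc_area) = (\<integral>\<^sup>+ z. ennreal (norm (\<nu> z)) \<partial>disc_area)"
      using \<nu>(1) by (intro nn_integral_cong) auto
    then show ?thesis using \<nu>(2) by (simp add: integrable_iff_bounded)
  qed
  finally show fin: "finite_measure (weight_measure \<nu>)" by (intro finite_measureI) simp
  show "radial_measure_axioms (weight_measure \<nu>)"
  proof (rule radial_measure_axioms.intro)
    show "sets (weight_measure \<nu>) = sets borel" by (simp add: weight_measure_def)
    show "distr (weight_measure \<nu>) borel ((*) e) = weight_measure \<nu>" if "cmod e = 1" for e
      by (rule weight_measure_rotation[OF that])
    show "AE z in weight_measure \<nu>. cmod z < 1"
      unfolding weight_measure_def
    proof (subst AE_distr_iff[OF measurable_id_weight])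
      show "AE z in density disc_area (\<lambda>z. ennreal (\<nu> z)). cmod z < 1" by (rule AE_I2) simp
    qed simp
    fix r :: real assume "r < 1"
    from weight_measure_tail_pos[OF this]
    show "0 < measure (weight_measure \<nu>) {z. r \<le> cmod z}"
      using finite_measure.emeasure_eq_measure[OF fin] by simp
  qed
qed

end

section \<open>Borel versions and the transfer to the weighted function spaces\<close>

lemma ex_borel_version:
  assumes "f \<in> borel_measurable disc_area"
  obtains f' :: "complex \<Rightarrow> complex" where "f' \<in> borel_measurable borel"
    "\<forall>z. 1 \<le> cmod z \<longrightarrow> f' z = 0" "AE z in disc_area. f z = f' z"
proof -
  have "(\<lambda>z. if z \<in> ball 0 1 then f z else 0) \<in> borel_measurable (completion lborel)"
    by (rule measurable_extend_lebesgue[OF assms])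
  then have m: "(\<lambda>z. Re (if z \<in> ball 0 1 then f z else 0)) \<in> borel_measurable (completion lborel)"
    "(\<lambda>z. Im (if z \<in> ball 0 1 then f z else 0)) \<in> borel_measurable (completion lborel)"
    by (auto simp only: borel_measurable_complex_iff)
  obtain a where [measurable]: "a \<in> borel_measurable lborel" and a: "AE z in lborel. Re (if z \<in> ball 0 1 then f z else 0) = a z"
    using completion_ex_borel_measurable_real[OF m(1)] by blast
  obtain b where [measurable]: "b \<in> borel_measurable lborel" and b: "AE z in lborel. Im (if z \<in> ball 0 1 then f z else 0) = b z"
    using completion_ex_borel_measurable_real[OF m(2)] by blast
  define f' where "f' z = (if cmod z < 1 then Complex (a z) (b z) else 0)" for z
  have "f' \<in> borel_measurable lborel" unfolding f'_def[abs_def] Complex_eq by measurable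
  then have 1: "f' \<in> borel_measurable borel" by simp
  have "AE z in lborel. z \<in> ball 0 1 \<longrightarrow> f z = f' z"
    using a b by eventually_elim (auto simp: f'_def complex_eq_iff)
  then have 2: "AE z in disc_area. f z = f' z"
    unfolding AE_disc_area_iff by (rule AE_completion)
  show thesis using that[OF 1 _ 2] by (simp add: f'_def)
qed

context
  fixes \<nu> :: "complex \<Rightarrow> real"
  assumes rw: "radial_weight \<nu>"
begin

interpretation W: radial_measure "weight_measure \<nu>"
  by (rule weight_radial_measure[OF rw])

lemmas \<nu>' = radial_weightD[OF rw]
lemmas [measurable] = radial_weightD(3)[OF rw]

lemma nn_integral_weight_eq:
  assumes [measurable]: "H \<in> borel_measurable disc_area" "g \<in> borel_measurable borel"
    and AE: "AE z in disc_area. H z = g z" and nn: "\<And>z. cmod z < 1 \<Longrightarrow> 0 \<le> H z"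
  shows "(\<integral>\<^sup>+ z. ennreal (g z) \<partial>weight_measure \<nu>) = (\<integral>\<^sup>+ z. ennreal (H z * \<nu> z) \<partial>disc_area)"
proof -
  have "(\<integral>\<^sup>+ z. ennreal (g z) \<partial>weight_measure \<nu>) = (\<integral>\<^sup>+ z. ennreal (\<nu> z) * ennreal (g z) \<partial>disc_area)"
    by (rule nn_integral_weight_measure[OF rw]) measurable
  also have "\<dots> = (\<integral>\<^sup>+ z. ennreal (H z * \<nu> z) \<partial>disc_area)"
  proof (rule nn_integral_cong_AE)
    show "AE z in disc_area. ennreal (\<nu> z) * ennreal (g z) = ennreal (H z * \<nu> z)"
      using AE AE_space[of disc_area]
    proof eventually_elim
      case (elim z)
      then show ?case using \<nu>'(1)[of z] nn[of z] by (simp add: ennreal_mult' mult.commute)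
    qed
  qed
  finally show ?thesis .
qed

lemma integral_weight_nonneg:
  assumes [measurable]: "H \<in> borel_measurable disc_area" and nn: "\<And>z. cmod z < 1 \<Longrightarrow> 0 \<le> H z"
  shows "(\<integral>\<^sup>+ z. ennreal (H z * \<nu> z) \<partial>disc_area) < \<infinity> \<longleftrightarrow> integrable disc_area (\<lambda>z. H z * \<nu> z)"
    and "integrable disc_area (\<lambda>z. H z * \<nu> z) \<Longrightarrow>
      (\<integral>\<^sup>+ z. ennreal (H z * \<nu> z) \<partial>disc_area) = ennreal (LINT z|disc_area. H z * \<nu> z)"
    and "0 \<le> (LINT z|disc_area. H z * \<nu> z)"
proof -
  have n: "0 \<le> H z * \<nu> z" if "z \<in> space disc_area" for z using that nn \<nu>'(1) by simp
  have "(\<integral>\<^sup>+ z. ennreal (H z * \<nu> z) \<partial>disc_area) = (\<integral>\<^sup>+ z. ennreal (norm (H z * \<nu> z)) \<partial>disc_area)"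
    using n by (intro nn_integral_cong) simp
  then show "(\<integral>\<^sup>+ z. ennreal (H z * \<nu> z) \<partial>disc_area) < \<infinity> \<longleftrightarrow> integrable disc_area (\<lambda>z. H z * \<nu> z)"
    by (simp add: integrable_iff_bounded)
  show "integrable disc_area (\<lambda>z. H z * \<nu> z) \<Longrightarrow>
      (\<integral>\<^sup>+ z. ennreal (H z * \<nu> z) \<partial>disc_area) = ennreal (LINT z|disc_area. H z * \<nu> z)"
    using n by (intro nn_integral_eq_integral AE_I2)
  show "0 \<le> (LINT z|disc_area. H z * \<nu> z)" using n by (intro integral_nonneg_AE AE_I2)
qed

lemma Lp_disc_borel_version:
  assumes f: "f \<in> Lp_space p \<nu>" and f': "f' \<in> borel_measurable borel" "\<forall>z. 1 \<le> cmod z \<longrightarrow> f' z = 0"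
    and AE: "AE z in disc_area. f z = f' z"
  shows "W.Lp_disc p f'"
    and "(\<integral>\<^sup>+ z. ennreal (cmod (f' z) powr p) \<partial>weight_measure \<nu>) = ennreal (LINT z|disc_area. cmod (f z) powr p * \<nu> z)"
proof -
  have [measurable]: "f \<in> borel_measurable disc_area" and int: "integrable disc_area (\<lambda>z. cmod (f z) powr p * \<nu> z)"
    using f by (auto simp: Lp_space_def)
  have "(\<integral>\<^sup>+ z. ennreal (cmod (f' z) powr p) \<partial>weight_measure \<nu>) = (\<integral>\<^sup>+ z. ennreal (cmod (f z) powr p * \<nu> z) \<partial>disc_area)"
    using f'(1) by (intro nn_integral_weight_eq) (measurable, use AE in \<open>auto elim: eventually_mono\<close>)
  also have "\<dots> = ennreal (LINT z|disc_area. cmod (f z) powr p * \<nu> z)"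
    using int by (intro integral_weight_nonneg) auto
  finally show eq: "(\<integral>\<^sup>+ z. ennreal (cmod (f' z) powr p) \<partial>weight_measure \<nu>) = ennreal (LINT z|disc_area. cmod (f z) powr p * \<nu> z)" .
  show "W.Lp_disc p f'" unfolding W.Lp_disc_def using f' eq by simp
qed

lemma bergman_Lp_disc:
  assumes F: "F \<in> bergman_space p \<nu>"
  shows "W.Lp_disc p (\<lambda>z. if cmod z < 1 then F z else 0)" "F holomorphic_on ball 0 1"
proof -
  show hol: "F holomorphic_on ball 0 1" using F by (simp add: bergman_space_def)
  have "AE z in disc_area. F z = (if cmod z < 1 then F z else 0)" by (rule AE_I2) simp
  then show "W.Lp_disc p (\<lambda>z. if cmod z < 1 then F z else 0)"
    using F by (intro Lp_disc_borel_version(1)[of F] measurable_extend_by_zero hol) (auto simp: bergman_space_def)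
qed

lemma bounded_in_Lp_space:
  assumes m: "g \<in> borel_measurable disc_area" and K: "\<And>z. cmod z < 1 \<Longrightarrow> cmod (g z) \<le> K" and p: "0 < p"
  shows "g \<in> Lp_space p \<nu>"
proof -
  note m[measurable]
  have "integrable disc_area (\<lambda>z. cmod (g z) powr p * \<nu> z)"
  proof (rule Bochner_Integration.integrable_bound)
    show "integrable disc_area (\<lambda>z. K powr p * \<nu> z)" using \<nu>'(2) by simp
    show "AE z in disc_area. norm (cmod (g z) powr p * \<nu> z) \<le> norm (K powr p * \<nu> z)"
      using K p by (intro AE_I2) (auto simp: abs_mult intro!: mult_right_mono powr_mono2)
  qed measurable
  then show ?thesis using m by (simp add: Lp_space_def)
qed

lemma monomial_in_bergman_space: "0 < p \<Longrightarrow> (\<lambda>z. z ^ n) \<in> bergman_space p \<nu>"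
  unfolding bergman_space_def
  by (intro IntI CollectI bounded_in_Lp_space[where K=1] borel_measurable_disc_area holomorphic_intros)
     (auto simp: norm_power power_le_one)

lemma integral_bergman_pairing:
  assumes [measurable]: "h \<in> borel_measurable borel" and g: "\<And>\<zeta>. cmod \<zeta> < 1 \<Longrightarrow> f \<zeta> * cnj (B \<zeta>) = h \<zeta>"
  shows "(LINT \<zeta>|disc_area. f \<zeta> * cnj (B \<zeta>) * complex_of_real (\<nu> \<zeta>)) = (\<integral> \<zeta>. h \<zeta> \<partial>weight_measure \<nu>)"
  unfolding integral_weight_measure[OF rw assms(1)]
  using g by (intro Bochner_Integration.integral_cong) (auto simp: scaleR_conv_of_real mult.commute)

text \<open>The witness that gives the choice in \<open>bergman_kernel\<close> its meaning. For |z|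
  < 1 it is bounded on the disc, hence square integrable, and it reproduces because
  \<open>W.proj\<close> does.\<close>

lemma ex_reproducing_kernel:
  assumes z: "cmod z < 1"
  shows "is_reproducing_kernel \<nu> z (\<lambda>w. W.kern (cnj z * w))"
  unfolding is_reproducing_kernel_def
proof (intro conjI ballI)
  have lt: "cmod (cnj z * w) \<le> cmod z" if "cmod w < 1" for w
    using that by (simp add: norm_mult mult_left_le)
  have "(\<lambda>w. W.kern (cnj z * w)) holomorphic_on ball 0 1"
    using lt z by (intro holomorphic_on_compose_gen[OF _ W.kern_holomorphic, unfolded o_def] holomorphic_intros) force
  moreover have "(\<lambda>w. W.kern (cnj z * w)) \<in> Lp_space 2 \<nu>"
    by (rule bounded_in_Lp_space[OF borel_measurable_disc_area])
       (measurable, rule W.norm_kern_le[OF lt z], auto)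
  ultimately show "(\<lambda>w. W.kern (cnj z * w)) \<in> bergman_space 2 \<nu>" by (simp add: bergman_space_def)
  fix F assume F: "F \<in> bergman_space 2 \<nu>"
  note F' = bergman_Lp_disc[OF F]
  define f where "f \<zeta> = (if cmod \<zeta> < 1 then F \<zeta> else 0)" for \<zeta>
  have [measurable]: "f \<in> borel_measurable borel" unfolding f_def[abs_def] by (rule measurable_extend_by_zero[OF F'(2)])
  have "F z = W.proj f z"
    unfolding f_def[abs_def] by (rule W.proj_reproduces[OF F'(2,1) _ z, symmetric]) simp
  also have "\<dots> = (LINT \<zeta>|disc_area. F \<zeta> * cnj (W.kern (cnj z * \<zeta>)) * complex_of_real (\<nu> \<zeta>))"
    unfolding W.proj_def
  proof (rule integral_bergman_pairing[symmetric])
    fix \<zeta> :: complex assume "cmod \<zeta> < 1"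
    then show "F \<zeta> * cnj (W.kern (cnj z * \<zeta>)) = f \<zeta> * W.kern (z * cnj \<zeta>)"
      using W.cnj_kern[of "cnj z * \<zeta>"] lt[of \<zeta>] z by (simp add: f_def)
  qed measurable
  finally show "F z = (LINT \<zeta>|disc_area. F \<zeta> * cnj (W.kern (cnj z * \<zeta>)) * complex_of_real (\<nu> \<zeta>))" .
qed

lemma bergman_kernel_reproducing:
  "cmod z < 1 \<Longrightarrow> is_reproducing_kernel \<nu> z (bergman_kernel \<nu> z)"
  unfolding bergman_kernel_def by (rule someI[of "is_reproducing_kernel \<nu> z"], rule ex_reproducing_kernel)

text \<open>Monomials lie in A^2 of every radial weight and are therefore reproduced. Applied to
  \<omega>, this turns the hypothesis of the theorem into an inequality about \<nu> alone.\<close>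

lemma bergman_proj_monomial:
  "cmod z < 1 \<Longrightarrow> bergman_proj \<nu> (\<lambda>\<zeta>. \<zeta> ^ n) z = z ^ n"
  using bergman_kernel_reproducing[of z] monomial_in_bergman_space[of 2 n]
  unfolding is_reproducing_kernel_def bergman_proj_def by fastforce

text \<open>Testing a reproducing kernel on monomials prescribes all its Taylor coefficients, so
  whichever kernel the choice operator selects is the explicit series inside the disc.\<close>

lemma bergman_kernel_eq:
  assumes z: "cmod z < 1" and w: "cmod w < 1"
  shows "bergman_kernel \<nu> z w = W.kern (cnj z * w)"
proof -
  define B where "B = bergman_kernel \<nu> z"
  have rep: "is_reproducing_kernel \<nu> z B" unfolding B_def by (rule bergman_kernel_reproducing[OF z])
  then have Bs: "B \<in> bergman_space 2 \<nu>" by (simp add: is_reproducing_kernel_def)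
  note B' = bergman_Lp_disc[OF Bs]
  define b where "b \<zeta> = (if cmod \<zeta> < 1 then B \<zeta> else 0)" for \<zeta>
  have [measurable]: "b \<in> borel_measurable borel" unfolding b_def[abs_def] by (rule measurable_extend_by_zero[OF B'(2)])
  have coeff: "(deriv ^^ n) B 0 / fact n * of_real (W.moment n) = cnj z ^ n" for n
  proof -
    have "z ^ n = (LINT \<zeta>|disc_area. \<zeta> ^ n * cnj (B \<zeta>) * complex_of_real (\<nu> \<zeta>))"
      using rep monomial_in_bergman_space[of 2 n] by (auto simp: is_reproducing_kernel_def)
    also have "\<dots> = (\<integral> \<zeta>. cnj (b \<zeta> * cnj \<zeta> ^ n) \<partial>weight_measure \<nu>)"
      by (rule integral_bergman_pairing) (measurable, simp add: b_def)
    also have "\<dots> = cnj (\<integral> \<zeta>. b \<zeta> * cnj \<zeta> ^ n \<partial>weight_measure \<nu>)" by (rule Bochner_Integration.integral_cnj)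
    also have "(\<integral> \<zeta>. b \<zeta> * cnj \<zeta> ^ n \<partial>weight_measure \<nu>) = (deriv ^^ n) B 0 / fact n * of_real (W.moment n)"
      unfolding b_def[abs_def] by (rule W.integral_coeff_pairing[OF B'(2) W.integrable_Lp_disc[OF B'(1)]]) simp
    finally have "cnj (z ^ n) = cnj (cnj ((deriv ^^ n) B 0 / fact n * of_real (W.moment n)))" by (rule arg_cong)
    then show ?thesis by simp
  qed
  show ?thesis using W.kern_eq_if_coeffs[OF B'(2) z coeff w] by (simp add: B_def)
qed

lemma bergman_proj_eq:
  assumes f: "f \<in> Lp_space p \<nu>" and p: "1 \<le> p" and f': "f' \<in> borel_measurable borel" "\<forall>z. 1 \<le> cmod z \<longrightarrow> f' z = 0"
    and AE: "AE z in disc_area. f z = f' z" and z: "cmod z < 1"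
  shows "integrable disc_area (\<lambda>\<zeta>. f \<zeta> * cnj (bergman_kernel \<nu> z \<zeta>) * complex_of_real (\<nu> \<zeta>))"
    and "bergman_proj \<nu> f z = W.proj f' z"
proof -
  have [measurable]: "f \<in> borel_measurable disc_area" using f by (simp add: Lp_space_def)
  note [measurable] = f'(1)
  define h where "h \<zeta> = W.kern (z * cnj \<zeta>)" for \<zeta>
  have hb[measurable]: "h \<in> borel_measurable borel" unfolding h_def[abs_def] by measurable
  have [measurable]: "h \<in> borel_measurable disc_area" "f' \<in> borel_measurable disc_area"
    by (auto intro: borel_measurable_disc_area)
  have eq: "f \<zeta> * cnj (bergman_kernel \<nu> z \<zeta>) * complex_of_real (\<nu> \<zeta>) = f \<zeta> * h \<zeta> * complex_of_real (\<nu> \<zeta>)"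
    if "\<zeta> \<in> space disc_area" for \<zeta>
  proof -
    have "cmod z * cmod \<zeta> \<le> cmod z * 1" using that by (intro mult_left_mono) auto
    then have "cmod (cnj z * \<zeta>) < 1" using z by (simp add: norm_mult)
    then have "cnj (W.kern (cnj z * \<zeta>)) = h \<zeta>" using W.cnj_kern[of "cnj z * \<zeta>"] by (simp add: h_def)
    then show ?thesis using that z by (simp add: bergman_kernel_eq)
  qed
  have ae: "AE \<zeta> in disc_area. f \<zeta> * h \<zeta> * complex_of_real (\<nu> \<zeta>) = \<nu> \<zeta> *\<^sub>R (f' \<zeta> * h \<zeta>)"
    using AE by eventually_elim (simp add: scaleR_conv_of_real)
  have "integrable (weight_measure \<nu>) (\<lambda>\<zeta>. f' \<zeta> * h \<zeta>)"
    unfolding h_def by (rule W.integrable_proj[OF Lp_disc_borel_version(1)[OF f f' AE] p z])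
  then have "integrable disc_area (\<lambda>\<zeta>. \<nu> \<zeta> *\<^sub>R (f' \<zeta> * h \<zeta>))"
    by (subst (asm) integrable_weight_measure[OF rw]) measurable
  then have "integrable disc_area (\<lambda>\<zeta>. f \<zeta> * h \<zeta> * complex_of_real (\<nu> \<zeta>))"
    using ae by (subst integrable_cong_AE) auto
  then show "integrable disc_area (\<lambda>\<zeta>. f \<zeta> * cnj (bergman_kernel \<nu> z \<zeta>) * complex_of_real (\<nu> \<zeta>))"
    using eq by (subst Bochner_Integration.integrable_cong[OF refl]) auto
  have "bergman_proj \<nu> f z = (\<integral> \<zeta>. f \<zeta> * h \<zeta> * complex_of_real (\<nu> \<zeta>) \<partial>disc_area)"
    unfolding bergman_proj_def by (rule Bochner_Integration.integral_cong[OF refl eq])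
  also have "\<dots> = (\<integral> \<zeta>. \<nu> \<zeta> *\<^sub>R (f' \<zeta> * h \<zeta>) \<partial>disc_area)"
    using ae by (intro integral_cong_AE) auto
  also have "\<dots> = W.proj f' z"
    unfolding W.proj_def h_def[symmetric] by (rule integral_weight_measure[OF rw, symmetric]) measurable
  finally show "bergman_proj \<nu> f z = W.proj f' z" .
qed

lemma powr_inverse_le:
  fixes a b C p :: real
  assumes "0 < p" "0 \<le> a" "0 \<le> b" "0 \<le> C" "a \<le> C * b"
  shows "a powr (1 / p) \<le> C powr (1 / p) * b powr (1 / p)"
proof -
  have "a powr (1 / p) \<le> (C * b) powr (1 / p)" using assms by (intro powr_mono2) auto
  then show ?thesis using assms by (simp add: powr_mult)
qed

text \<open>The bounds for \<open>W.proj\<close> are inequalities between extended integrals, so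
  they give membership in the target space and the norm estimate at once. They are applied to a
  Borel version of \<open>f\<close> that vanishes off the disc.\<close>

lemma bergman_proj_bounded_if_doubling:
  assumes p: "1 < p"
    and D: "1 \<le> D" "\<And>r. 0 \<le> r \<Longrightarrow> r < 1 \<Longrightarrow> W.tail r \<le> D * W.tail ((1 + r) / 2)"
  shows "bergman_proj_bounded \<nu> (Lp_space p \<nu>) (Lp_norm p \<nu>) (dirichlet_space p \<nu> k) (dirichlet_norm p \<nu> k)"
    and "bergman_proj_bounded \<nu> (Lp_space p \<nu>) (Lp_norm p \<nu>) (Lp_space p \<nu>) (Lp_norm p \<nu>)"
proof -
  interpret W: doubling_measure "weight_measure \<nu>" D
    by unfold_locales (use D in auto)
  have p0: "0 < p" "1 \<le> p" using p by auto
  obtain C where C: "C > 0" and Lp: "\<And>f. W.Lp_disc p f \<Longrightarrow>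
      (\<integral>\<^sup>+ z. ennreal (cmod (W.proj f z) powr p) \<partial>weight_measure \<nu>) \<le> ennreal C * (\<integral>\<^sup>+ z. ennreal (cmod (f z) powr p) \<partial>weight_measure \<nu>)"
    by (rule W.proj_Lp_bounded[OF p]) (rule that)
  obtain E where E: "E > 0" and Dir: "\<And>f. W.Lp_disc p f \<Longrightarrow>
      (\<Sum>j<k. ennreal (cmod ((deriv ^^ j) (W.proj f) 0) powr p)) +
      (\<integral>\<^sup>+ z. ennreal (cmod (if cmod z < 1 then (deriv ^^ k) (W.proj f) z else 0) powr p * (1 - cmod z) powr (real k * p)) \<partial>weight_measure \<nu>)
      \<le> ennreal E * (\<integral>\<^sup>+ z. ennreal (cmod (f z) powr p) \<partial>weight_measure \<nu>)"
    by (rule W.proj_Dirichlet_bounded[OF p]) (rule that)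
  have main: "(\<forall>z\<in>unit_disc. integrable disc_area (\<lambda>\<zeta>. f \<zeta> * cnj (bergman_kernel \<nu> z \<zeta>) * complex_of_real (\<nu> \<zeta>))) \<and>
      bergman_proj \<nu> f \<in> Lp_space p \<nu> \<and> Lp_norm p \<nu> (bergman_proj \<nu> f) \<le> C powr (1 / p) * Lp_norm p \<nu> f \<and>
      bergman_proj \<nu> f \<in> dirichlet_space p \<nu> k \<and> dirichlet_norm p \<nu> k (bergman_proj \<nu> f) \<le> E powr (1 / p) * Lp_norm p \<nu> f"
    if f: "f \<in> Lp_space p \<nu>" for f
  proof -
    have fm[measurable]: "f \<in> borel_measurable disc_area" using f by (simp add: Lp_space_def)
    obtain f' where f': "f' \<in> borel_measurable borel" "\<forall>z. 1 \<le> cmod z \<longrightarrow> f' z = 0" "AE z in disc_area. f z = f' z"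
      using ex_borel_version[OF fm] by metis
    note eqs = bergman_proj_eq[OF f p0(2) f']
    note Ld = Lp_disc_borel_version[OF f f']
    define I where "I = (LINT z|disc_area. cmod (f z) powr p * \<nu> z)"
    have I0: "0 \<le> I" unfolding I_def by (rule integral_weight_nonneg) auto
    have nnI: "(\<integral>\<^sup>+ z. ennreal (cmod (f' z) powr p) \<partial>weight_measure \<nu>) = ennreal I" unfolding I_def by (rule Ld(2))
    define F where "F = W.proj f'"
    define P where "P = bergman_proj \<nu> f"
    have PF: "P z = F z" if "cmod z < 1" for z unfolding P_def F_def by (rule eqs(2)[OF that])
    have holF: "F holomorphic_on ball 0 1" unfolding F_def by (rule W.proj_holomorphic[OF Ld(1) p0(2)])
    have [measurable]: "F \<in> borel_measurable borel" unfolding F_def by (rule W.measurable_proj[OF f'(1)])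
    have Fd[measurable]: "F \<in> borel_measurable disc_area" by (rule borel_measurable_disc_area) simp
    have Pm[measurable]: "P \<in> borel_measurable disc_area"
      using Fd by (rule measurable_cong[THEN iffD1, rotated]) (simp add: PF)
    have holP: "P holomorphic_on ball 0 1" using holF by (rule holomorphic_transform) (simp add: PF)
    \<comment> \<open>Off the disc \<open>P\<close> and \<open>F\<close> may differ, since
      \<open>bergman_kernel\<close> is arbitrary there; they agree on the open disc, hence so do
      their derivatives in it.\<close>
    have dPF: "(deriv ^^ j) P z = (deriv ^^ j) F z" if "cmod z < 1" for j z
    proof (rule higher_deriv_cong_ev)
      have "\<forall>\<^sub>F w in nhds z. w \<in> ball 0 1" using that by (intro eventually_nhds_in_open) auto
      then show "\<forall>\<^sub>F w in nhds z. P w = F w" by eventually_elim (simp add: PF)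
    qed auto
    have "(\<integral>\<^sup>+ z. ennreal (cmod (F z) powr p) \<partial>weight_measure \<nu>) = (\<integral>\<^sup>+ z. ennreal (cmod (P z) powr p * \<nu> z) \<partial>disc_area)"
      by (rule nn_integral_weight_eq) (measurable, auto simp: PF intro!: AE_I2)
    then have leP: "(\<integral>\<^sup>+ z. ennreal (cmod (P z) powr p * \<nu> z) \<partial>disc_area) \<le> ennreal (C * I)"
      using Lp[OF Ld(1)] C by (simp add: F_def nnI ennreal_mult')
    then have intP: "integrable disc_area (\<lambda>z. cmod (P z) powr p * \<nu> z)"
      by (subst integral_weight_nonneg(1)[symmetric]) (auto intro: le_less_trans)
    have LP: "(LINT z|disc_area. cmod (P z) powr p * \<nu> z) \<le> C * I"
      using leP I0 C by (subst (asm) integral_weight_nonneg(2)[OF _ _ intP]) auto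
    have LP0: "0 \<le> (LINT z|disc_area. cmod (P z) powr p * \<nu> z)" by (rule integral_weight_nonneg) auto
    define G where "G z = (if cmod z < 1 then (deriv ^^ k) F z else 0)" for z
    have [measurable]: "G \<in> borel_measurable borel"
      unfolding G_def[abs_def] by (intro measurable_extend_by_zero holomorphic_higher_deriv holF) simp
    have Gd: "G \<in> borel_measurable disc_area" by (rule borel_measurable_disc_area) simp
    define H where "H z = cmod ((deriv ^^ k) P z) powr p * (1 - cmod z) powr (real k * p)" for z
    have HG: "H z = cmod (G z) powr p * (1 - cmod z) powr (real k * p)" if "cmod z < 1" for z
      using that by (simp add: H_def G_def dPF)
    have HGm: "(\<lambda>z. cmod (G z) powr p * (1 - cmod z) powr (real k * p)) \<in> borel_measurable disc_area"
      by (rule borel_measurable_disc_area) measurable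
    have Hm[measurable]: "H \<in> borel_measurable disc_area"
      using HGm by (rule measurable_cong[THEN iffD1, rotated]) (simp add: HG)
    have H0: "0 \<le> H z" for z by (simp add: H_def)
    define S where "S = (\<Sum>j<k. cmod ((deriv ^^ j) P 0) powr p)"
    have S0: "0 \<le> S" by (simp add: S_def sum_nonneg)
    have eqH: "(\<integral>\<^sup>+ z. ennreal (cmod (G z) powr p * (1 - cmod z) powr (real k * p)) \<partial>weight_measure \<nu>) = (\<integral>\<^sup>+ z. ennreal (H z * \<nu> z) \<partial>disc_area)"
      by (rule nn_integral_weight_eq[OF Hm]) (measurable, auto simp: HG H0 intro!: AE_I2)
    have eqS: "(\<Sum>j<k. ennreal (cmod ((deriv ^^ j) F 0) powr p)) = ennreal S"
      by (simp add: S_def dPF)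
    have "(\<Sum>j<k. ennreal (cmod ((deriv ^^ j) F 0) powr p)) +
        (\<integral>\<^sup>+ z. ennreal (cmod (G z) powr p * (1 - cmod z) powr (real k * p)) \<partial>weight_measure \<nu>) \<le> ennreal E * ennreal I"
      using Dir[OF Ld(1)] unfolding G_def F_def nnI .
    then have leD: "ennreal S + (\<integral>\<^sup>+ z. ennreal (H z * \<nu> z) \<partial>disc_area) \<le> ennreal (E * I)"
      unfolding eqH eqS using E by (simp add: ennreal_mult')
    then have "(\<integral>\<^sup>+ z. ennreal (H z * \<nu> z) \<partial>disc_area) \<le> ennreal (E * I)"
      by (rule order_trans[rotated]) simp
    then have intH: "integrable disc_area (\<lambda>z. H z * \<nu> z)"
      by (subst integral_weight_nonneg(1)[symmetric]) (auto simp: H0 intro: le_less_trans)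
    have LH0: "0 \<le> (LINT z|disc_area. H z * \<nu> z)" by (rule integral_weight_nonneg) (auto simp: H0)
    have "ennreal (S + (LINT z|disc_area. H z * \<nu> z)) \<le> ennreal (E * I)"
      using leD LH0 S0 integral_weight_nonneg(2)[OF Hm H0 intH] by simp
    then have LH: "S + (LINT z|disc_area. H z * \<nu> z) \<le> E * I" using E I0 by simp
    have norm1: "Lp_norm p \<nu> P \<le> C powr (1 / p) * Lp_norm p \<nu> f"
      unfolding Lp_norm_def I_def[symmetric] using p0 LP LP0 I0 C by (intro powr_inverse_le) auto
    have norm2: "dirichlet_norm p \<nu> k P \<le> E powr (1 / p) * Lp_norm p \<nu> f"
      unfolding Lp_norm_def dirichlet_norm_def I_def[symmetric] S_def[symmetric] H_def[symmetric]
      using p0 LH LH0 S0 I0 E by (intro powr_inverse_le) auto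
    have mem: "P \<in> Lp_space p \<nu>" "P \<in> dirichlet_space p \<nu> k"
      using Pm intP holP intH by (auto simp: Lp_space_def dirichlet_space_def H_def)
    show ?thesis using eqs(1) mem norm1 norm2 by (auto simp: P_def)
  qed
  show "bergman_proj_bounded \<nu> (Lp_space p \<nu>) (Lp_norm p \<nu>) (dirichlet_space p \<nu> k) (dirichlet_norm p \<nu> k)"
    "bergman_proj_bounded \<nu> (Lp_space p \<nu>) (Lp_norm p \<nu>) (Lp_space p \<nu>) (Lp_norm p \<nu>)"
    unfolding bergman_proj_bounded_def using main by blast+
qed

end

section \<open>From boundedness on monomials to doubling\<close>

lemma power_le_pochhammer: "(m::nat) ^ k \<le> pochhammer m k"
proof (induction k)
  case (Suc k)
  have "m ^ k * m \<le> pochhammer m k * (m + k)" by (intro mult_mono Suc.IH) auto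
  then show ?case by (simp add: pochhammer_Suc mult.commute)
qed simp

text \<open>The derivative carries the factor n (n - 1) ... (n - k + 1), each term of which is at
  least n - k + 1 \<ge> n / k; for n = k + d the last inequality says d \<le> k d.\<close>

lemma norm_higher_deriv_power_ge:
  assumes k: "1 \<le> k" "k \<le> n"
  shows "(real n / real k) ^ k * cmod z ^ (n - k) \<le> cmod ((deriv ^^ k) (\<lambda>w. w ^ n) z)"
proof -
  obtain d where d: "n = k + d" using k le_Suc_ex by blast
  have "1 * real d \<le> real k * real d" using k by (intro mult_right_mono) auto
  then have "real n / real k \<le> real (Suc n - k)" using k by (simp add: d field_simps)
  then have "(real n / real k) ^ k \<le> real (Suc n - k) ^ k" by (intro power_mono) auto
  also have "\<dots> \<le> real (pochhammer (Suc n - k) k)"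
    using power_le_pochhammer[of "Suc n - k" k] by (metis of_nat_le_iff of_nat_power)
  finally have "(real n / real k) ^ k * cmod z ^ (n - k) \<le> real (pochhammer (Suc n - k) k) * cmod z ^ (n - k)"
    by (intro mult_right_mono) auto
  also have "\<dots> = cmod (pochhammer (of_nat (Suc n - k)) k * z ^ (n - k))"
    by (simp only: pochhammer_of_nat norm_mult norm_power norm_of_nat)
  also have "pochhammer (of_nat (Suc n - k)) k * z ^ (n - k) = (deriv ^^ k) (\<lambda>w. w ^ n) z"
    using higher_deriv_power[of k 0 n z] by simp
  finally show ?thesis .
qed

lemma doubling_if_bergman_proj_bounded:
  assumes p: "1 < p" and k: "1 \<le> k" and \<omega>: "radial_weight \<omega>" and rw: "radial_weight \<nu>"
    and bounded: "bergman_proj_bounded \<omega> (Lp_space p \<nu>) (Lp_norm p \<nu>) (dirichlet_space p \<nu> k) (dirichlet_norm p \<nu> k)"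
  obtains D where "1 \<le> D"
    "\<And>r. 0 \<le> r \<Longrightarrow> r < 1 \<Longrightarrow>
       radial_measure.tail (weight_measure \<nu>) r \<le> D * radial_measure.tail (weight_measure \<nu>) ((1 + r) / 2)"
proof -
  interpret W: radial_measure "weight_measure \<nu>" by (rule weight_radial_measure[OF rw])
  note \<nu> = radial_weightD[OF rw]
  obtain C where mem: "\<And>f. f \<in> Lp_space p \<nu> \<Longrightarrow> bergman_proj \<omega> f \<in> dirichlet_space p \<nu> k"
    and C: "\<And>f. f \<in> Lp_space p \<nu> \<Longrightarrow> dirichlet_norm p \<nu> k (bergman_proj \<omega> f) \<le> C * Lp_norm p \<nu> f"
    using bounded unfolding bergman_proj_bounded_def by blast
  \<comment> \<open>The definition of boundedness leaves the sign of \<open>C\<close> open, hence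
    the absolute value; the summand 1 keeps \<open>c\<close> positive.\<close>
  define c where "c = \<bar>C\<bar> powr p + 1"
  have c: "c > 0" by (simp add: c_def add_nonneg_pos)
  \<comment> \<open>Chosen so that (\<Lambda> / k)^(kp) = 2 c, which is what the halving in
    \<open>power_tail_bound\<close> asks for.\<close>
  define \<Lambda> where "\<Lambda> = real k * (2 * c) powr (1 / (real k * p))"
  have \<Lambda>: "\<Lambda> > 0" using c k by (simp add: \<Lambda>_def)
  have "(\<Lambda> / real k) ^ k = (2 * c) powr (1 / p)"
    using k c p by (simp add: \<Lambda>_def powr_realpow[symmetric] powr_powr)
  then have \<Lambda>2: "2 * c \<le> ((\<Lambda> / real k) ^ k) powr p" using p c by (simp add: powr_powr)
  have "(r ^ n) powr p * W.tail r \<le> 2 * W.tail (1 - \<Lambda> / real n)"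
    if n: "k \<le> n" and r: "0 \<le> r" "r < 1" for n r
  proof (rule W.power_tail_bound[OF _ k n c \<Lambda> \<Lambda>2 _ r])
    show "0 < p" using p by simp
    define f where "f = (\<lambda>z::complex. z ^ n)"
    have f: "f \<in> Lp_space p \<nu>"
      unfolding f_def using monomial_in_bergman_space[OF rw, of p n] p by (simp add: bergman_space_def)
    define P where "P = bergman_proj \<omega> f"
    have PF: "P z = z ^ n" if "cmod z < 1" for z
      unfolding P_def f_def by (rule bergman_proj_monomial[OF \<omega> that])
    have dP: "(deriv ^^ j) P z = (deriv ^^ j) (\<lambda>w. w ^ n) z" if "cmod z < 1" for j z
    proof (rule higher_deriv_cong_ev)
      have "\<forall>\<^sub>F w in nhds z. w \<in> ball 0 1" using that by (intro eventually_nhds_in_open) auto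
      then show "\<forall>\<^sub>F w in nhds z. P w = w ^ n" by eventually_elim (simp add: PF)
    qed auto
    define H where "H z = cmod ((deriv ^^ k) P z) powr p * (1 - cmod z) powr (real k * p)" for z
    define S where "S = (\<Sum>j<k. cmod ((deriv ^^ j) P 0) powr p)"
    define I where "I = (LINT z|disc_area. H z * \<nu> z)"
    define J where "J = (LINT z|disc_area. cmod (f z) powr p * \<nu> z)"
    have intH: "integrable disc_area (\<lambda>z. H z * \<nu> z)"
      using mem[OF f] by (simp add: dirichlet_space_def P_def H_def)
    have S0: "0 \<le> S" by (simp add: S_def sum_nonneg)
    have I0: "0 \<le> I" unfolding I_def using \<nu>(1) by (intro integral_nonneg_AE AE_I2) (simp add: H_def)
    have J0: "0 \<le> J" unfolding J_def using \<nu>(1) by (intro integral_nonneg_AE AE_I2) simp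
    have "(S + I) powr (1 / p) \<le> C * J powr (1 / p)"
      using C[OF f] unfolding dirichlet_norm_def Lp_norm_def S_def I_def J_def H_def P_def .
    also have "\<dots> \<le> \<bar>C\<bar> * J powr (1 / p)" by (intro mult_right_mono) auto
    finally have "((S + I) powr (1 / p)) powr p \<le> (\<bar>C\<bar> * J powr (1 / p)) powr p"
      using p by (intro powr_mono2) auto
    then have "S + I \<le> \<bar>C\<bar> powr p * J" using p S0 I0 J0 by (simp add: powr_mult powr_powr)
    also have "\<dots> \<le> c * J" using J0 by (intro mult_right_mono) (auto simp: c_def)
    finally have IJ: "I \<le> c * J" using S0 by simp
    define g where "g z = ((real n / real k) ^ k * cmod z ^ (n - k) * (1 - cmod z) ^ k) powr p" for z
    have gb: "g \<in> borel_measurable borel" unfolding g_def[abs_def] by measurable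
    note [measurable] = radial_weightD(3)[OF rw] borel_measurable_disc_area[OF gb]
    have gH: "\<nu> z *\<^sub>R g z \<le> H z * \<nu> z" "0 \<le> \<nu> z *\<^sub>R g z" if z: "cmod z < 1" for z
    proof -
      have "g z \<le> (cmod ((deriv ^^ k) P z) * (1 - cmod z) ^ k) powr p"
        unfolding g_def dP[OF z] using z p norm_higher_deriv_power_ge[OF k n, of z]
        by (intro powr_mono2 mult_right_mono) auto
      also have "\<dots> = H z" using z by (simp add: H_def powr_mult powr_realpow[symmetric] powr_powr)
      finally show "\<nu> z *\<^sub>R g z \<le> H z * \<nu> z"
        using mult_left_mono[OF _ \<nu>(1)[OF z]] by (simp add: mult.commute[of "H z"])
      show "0 \<le> \<nu> z *\<^sub>R g z" using \<nu>(1)[OF z] by (simp add: g_def)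
    qed
    have intg: "integrable disc_area (\<lambda>z. \<nu> z *\<^sub>R g z)"
    proof (rule Bochner_Integration.integrable_bound[OF intH])
      show "AE z in disc_area. norm (\<nu> z *\<^sub>R g z) \<le> norm (H z * \<nu> z)"
      proof (rule AE_I2)
        fix z assume "z \<in> space disc_area"
        then have "cmod z < 1" by simp
        from gH[OF this] show "norm (\<nu> z *\<^sub>R g z) \<le> norm (H z * \<nu> z)" by simp
      qed
    qed measurable
    have "(\<integral> z. g z \<partial>weight_measure \<nu>) = (\<integral> z. \<nu> z *\<^sub>R g z \<partial>disc_area)"
      by (rule integral_weight_measure[OF rw gb])
    also have "\<dots> \<le> I" unfolding I_def using gH(1) by (intro integral_mono intg intH) simp
    also note IJ
    also have "J = (\<integral> z. (cmod z ^ n) powr p \<partial>weight_measure \<nu>)"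
      unfolding J_def by (subst integral_weight_measure[OF rw]) (auto simp: f_def norm_power mult.commute)
    finally show "(\<integral> z. ((real n / real k) ^ k * cmod z ^ (n - k) * (1 - cmod z) ^ k) powr p \<partial>weight_measure \<nu>)
        \<le> c * (\<integral> z. (cmod z ^ n) powr p \<partial>weight_measure \<nu>)"
      unfolding g_def .
  qed
  note bound = this
  show thesis
  proof (rule W.doubling_if_power_tail_bound[of p \<Lambda> k])
    show "0 \<le> p" using p by simp
    show "(r ^ n) powr p * W.tail r \<le> 2 * W.tail (1 - \<Lambda> / real n)"
      if "k \<le> n" "0 \<le> r" "r < 1" for n r using that by (rule bound)
  qed (use \<Lambda> in \<open>auto intro: that\<close>)
qed

theorem theorem5:
  fixes p :: real and k :: nat and \<omega> \<nu> :: "complex \<Rightarrow> real"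
  assumes "1 < p" and "1 \<le> k"
    and "radial_weight \<omega>" and "radial_weight \<nu>"
    and "bergman_proj_bounded \<omega> (Lp_space p \<nu>) (Lp_norm p \<nu>)
           (dirichlet_space p \<nu> k) (dirichlet_norm p \<nu> k)"
  shows "bergman_proj_bounded \<nu> (Lp_space p \<nu>) (Lp_norm p \<nu>)
           (dirichlet_space p \<nu> k) (dirichlet_norm p \<nu> k) \<and>
         bergman_proj_bounded \<nu> (Lp_space p \<nu>) (Lp_norm p \<nu>)
           (Lp_space p \<nu>) (Lp_norm p \<nu>)"
proof -
  obtain D where D: "1 \<le> D" "\<And>r. 0 \<le> r \<Longrightarrow> r < 1 \<Longrightarrow>
       radial_measure.tail (weight_measure \<nu>) r \<le> D * radial_measure.tail (weight_measure \<nu>) ((1 + r) / 2)"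
    by (rule doubling_if_bergman_proj_bounded[OF assms]) (rule that)
  show ?thesis
    using bergman_proj_bounded_if_doubling[OF assms(4,1) D] by blast
qed

end
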